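(* Let $\mathcal F$ be a saturated fusion system on a finite $p$-group $S$. The characteristic idempotent $\omega_{\mathcal F}\in A(S,S)_{(p)}$ associated to $\mathcal F$ satisfies: for all graphs $\Delta(P,\varphi)\le S\times S$ with $P\le S$ and $\varphi\in\mathcal F(P,S)$, $$\Phi_{\Delta(P,\varphi)}(\omega_{\mathcal F})=\frac{|S|}{|\mathcal F(P,S)|},$$ and $\Phi_D(\omega_{\mathcal F})=0$ for all other subgroups $D\le S\times S$. Consequently, in terms of the transitive bisets in $A(S,S)_{(p)}$, $$\omega_{\mathcal F}=\sum_{\substack{[\Delta(P,\varphi)]_{S\times S}\\ \text{with }\varphi\in\mathcal F(P,S)}}\frac{|S|}{\Phi_{\Delta(P,\varphi)}([P,\varphi]_S^S)}\Bigl(\sum_{P\le Q\le S}\frac{|\{\psi\in\mathcal F(Q,S)\mid\psi|_P=\varphi\}|}{|\mathcal F(Q,S)|}\cdot\mu(P,Q)\Bigr)[P,\varphi]_S^S,$$ where the outer sum is over $(S\times S)$-conjugacy classes of subgroups $\Delta(P,\varphi)$ with $\varphi\in\mathcal F(P,S)$, and $\mu$ is the Möbius function of the poset of subgroups of $S$.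
   Context: Here $p$ is a prime and $p$-groups are finite. A fusion system $\mathcal F$ on a $p$-group $S$ is a category whose objects are the subgroups of $S$, whose morphism sets $\mathcal F(P,Q)=\mathrm{Hom}_{\mathcal F}(P,Q)$ consist of injective group homomorphisms $P\to Q$ (composed as homomorphisms) and contain all homomorphisms $P\to Q$ induced by conjugation by elements of $S$, and such that for each $\varphi\in\mathcal F(P,Q)$ the isomorphism $\varphi\colon P\to\varphi P$ and its inverse are morphisms of $\mathcal F$. Write $\mathrm{Aut}_{\mathcal F}(P)=\mathcal F(P,P)$. Subgroups $P,Q$ are $\mathcal F$-conjugate if they are isomorphic in $\mathcal F$; $[P]_{\mathcal F}$ is the set of $\mathcal F$-conjugates of $P$. $P$ is fully $\mathcal F$-normalized (resp. fully $\mathcal F$-centralized) if $|N_SP|\ge|N_SQ|$ (resp. $|C_SP|\ge|C_SQ|$) for all $Q\in[P]_{\mathcal F}$. $\mathcal F$ is saturated if for all $P\le S$: (1) if $P$ is fully $\mathcal F$-normalized, then $P$ is fully $\mathcal F$-centralized and $\mathrm{Aut}_S(P)$ is a Sylow $p$-subgroup of $\mathrm{Aut}_{\mathcal F}(P)$; (2) every $\varphi\in\mathcal F(P,S)$ with $\varphi(P)$ fully $\mathcal F$-centralized extends to a morphism in $\mathcal F(N_\varphi,S)$, where $N_\varphi=\{x\in N_S(P)\mid \exists y\in S:\varphi\circ c_x=c_y\circ\varphi\}$. Bisets: for finite groups $G,H$, a $(G,H)$-biset is a finite set with commuting right $G$-action and left $H$-action, regarded as a left $(H\times G)$-set via $(h,g).x=hxg^{-1}$.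 $A(G,H)$ is the Grothendieck group of isomorphism classes of $(G,H)$-bisets under disjoint union; additively it is $A(H\times G)$. For $D\le H\times G$, $\Phi_D\colon A(G,H)\to\mathbb Z$ is the additive map counting $D$-fixed points. Composition $\circ\colon A(H,K)\times A(G,H)\to A(G,K)$ is induced by $Y\circ X=Y\times_HX$. For $U\le G$ and a homomorphism $\varphi\colon U\to H$, $\Delta(U,\varphi)=\{(\varphi(u),u)\mid u\in U\}\le H\times G$ and $[U,\varphi]_G^H=[(H\times G)/\Delta(U,\varphi)]$. The subscript $(p)$ denotes tensoring with $\mathbb Z_{(p)}$. Characteristic idempotent: $X\in A(S,S)_{(p)}$ is $\mathcal F$-generated if it is a $\mathbb Z_{(p)}$-linear combination of elements $[P,\varphi]_S^S$ with $P\le S$, $\varphi\in\mathcal F(P,S)$. It is right $\mathcal F$-stable if $X\circ[P,\varphi]_P^S=X\circ[P,\mathrm{id}]_P^S$, and left $\mathcal F$-stable if $[\varphi P,\varphi^{-1}]_S^P\circ X=[P,\mathrm{id}]_S^P\circ X$, for all $P\le S$, $\varphi\in\mathcal F(P,S)$. It is $\mathcal F$-characteristic if it is $\mathcal F$-generated, left and right $\mathcal F$-stable, and $\varepsilon(X)$ is invertible in $\mathbb Z_{(p)}$, where $\varepsilon$ is the $\mathbb Z_{(p)}$-linear extension of $X\mapsto|X|/|S|$ to the span of left-free bisets. For each saturated $\mathcal F$ there is exactly one idempotent (with respect to $\circ$) in $A(S,S)_{(p)}$ that is $\mathcal F$-characteristic; it is the characteristic idempotent $\omega_{\mathcal F}$.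 *)

theory Defs
  imports
    Complex_Main
    "HOL-Algebra.Group_Action"
    "HOL-Algebra.Left_Coset"
    "HOL-Computational_Algebra.Primes"
    "HOL-Library.Poly_Mapping"
begin

section \<open>Fusion systems\<close>

definition conj_map :: "('a, 'b) monoid_scheme \<Rightarrow> 'a \<Rightarrow> 'a set \<Rightarrow> 'a \<Rightarrow> 'a" where
  "conj_map S x P = (\<lambda>u\<in>P. x \<otimes>\<^bsub>S\<^esub> u \<otimes>\<^bsub>S\<^esub> inv\<^bsub>S\<^esub> x)"

text \<open>
  Morphisms \<open>P \<rightarrow> Q\<close> are functions on the type of \<open>S\<close> that are extensional on \<open>P\<close>, so that
  morphisms are equal iff they agree on \<open>P\<close> and \<open>card (F P Q)\<close> is the number of morphisms.
  The values of \<open>F\<close> at sets that are not subgroups of \<open>S\<close> are irrelevant. Identities and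
  inclusions are morphisms by \<open>conj_in\<close> with \<open>x = \<one>\<close>.
\<close>

locale fusion_system = group S for S (structure) +
  fixes p :: nat and F :: "'a set \<Rightarrow> 'a set \<Rightarrow> ('a \<Rightarrow> 'a) set"
  assumes prime_p: "prime p"
    and p_group: "\<exists>n. order S = p ^ n"
    and mor_mon: "\<lbrakk>subgroup P S; subgroup Q S; \<phi> \<in> F P Q\<rbrakk>
        \<Longrightarrow> \<phi> \<in> extensional P \<and> \<phi> \<in> mon (S\<lparr>carrier := P\<rparr>) (S\<lparr>carrier := Q\<rparr>)"
    and comp_in: "\<lbrakk>subgroup P S; subgroup Q S; subgroup R S; \<phi> \<in> F P Q; \<psi> \<in> F Q R\<rbrakk>
        \<Longrightarrow> compose P \<psi> \<phi> \<in> F P R"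
    and conj_in: "\<lbrakk>subgroup P S; subgroup Q S; x \<in> carrier S; conj_map S x P ` P \<subseteq> Q\<rbrakk>
        \<Longrightarrow> conj_map S x P \<in> F P Q"
    and iso_in: "\<lbrakk>subgroup P S; subgroup Q S; \<phi> \<in> F P Q\<rbrakk>
        \<Longrightarrow> \<phi> \<in> F P (\<phi> ` P) \<and> restrict (inv_into P \<phi>) (\<phi> ` P) \<in> F (\<phi> ` P) P"

definition centralizer :: "('a, 'b) monoid_scheme \<Rightarrow> 'a set \<Rightarrow> 'a set" where
  "centralizer S P = {x \<in> carrier S. \<forall>u\<in>P. x \<otimes>\<^bsub>S\<^esub> u = u \<otimes>\<^bsub>S\<^esub> x}"

definition F_conjugate :: "('a set \<Rightarrow> 'a set \<Rightarrow> ('a \<Rightarrow> 'a) set) \<Rightarrow> 'a set \<Rightarrow> 'a set \<Rightarrow> bool" where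
  "F_conjugate F P Q \<longleftrightarrow>
     (\<exists>\<phi>\<in>F P Q. \<exists>\<psi>\<in>F Q P. (\<forall>x\<in>P. \<psi> (\<phi> x) = x) \<and> (\<forall>y\<in>Q. \<phi> (\<psi> y) = y))"

definition fully_normalized ::
  "('a, 'b) monoid_scheme \<Rightarrow> ('a set \<Rightarrow> 'a set \<Rightarrow> ('a \<Rightarrow> 'a) set) \<Rightarrow> 'a set \<Rightarrow> bool" where
  "fully_normalized S F P \<longleftrightarrow>
     (\<forall>Q. subgroup Q S \<and> F_conjugate F P Q \<longrightarrow> card (normalizer S P) \<ge> card (normalizer S Q))"

definition fully_centralized ::
  "('a, 'b) monoid_scheme \<Rightarrow> ('a set \<Rightarrow> 'a set \<Rightarrow> ('a \<Rightarrow> 'a) set) \<Rightarrow> 'a set \<Rightarrow> bool" where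
  "fully_centralized S F P \<longleftrightarrow>
     (\<forall>Q. subgroup Q S \<and> F_conjugate F P Q \<longrightarrow> card (centralizer S P) \<ge> card (centralizer S Q))"

definition Aut_F :: "('a set \<Rightarrow> 'a set \<Rightarrow> ('a \<Rightarrow> 'a) set) \<Rightarrow> 'a set \<Rightarrow> ('a \<Rightarrow> 'a) monoid" where
  "Aut_F F P = \<lparr>carrier = F P P, monoid.mult = compose P, one = (\<lambda>u\<in>P. u)\<rparr>"

definition Aut_S :: "('a, 'b) monoid_scheme \<Rightarrow> 'a set \<Rightarrow> ('a \<Rightarrow> 'a) set" where
  "Aut_S S P = (\<lambda>x. conj_map S x P) ` normalizer S P"

definition sylow_subgroup :: "nat \<Rightarrow> ('a, 'b) monoid_scheme \<Rightarrow> 'a set \<Rightarrow> bool" where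
  "sylow_subgroup p G H \<longleftrightarrow> subgroup H G \<and> card H = p ^ multiplicity p (order G)"

definition extender :: "('a, 'b) monoid_scheme \<Rightarrow> 'a set \<Rightarrow> ('a \<Rightarrow> 'a) \<Rightarrow> 'a set" where
  "extender S P \<phi> = {x \<in> normalizer S P. \<exists>y\<in>carrier S.
     \<forall>u\<in>P. \<phi> (x \<otimes>\<^bsub>S\<^esub> u \<otimes>\<^bsub>S\<^esub> inv\<^bsub>S\<^esub> x) = y \<otimes>\<^bsub>S\<^esub> \<phi> u \<otimes>\<^bsub>S\<^esub> inv\<^bsub>S\<^esub> y}"

locale saturated_fusion_system = fusion_system +
  assumes sylow_axiom: "\<lbrakk>subgroup P S; fully_normalized S F P\<rbrakk>
        \<Longrightarrow> fully_centralized S F P \<and> sylow_subgroup p (Aut_F F P) (Aut_S S P)"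
    and extension_axiom: "\<lbrakk>subgroup P S; \<phi> \<in> F P (carrier S); fully_centralized S F (\<phi> ` P)\<rbrakk>
        \<Longrightarrow> \<exists>\<psi>\<in>F (extender S P \<phi>) (carrier S). \<forall>u\<in>P. \<psi> u = \<phi> u"


section \<open>Finite \<open>K\<close>-sets\<close>

text \<open>A finite left \<open>K\<close>-set is a pair of its set of points and the action.\<close>

type_synonym ('k, 'x) gset = "'x set \<times> ('k \<Rightarrow> 'x \<Rightarrow> 'x)"

definition is_gset :: "('k, 'm) monoid_scheme \<Rightarrow> ('k, 'x) gset \<Rightarrow> bool" where
  "is_gset K X \<longleftrightarrow> finite (fst X) \<and> group_action K (fst X) (snd X)"

definition gset_iso ::
  "('k, 'm) monoid_scheme \<Rightarrow> ('k, 'x) gset \<Rightarrow> ('k, 'y) gset \<Rightarrow> bool" where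
  "gset_iso K X Y \<longleftrightarrow> (\<exists>f. bij_betw f (fst X) (fst Y) \<and>
     (\<forall>k\<in>carrier K. \<forall>x\<in>fst X. f (snd X k x) = snd Y k (f x)))"

definition gset_sum :: "('k, 'x) gset \<Rightarrow> ('k, 'y) gset \<Rightarrow> ('k, 'x + 'y) gset" where
  "gset_sum X Y =
     (fst X <+> fst Y, \<lambda>k. restrict (map_sum (snd X k) (snd Y k)) (fst X <+> fst Y))"

definition fixed_points :: "'k set \<Rightarrow> ('k, 'x) gset \<Rightarrow> 'x set" where
  "fixed_points D X = {x \<in> fst X. \<forall>d\<in>D. snd X d x = x}"

definition coset_gset :: "('k, 'm) monoid_scheme \<Rightarrow> 'k set \<Rightarrow> ('k, 'k set) gset" where
  "coset_gset K D = (lcosets\<^bsub>K\<^esub> D, \<lambda>k. \<lambda>C\<in>lcosets\<^bsub>K\<^esub> D. k <#\<^bsub>K\<^esub> C)"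


section \<open>Burnside modules localized at \<open>p\<close>\<close>

definition Z_loc :: "nat \<Rightarrow> rat set" where
  "Z_loc p = {of_int a / of_int b |a b. \<not> int p dvd b}"

text \<open>
  The Grothendieck group of isomorphism classes of finite \<open>K\<close>-sets, tensored with the
  localization of the integers at \<open>p\<close>, is presented as the free module over that localization
  on finite \<open>K\<close>-sets modulo the submodule spanned by \<open>[X] - [Y]\<close> for isomorphic
  \<open>X, Y\<close> and by \<open>[Z] - [X] - [Y]\<close> for \<open>Z\<close> isomorphic to the disjoint union of \<open>X\<close> and \<open>Y\<close>.
  Since every finite set is in bijection with a set of natural numbers, generators with points
  in \<^typ>\<open>nat\<close> suffice; this keeps the free module inside one type.
\<close>

type_synonym 'k formal = "('k, nat) gset \<Rightarrow>\<^sub>0 rat"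

definition burnside_free :: "nat \<Rightarrow> ('k, 'm) monoid_scheme \<Rightarrow> 'k formal set" where
  "burnside_free p K = {a. \<forall>X\<in>Poly_Mapping.keys a. is_gset K X \<and> Poly_Mapping.lookup a X \<in> Z_loc p}"

inductive_set burnside_null :: "nat \<Rightarrow> ('k, 'm) monoid_scheme \<Rightarrow> 'k formal set"
  for p :: nat and K :: "('k, 'm) monoid_scheme" where
  zero: "0 \<in> burnside_null p K"
| iso: "\<lbrakk>a \<in> burnside_null p K; c \<in> Z_loc p; is_gset K X; is_gset K Y; gset_iso K X Y\<rbrakk>
    \<Longrightarrow> a + (Poly_Mapping.single X c - Poly_Mapping.single Y c) \<in> burnside_null p K"
| sum: "\<lbrakk>a \<in> burnside_null p K; c \<in> Z_loc p; is_gset K X; is_gset K Y; is_gset K Z;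
      gset_iso K Z (gset_sum X Y)\<rbrakk>
    \<Longrightarrow> a + (Poly_Mapping.single Z c - Poly_Mapping.single X c - Poly_Mapping.single Y c)
        \<in> burnside_null p K"

definition burnside_cls :: "nat \<Rightarrow> ('k, 'm) monoid_scheme \<Rightarrow> 'k formal \<Rightarrow> 'k formal set" where
  "burnside_cls p K a = {b \<in> burnside_free p K. b - a \<in> burnside_null p K}"

text \<open>The elements of the localized Burnside module are the cosets of \<^const>\<open>burnside_null\<close>.\<close>

definition burnside_loc :: "nat \<Rightarrow> ('k, 'm) monoid_scheme \<Rightarrow> 'k formal set set" where
  "burnside_loc p K = burnside_cls p K ` burnside_free p K"

definition burnside_rep :: "'k formal set \<Rightarrow> 'k formal" where
  "burnside_rep \<alpha> = (SOME a. a \<in> \<alpha>)"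

definition nat_model :: "('k, 'm) monoid_scheme \<Rightarrow> ('k, 'x) gset \<Rightarrow> ('k, nat) gset" where
  "nat_model K X = (SOME N. is_gset K N \<and> gset_iso K X N)"

text \<open>
  The linear combination \<open>\<Sum>i\<in>I. c i [X i]\<close> for a finite index set \<open>I\<close> and finite \<open>K\<close>-sets \<open>X i\<close>;
  it is the empty set, hence no element of the module, if the total coefficient of some
  generator is not in \<open>Z_loc p\<close>.
\<close>

definition burnside_comb ::
  "nat \<Rightarrow> ('k, 'm) monoid_scheme \<Rightarrow> 'i set \<Rightarrow> ('i \<Rightarrow> rat) \<Rightarrow> ('i \<Rightarrow> ('k, 'x) gset) \<Rightarrow> 'k formal set"
where
  "burnside_comb p K I c X = burnside_cls p K (\<Sum>i\<in>I. Poly_Mapping.single (nat_model K (X i)) (c i))"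

definition burnside_basic ::
  "nat \<Rightarrow> ('k, 'm) monoid_scheme \<Rightarrow> ('k, 'x) gset \<Rightarrow> 'k formal set" where
  "burnside_basic p K X = burnside_comb p K {()} (\<lambda>_. 1) (\<lambda>_. X)"

text \<open>
  The number of \<open>D\<close>-fixed points extended linearly. It respects the relations, so the choice
  of representative does not matter.
\<close>

definition mark :: "'k set \<Rightarrow> 'k formal set \<Rightarrow> rat" where
  "mark D \<alpha> =
     (let a = burnside_rep \<alpha>
      in \<Sum>X\<in>Poly_Mapping.keys a. Poly_Mapping.lookup a X * of_nat (card (fixed_points D X)))"


section \<open>Bisets\<close>

text \<open>
  A \<open>(G,H)\<close>-biset (\<open>G\<close> acting on the right, \<open>H\<close> on the left) is a left set over \<open>H \<times>\<times> G\<close>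
  via \<open>(h, g).x = h x g\<^sup>-\<^sup>1\<close>, and \<open>A(G,H)\<close> localized at \<open>p\<close> is \<open>burnside_loc p (H \<times>\<times> G)\<close>.
\<close>

text \<open>
  \<open>Y \<times>\<^bsub>H\<^esub> X\<close> for a \<open>(G,H)\<close>-biset \<open>X\<close> and an \<open>(H,K)\<close>-biset \<open>Y\<close>: identifying \<open>(y h, x)\<close> with
  \<open>(y, h x)\<close> amounts to identifying \<open>(y, x)\<close> with \<open>(y h\<^sup>-\<^sup>1, h x)\<close>, where
  \<open>y h\<^sup>-\<^sup>1 = (\<one>, h).y\<close> and \<open>h x = (h, \<one>).x\<close>.
\<close>

definition tensor_rel ::
  "('g, 'm) monoid_scheme \<Rightarrow> ('h, 'n) monoid_scheme \<Rightarrow> ('k, 'o) monoid_scheme \<Rightarrow>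
   ('k \<times> 'h, 'y) gset \<Rightarrow> ('h \<times> 'g, 'x) gset \<Rightarrow> (('y \<times> 'x) \<times> ('y \<times> 'x)) set" where
  "tensor_rel G H K Y X =
     {((y, x), (y', x')) | y x y' x'. y \<in> fst Y \<and> x \<in> fst X \<and>
        (\<exists>h\<in>carrier H. y' = snd Y (\<one>\<^bsub>K\<^esub>, h) y \<and> x' = snd X (h, \<one>\<^bsub>G\<^esub>) x)}"

definition biset_tensor ::
  "('g, 'm) monoid_scheme \<Rightarrow> ('h, 'n) monoid_scheme \<Rightarrow> ('k, 'o) monoid_scheme \<Rightarrow>
   ('k \<times> 'h, 'y) gset \<Rightarrow> ('h \<times> 'g, 'x) gset \<Rightarrow> ('k \<times> 'g, ('y \<times> 'x) set) gset" where
  "biset_tensor G H K Y X =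
     (let E = (fst Y \<times> fst X) // tensor_rel G H K Y X
      in (E, \<lambda>(k, g). \<lambda>C\<in>E. (\<lambda>(y, x). (snd Y (k, \<one>\<^bsub>H\<^esub>) y, snd X (\<one>\<^bsub>H\<^esub>, g) x)) ` C))"

text \<open>
  The bilinear extension \<open>A(H,K) \<times> A(G,H) \<rightarrow> A(G,K)\<close> of \<^const>\<open>biset_tensor\<close>, which is compatible
  with isomorphisms and disjoint unions in both arguments.
\<close>

definition biset_comp ::
  "nat \<Rightarrow> ('g, 'm) monoid_scheme \<Rightarrow> ('h, 'n) monoid_scheme \<Rightarrow> ('k, 'o) monoid_scheme \<Rightarrow>
   ('k \<times> 'h) formal set \<Rightarrow> ('h \<times> 'g) formal set \<Rightarrow> ('k \<times> 'g) formal set" where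
  "biset_comp p G H K \<beta> \<alpha> =
     (let b = burnside_rep \<beta>; a = burnside_rep \<alpha>
      in burnside_comb p (K \<times>\<times> G) (Poly_Mapping.keys b \<times> Poly_Mapping.keys a)
           (\<lambda>(Y, X). Poly_Mapping.lookup b Y * Poly_Mapping.lookup a X) (\<lambda>(Y, X). biset_tensor G H K Y X))"

definition graph :: "'g set \<Rightarrow> ('g \<Rightarrow> 'h) \<Rightarrow> ('h \<times> 'g) set" where
  "graph U \<phi> = (\<lambda>u. (\<phi> u, u)) ` U"

definition graph_biset ::
  "('g, 'm) monoid_scheme \<Rightarrow> ('h, 'n) monoid_scheme \<Rightarrow> 'g set \<Rightarrow> ('g \<Rightarrow> 'h) \<Rightarrow>
   ('h \<times> 'g, ('h \<times> 'g) set) gset" where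
  "graph_biset G H U \<phi> = coset_gset (H \<times>\<times> G) (graph U \<phi>)"

definition graph_elem ::
  "nat \<Rightarrow> ('g, 'm) monoid_scheme \<Rightarrow> ('h, 'n) monoid_scheme \<Rightarrow> 'g set \<Rightarrow> ('g \<Rightarrow> 'h) \<Rightarrow>
   ('h \<times> 'g) formal set" where
  "graph_elem p G H U \<phi> = burnside_basic p (H \<times>\<times> G) (graph_biset G H U \<phi>)"

text \<open>
  The linear extension of \<open>X \<mapsto> |X|/|S|\<close>. The formula makes sense for all \<open>\<alpha>\<close>; it is only used
  on the span of left-free bisets, which contains all \<open>F\<close>-generated elements.
\<close>

definition augmentation :: "('a, 'b) monoid_scheme \<Rightarrow> ('a \<times> 'a) formal set \<Rightarrow> rat" where
  "augmentation S \<alpha> =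
     (let a = burnside_rep \<alpha>
      in \<Sum>X\<in>Poly_Mapping.keys a.
           Poly_Mapping.lookup a X * (of_nat (card (fst X)) / of_nat (order S)))"


section \<open>Characteristic idempotents\<close>

definition fusion_pairs ::
  "('a, 'b) monoid_scheme \<Rightarrow> ('a set \<Rightarrow> 'a set \<Rightarrow> ('a \<Rightarrow> 'a) set) \<Rightarrow> ('a set \<times> ('a \<Rightarrow> 'a)) set" where
  "fusion_pairs S F = {(P, \<phi>). subgroup P S \<and> \<phi> \<in> F P (carrier S)}"

definition F_generated ::
  "nat \<Rightarrow> ('a, 'b) monoid_scheme \<Rightarrow> ('a set \<Rightarrow> 'a set \<Rightarrow> ('a \<Rightarrow> 'a) set) \<Rightarrow>
   ('a \<times> 'a) formal set \<Rightarrow> bool" where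
  "F_generated p S F \<alpha> \<longleftrightarrow>
     (\<exists>I c. finite I \<and> I \<subseteq> fusion_pairs S F \<and> (\<forall>i\<in>I. c i \<in> Z_loc p) \<and>
        \<alpha> = burnside_comb p (S \<times>\<times> S) I c (\<lambda>(P, \<phi>). graph_biset S S P \<phi>))"

definition right_F_stable ::
  "nat \<Rightarrow> ('a, 'b) monoid_scheme \<Rightarrow> ('a set \<Rightarrow> 'a set \<Rightarrow> ('a \<Rightarrow> 'a) set) \<Rightarrow>
   ('a \<times> 'a) formal set \<Rightarrow> bool" where
  "right_F_stable p S F \<alpha> \<longleftrightarrow>
     (\<forall>P \<phi>. subgroup P S \<and> \<phi> \<in> F P (carrier S) \<longrightarrow>
        biset_comp p (S\<lparr>carrier := P\<rparr>) S S \<alpha> (graph_elem p (S\<lparr>carrier := P\<rparr>) S P \<phi>) =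
        biset_comp p (S\<lparr>carrier := P\<rparr>) S S \<alpha> (graph_elem p (S\<lparr>carrier := P\<rparr>) S P id))"

definition left_F_stable ::
  "nat \<Rightarrow> ('a, 'b) monoid_scheme \<Rightarrow> ('a set \<Rightarrow> 'a set \<Rightarrow> ('a \<Rightarrow> 'a) set) \<Rightarrow>
   ('a \<times> 'a) formal set \<Rightarrow> bool" where
  "left_F_stable p S F \<alpha> \<longleftrightarrow>
     (\<forall>P \<phi>. subgroup P S \<and> \<phi> \<in> F P (carrier S) \<longrightarrow>
        biset_comp p S S (S\<lparr>carrier := P\<rparr>)
          (graph_elem p S (S\<lparr>carrier := P\<rparr>) (\<phi> ` P) (inv_into P \<phi>)) \<alpha> =
        biset_comp p S S (S\<lparr>carrier := P\<rparr>) (graph_elem p S (S\<lparr>carrier := P\<rparr>) P id) \<alpha>)"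

definition F_characteristic ::
  "nat \<Rightarrow> ('a, 'b) monoid_scheme \<Rightarrow> ('a set \<Rightarrow> 'a set \<Rightarrow> ('a \<Rightarrow> 'a) set) \<Rightarrow>
   ('a \<times> 'a) formal set \<Rightarrow> bool" where
  "F_characteristic p S F \<alpha> \<longleftrightarrow>
     F_generated p S F \<alpha> \<and> left_F_stable p S F \<alpha> \<and> right_F_stable p S F \<alpha> \<and>
     augmentation S \<alpha> \<in> Z_loc p \<and> (\<exists>u\<in>Z_loc p. augmentation S \<alpha> * u = 1)"

definition characteristic_idempotent ::
  "nat \<Rightarrow> ('a, 'b) monoid_scheme \<Rightarrow> ('a set \<Rightarrow> 'a set \<Rightarrow> ('a \<Rightarrow> 'a) set) \<Rightarrow>
   ('a \<times> 'a) formal set \<Rightarrow> bool" where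
  "characteristic_idempotent p S F \<omega> \<longleftrightarrow>
     \<omega> \<in> burnside_loc p (S \<times>\<times> S) \<and> biset_comp p S S S \<omega> \<omega> = \<omega> \<and> F_characteristic p S F \<omega>"


section \<open>Moebius function and conjugacy classes of subgroups\<close>

text \<open>The Moebius function of a family \<open>A\<close> of finite sets ordered by inclusion.\<close>

function mobius :: "'a set set \<Rightarrow> 'a set \<Rightarrow> 'a set \<Rightarrow> int" where
  "mobius A P Q =
     (if finite Q \<and> P \<subseteq> Q
      then if P = Q then 1 else - (\<Sum>R\<in>{R \<in> A. P \<subseteq> R \<and> R \<subset> Q}. mobius A P R)
      else 0)"
  by pat_completeness auto
termination
  by (relation "measure (\<lambda>(A, P, Q). card Q)") (auto intro: psubset_card_mono)

declare mobius.simps [simp del]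

definition subgroups_conjugate :: "('k, 'm) monoid_scheme \<Rightarrow> 'k set \<Rightarrow> 'k set \<Rightarrow> bool" where
  "subgroups_conjugate K D E \<longleftrightarrow> (\<exists>k\<in>carrier K. E = k <#\<^bsub>K\<^esub> D #>\<^bsub>K\<^esub> inv\<^bsub>K\<^esub> k)"

text \<open>
  \<open>R\<close> contains exactly one pair \<open>(P, \<phi>)\<close> for each \<open>S \<times> S\<close>-conjugacy class of subgroups
  \<open>graph P \<phi>\<close> with \<open>\<phi>\<close> in \<open>F P (carrier S)\<close>.
\<close>

definition graph_representatives ::
  "('a, 'b) monoid_scheme \<Rightarrow> ('a set \<Rightarrow> 'a set \<Rightarrow> ('a \<Rightarrow> 'a) set) \<Rightarrow>
   ('a set \<times> ('a \<Rightarrow> 'a)) set \<Rightarrow> bool" where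
  "graph_representatives S F R \<longleftrightarrow>
     R \<subseteq> fusion_pairs S F \<and>
     (\<forall>(P, \<phi>)\<in>fusion_pairs S F.
        \<exists>!r. r \<in> R \<and> subgroups_conjugate (S \<times>\<times> S) (graph P \<phi>) (graph (fst r) (snd r)))"

end

theory Submission
  imports Defs
begin

text \<open>
  Fixed points, the augmentation and the fixed points of a composition depend on a finite set with
  action only through the stabilizers of its points. For a function \<open>w\<close> on subgroups, the sum of
  \<open>w\<close> over all point stabilizers is additive and invariant under isomorphism, so it descends to a
  linear functional \<^term>\<open>weight K w\<close> on the localized Burnside module. All computations below
  take place in these functionals. For an \<open>F\<close>-generated element they only see the values of \<open>w\<close> on
  graphs of morphisms of \<open>F\<close>, because the stabilizers of \<open>(S \<times> S) / \<Delta>(P, \<phi>)\<close> are the conjugates of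
  \<open>\<Delta>(P, \<phi>)\<close>, which are again such graphs (\<open>weight_cong_F_graphs\<close>). In particular the marks of
  \<open>\<omega>\<close> vanish at every subgroup that is not a graph of this kind.

  Composing with \<open>[P, \<phi>]\<close> restricts an action along \<open>\<phi>\<close>. So stability says that the mark of \<open>\<omega>\<close>
  at \<open>\<Delta>(P, \<phi>)\<close> does not depend on \<open>\<phi>\<close>, and that this common value \<open>f(P)\<close> is the same for
  \<open>F\<close>-conjugate subgroups (\<open>mark_F_stable\<close>). A fixed point of \<open>\<Delta>(P, id)\<close> on a composition
  \<open>Y \<times>\<^bsub>S\<^esub> X\<close> of \<open>F\<close>-generated bisets is an orbit of pairs, and such a pair determines the morphism
  \<open>\<eta> : P \<rightarrow> S\<close> that transports the action of \<open>P\<close> from \<open>X\<close> to \<open>Y\<close>. Hence \<open>\<omega> = \<omega> \<circ> \<omega>\<close> gives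
  \<open>f(P) = |F(P, S)| f(P)\<^sup>2 / |S|\<close>, so \<open>f(P)\<close> is either \<open>0\<close> or \<open>|S| / |F(P, S)|\<close>.

  The value \<open>0\<close> is excluded by counting modulo \<open>p\<close>. The number \<open>|F(P, S)| f(P) / |S|\<close> is the linear
  extension of counting the \<open>P\<close>-fixed points on the set of left \<open>S\<close>-orbits of a biset, and the
  augmentation counts all these orbits. As \<open>P\<close> is a \<open>p\<close>-group, the two numbers agree modulo \<open>p\<close> in the localization
  (\<open>augmentation_congruence\<close>), and the augmentation is a unit.

  For the formula in terms of transitive bisets, \<open>\<omega>\<close> is first written as a combination of
  one biset for each conjugacy class of graphs. The coefficient at \<open>(P, \<phi>)\<close> is then read off from
  the number of points whose stabilizer is exactly \<open>\<Delta>(P, \<phi>)\<close>. Moebius inversion over the subgroups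
  \<open>Q \<ge> P\<close> expresses this number by the marks (\<open>weight_eq_graph\<close>), which are already known.
\<close>

section \<open>Finite sets with a group action\<close>

lemma group_actionI:
  assumes "group K"
    and ext: "\<And>k. k \<in> carrier K \<Longrightarrow> act k \<in> extensional E"
    and closed: "\<And>k x. \<lbrakk>k \<in> carrier K; x \<in> E\<rbrakk> \<Longrightarrow> act k x \<in> E"
    and one: "\<And>x. x \<in> E \<Longrightarrow> act \<one>\<^bsub>K\<^esub> x = x"
    and mult: "\<And>k l x. \<lbrakk>k \<in> carrier K; l \<in> carrier K; x \<in> E\<rbrakk>
        \<Longrightarrow> act (k \<otimes>\<^bsub>K\<^esub> l) x = act k (act l x)"
  shows "group_action K E act"
proof -
  interpret group K by fact
  have bij: "act k \<in> Bij E" if k: "k \<in> carrier K" for k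
  proof -
    have "bij_betw (act k) E E"
    proof (rule bij_betw_byWitness[where f' = "act (inv\<^bsub>K\<^esub> k)"])
      show "\<forall>x\<in>E. act (inv\<^bsub>K\<^esub> k) (act k x) = x"
        using mult[of "inv\<^bsub>K\<^esub> k" k] k one by auto
      show "\<forall>x\<in>E. act k (act (inv\<^bsub>K\<^esub> k) x) = x"
        using mult[of k "inv\<^bsub>K\<^esub> k"] k one by auto
    qed (use closed k in auto)
    then show ?thesis using ext[OF k] by (simp add: Bij_def)
  qed
  have "act \<in> hom K (BijGroup E)"
  proof (rule homI)
    fix k l assume kl: "k \<in> carrier K" "l \<in> carrier K"
    have "act (k \<otimes>\<^bsub>K\<^esub> l) = compose E (act k) (act l)"
      by (rule extensionalityI[where A = E]) (use kl ext mult in \<open>auto simp: compose_def\<close>)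
    then show "act (k \<otimes>\<^bsub>K\<^esub> l) = act k \<otimes>\<^bsub>BijGroup E\<^esub> act l"
      using bij kl by (simp add: BijGroup_def)
  qed (use bij in \<open>simp add: BijGroup_def\<close>)
  then show ?thesis
    unfolding group_action_def
    by (intro group_hom.intro group_hom_axioms.intro group_BijGroup \<open>group K\<close>)
qed

lemma is_gset_group_action: "is_gset K X \<Longrightarrow> group_action K (fst X) (snd X)"
  by (simp add: is_gset_def)

lemma is_gset_finite: "is_gset K X \<Longrightarrow> finite (fst X)"
  by (simp add: is_gset_def)

lemma is_gset_closed: "\<lbrakk>is_gset K X; k \<in> carrier K; x \<in> fst X\<rbrakk> \<Longrightarrow> snd X k x \<in> fst X"
  by (meson group_action.element_image is_gset_group_action)

lemma is_gset_one: "\<lbrakk>is_gset K X; x \<in> fst X\<rbrakk> \<Longrightarrow> snd X \<one>\<^bsub>K\<^esub> x = x"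
  by (metis group_action.id_eq_one is_gset_group_action restrict_apply')

lemma is_gset_mult:
  "\<lbrakk>is_gset K X; k \<in> carrier K; l \<in> carrier K; x \<in> fst X\<rbrakk>
    \<Longrightarrow> snd X (k \<otimes>\<^bsub>K\<^esub> l) x = snd X k (snd X l x)"
  by (rule group_action.composition_rule[OF is_gset_group_action])

lemma nat_model:
  assumes X: "is_gset K X" and "group K"
  shows "is_gset K (nat_model K X)" "gset_iso K X (nat_model K X)"
proof -
  obtain f where f: "bij_betw f (fst X) {0..<card (fst X)}"
    using ex_bij_betw_finite_nat is_gset_finite[OF X] by blast
  let ?N = "{0..<card (fst X)}" and ?g = "inv_into (fst X) f"
  let ?act = "\<lambda>k. \<lambda>n\<in>?N. f (snd X k (?g n))"
  have g: "?g n \<in> fst X" "f (?g n) = n" if "n \<in> ?N" for n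
    using f that by (auto simp: bij_betw_def inv_into_into f_inv_into_f)
  have f_in: "f x \<in> ?N" and gf: "?g (f x) = x" if "x \<in> fst X" for x
    using f that by (auto simp: bij_betw_def)
  interpret group K by fact
  have "group_action K ?N ?act"
  proof (rule group_actionI)
    show "?act k n \<in> ?N" if "k \<in> carrier K" "n \<in> ?N" for k n
      using that g f_in is_gset_closed[OF X] by auto
    show "?act \<one>\<^bsub>K\<^esub> n = n" if "n \<in> ?N" for n
      using that g is_gset_one[OF X] by auto
    show "?act (k \<otimes>\<^bsub>K\<^esub> l) n = ?act k (?act l n)"
      if "k \<in> carrier K" "l \<in> carrier K" "n \<in> ?N" for k l n
    proof -
      have "f (snd X l (?g n)) \<in> ?N" "snd X l (?g n) \<in> fst X"
        using that g f_in is_gset_closed[OF X] by auto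
      then show ?thesis
        using that g gf is_gset_mult[OF X] by auto
    qed
  qed (auto intro: \<open>group K\<close>)
  then have "is_gset K (?N, ?act)"
    by (simp add: is_gset_def)
  moreover have "gset_iso K X (?N, ?act)"
    unfolding gset_iso_def
  proof (intro exI conjI ballI)
    show "bij_betw f (fst X) (fst (?N, ?act))" using f by simp
    show "f (snd X k x) = snd (?N, ?act) k (f x)" if "k \<in> carrier K" "x \<in> fst X" for k x
      using f_in[OF that(2)] gf[OF that(2)] by simp
  qed
  ultimately have "is_gset K (nat_model K X) \<and> gset_iso K X (nat_model K X)"
    unfolding nat_model_def by (rule someI[where P = "\<lambda>N. is_gset K N \<and> gset_iso K X N", OF conjI])
  then show "is_gset K (nat_model K X)" "gset_iso K X (nat_model K X)" by auto
qed

text \<open>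
  The invariant through which everything else is computed: taking for \<open>w\<close> the indicator of the
  subgroups that contain \<open>D\<close> gives the number of \<open>D\<close>-fixed points, and a constant \<open>w\<close> gives a multiple
  of the number of points.
\<close>

definition stab_sum :: "('k, 'm) monoid_scheme \<Rightarrow> ('k set \<Rightarrow> rat) \<Rightarrow> ('k, 'x) gset \<Rightarrow> rat" where
  "stab_sum K w X = (\<Sum>x\<in>fst X. w (stabilizer K (snd X) x))"

lemma stab_sum_iso:
  assumes X: "is_gset K X" and iso: "gset_iso K X Y"
  shows "stab_sum K w X = stab_sum K w Y"
proof -
  obtain f where f: "bij_betw f (fst X) (fst Y)"
    and eq: "\<And>k x. \<lbrakk>k \<in> carrier K; x \<in> fst X\<rbrakk> \<Longrightarrow> f (snd X k x) = snd Y k (f x)"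
    using iso by (auto simp: gset_iso_def)
  have "stabilizer K (snd X) x = stabilizer K (snd Y) (f x)" if x: "x \<in> fst X" for x
  proof -
    have "f (snd X k x) = f x \<longleftrightarrow> snd X k x = x" if "k \<in> carrier K" for k
      using f x is_gset_closed[OF X that x] by (auto simp: bij_betw_def inj_on_eq_iff)
    then show ?thesis using eq x by (auto simp: stabilizer_def)
  qed
  then show ?thesis
    unfolding stab_sum_def
    by (subst sum.reindex_bij_betw[OF f, symmetric]) (auto intro!: sum.cong)
qed

lemma stab_sum_gset_sum:
  assumes "finite (fst X)" "finite (fst Y)"
  shows "stab_sum K w (gset_sum X Y) = stab_sum K w X + stab_sum K w Y"
proof -
  have "stabilizer K (snd (gset_sum X Y)) (Inl x) = stabilizer K (snd X) x" if "x \<in> fst X" for x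
    using that by (auto simp: stabilizer_def gset_sum_def)
  moreover have "stabilizer K (snd (gset_sum X Y)) (Inr y) = stabilizer K (snd Y) y"
    if "y \<in> fst Y" for y
    using that by (auto simp: stabilizer_def gset_sum_def)
  moreover have "fst (gset_sum X Y) = fst X <+> fst Y" by (simp add: gset_sum_def)
  ultimately show ?thesis
    using assms by (simp add: stab_sum_def sum.Plus)
qed

lemma card_fixed_points:
  assumes "is_gset K X" "D \<subseteq> carrier K"
  shows "of_nat (card (fixed_points D X)) = stab_sum K (\<lambda>E. of_bool (D \<subseteq> E)) X"
proof -
  have "fixed_points D X = {x \<in> fst X. D \<subseteq> stabilizer K (snd X) x}"
    using assms(2) by (auto simp: fixed_points_def stabilizer_def)
  then show ?thesis
    using is_gset_finite[OF assms(1)]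
    by (simp add: stab_sum_def sum.If_cases of_bool_def Int_def)
qed

definition conj_set :: "('k, 'm) monoid_scheme \<Rightarrow> 'k \<Rightarrow> 'k set \<Rightarrow> 'k set" where
  "conj_set K k D = (\<lambda>d. k \<otimes>\<^bsub>K\<^esub> d \<otimes>\<^bsub>K\<^esub> inv\<^bsub>K\<^esub> k) ` D"

context group
begin

lemma conj_set_eq_cosets: "conj_set G k D = k <# D #> inv k"
  by (auto simp: conj_set_def l_coset_def r_coset_def)

lemma subgroup_conj_set: "\<lbrakk>k \<in> carrier G; subgroup D G\<rbrakk> \<Longrightarrow> subgroup (conj_set G k D) G"
  by (simp add: conj_set_eq_cosets subgroup_conjugation_is_surj2)

lemma conj_set_conj_set:
  "\<lbrakk>k \<in> carrier G; l \<in> carrier G; D \<subseteq> carrier G\<rbrakk>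
    \<Longrightarrow> conj_set G k (conj_set G l D) = conj_set G (k \<otimes> l) D"
  unfolding conj_set_def image_image
  by (intro image_cong) (auto simp: m_assoc inv_mult_group subset_iff)

lemma conj_set_one: "D \<subseteq> carrier G \<Longrightarrow> conj_set G \<one> D = D"
  unfolding conj_set_def by (force simp: subset_iff image_iff)

lemma conj_set_mono: "D \<subseteq> E \<Longrightarrow> conj_set G k D \<subseteq> conj_set G k E"
  by (auto simp: conj_set_def)

lemma conj_set_subset_iff:
  assumes "k \<in> carrier G" "D \<subseteq> carrier G" "E \<subseteq> carrier G"
  shows "conj_set G k D \<subseteq> conj_set G k E \<longleftrightarrow> D \<subseteq> E"
proof
  assume "conj_set G k D \<subseteq> conj_set G k E"
  from conj_set_mono[OF this, of "inv k"] show "D \<subseteq> E"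
    using assms by (simp add: conj_set_conj_set conj_set_one)
qed (rule conj_set_mono)

lemma card_conj_set: "\<lbrakk>k \<in> carrier G; D \<subseteq> carrier G\<rbrakk> \<Longrightarrow> card (conj_set G k D) = card D"
  unfolding conj_set_def by (rule card_image) (auto simp: inj_on_def subset_iff)

lemma stabilizer_translate:
  assumes X: "is_gset G X" and k: "k \<in> carrier G" and x: "x \<in> fst X"
  shows "stabilizer G (snd X) (snd X k x) = conj_set G k (stabilizer G (snd X) x)"
proof (intro equalityI subsetI)
  fix g assume "g \<in> stabilizer G (snd X) (snd X k x)"
  then have g: "g \<in> carrier G" "snd X g (snd X k x) = snd X k x"
    by (auto simp: stabilizer_def)
  have "snd X (inv k \<otimes> g \<otimes> k) x = x"
    using X k x g by (simp add: is_gset_mult[OF X] is_gset_closed[OF X])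
      (metis X inv_closed is_gset_mult is_gset_one l_inv)
  then have "inv k \<otimes> g \<otimes> k \<in> stabilizer G (snd X) x"
    using k g by (simp add: stabilizer_def)
  moreover have "g = k \<otimes> (inv k \<otimes> g \<otimes> k) \<otimes> inv k"
    using k g conjugation_is_surj by metis
  ultimately show "g \<in> conj_set G k (stabilizer G (snd X) x)"
    by (auto simp: conj_set_def)
next
  fix g assume "g \<in> conj_set G k (stabilizer G (snd X) x)"
  then obtain h where h: "h \<in> carrier G" "snd X h x = x" "g = k \<otimes> h \<otimes> inv k"
    by (auto simp: conj_set_def stabilizer_def)
  then have "snd X g (snd X k x) = snd X (g \<otimes> k) x"
    using X k x by (simp add: is_gset_mult)
  also have "g \<otimes> k = k \<otimes> h" using h k by (simp add: m_assoc)
  also have "snd X (k \<otimes> h) x = snd X k x" using h k X x by (simp add: is_gset_mult)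
  finally show "g \<in> stabilizer G (snd X) (snd X k x)"
    using h k by (simp add: stabilizer_def)
qed

text \<open>
  Translation by \<open>k\<close> permutes the points and conjugates their stabilizers by \<open>k\<close>.
\<close>

lemma stab_sum_conj:
  assumes X: "is_gset G X" and k: "k \<in> carrier G"
  shows "stab_sum G (\<lambda>E. w (conj_set G k E)) X = stab_sum G w X"
proof -
  interpret group_action G "fst X" "snd X" by (rule is_gset_group_action[OF X])
  have "bij_betw (snd X k) (fst X) (fst X)"
    using inj_prop[OF k] surj_prop[OF k] by (simp add: bij_betw_def)
  then have "(\<Sum>x\<in>fst X. w (stabilizer G (snd X) (snd X k x))) = stab_sum G w X"
    unfolding stab_sum_def by (rule sum.reindex_bij_betw)
  then show ?thesis
    using stabilizer_translate[OF X k] by (simp add: stab_sum_def cong: sum.cong)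
qed

lemma is_gset_coset_gset:
  assumes fin: "finite (carrier G)" and D: "subgroup D G"
  shows "is_gset G (coset_gset G D)"
proof -
  let ?E = "lcosets D" and ?act = "\<lambda>k. \<lambda>C\<in>lcosets D. k <# C"
  have sub: "C \<subseteq> carrier G" if "C \<in> ?E" for C
    using subgroup.lcosets_carrier[OF D is_group] that by blast
  have in_E: "k <# C \<in> ?E" if kC: "k \<in> carrier G" "C \<in> ?E" for k C
  proof -
    obtain a where a: "a \<in> carrier G" "C = a <# D"
      using kC(2) by (auto simp: LCOSETS_def)
    then have "k <# C = (k \<otimes> a) <# D"
      using that D subgroup.subset[OF D] by (simp add: lcos_m_assoc)
    moreover have "k \<otimes> a \<in> carrier G" using a that by simp
    ultimately show ?thesis unfolding LCOSETS_def by blast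
  qed
  have "group_action G ?E ?act"
  proof (rule group_actionI)
    show "?act (k \<otimes> l) C = ?act k (?act l C)"
      if "k \<in> carrier G" "l \<in> carrier G" "C \<in> ?E" for k l C
      using that in_E[OF that(2,3)] sub[OF that(3)] by (simp add: lcos_m_assoc)
    show "?act \<one> C = C" if "C \<in> ?E" for C
      using that sub[OF that] by (simp add: lcos_mult_one)
    show "?act k C \<in> ?E" if "k \<in> carrier G" "C \<in> ?E" for k C
      using that in_E[OF that] by simp
  qed (simp_all add: is_group)
  moreover have "finite ?E" using fin by (simp add: LCOSETS_def)
  ultimately show ?thesis by (simp add: is_gset_def coset_gset_def)
qed

lemma stabilizer_coset_gset:
  assumes D: "subgroup D G" and k: "k \<in> carrier G"
  shows "stabilizer G (snd (coset_gset G D)) (k <# D) = conj_set G k D"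
proof -
  have kD: "k <# D \<in> lcosets D" using k by (auto simp: LCOSETS_def)
  have sub: "D \<subseteq> carrier G" by (rule subgroup.subset[OF D])
  have "g <# (k <# D) = k <# D \<longleftrightarrow> g \<in> conj_set G k D" if g: "g \<in> carrier G" for g
  proof
    assume "g <# (k <# D) = k <# D"
    then have "(g \<otimes> k) <# D = k <# D" using g k sub by (simp add: lcos_m_assoc)
    then have "g \<otimes> k \<in> k <# D" using lcos_self[of "g \<otimes> k" D] g k D by auto
    then obtain d where d: "d \<in> D" "g \<otimes> k = k \<otimes> d" by (auto simp: l_coset_def)
    have dG: "d \<in> carrier G" using d sub by auto
    have "g = k \<otimes> d \<otimes> inv k"
      using g k dG d(2)[symmetric] by (simp add: m_assoc)
    then show "g \<in> conj_set G k D" using d by (auto simp: conj_set_def)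
  next
    assume "g \<in> conj_set G k D"
    then obtain d where d: "d \<in> D" "g = k \<otimes> d \<otimes> inv k" by (auto simp: conj_set_def)
    have dG: "d \<in> carrier G" using d sub by auto
    have "g <# (k <# D) = (g \<otimes> k) <# D" using g k sub by (simp add: lcos_m_assoc)
    also have "g \<otimes> k = k \<otimes> d" using d dG k by (simp add: m_assoc)
    also have "(k \<otimes> d) <# D = k <# (d <# D)" using d dG k sub by (simp add: lcos_m_assoc)
    also have "d <# D = D"
      using d D dG coset_join3 by blast
    finally show "g <# (k <# D) = k <# D" .
  qed
  moreover have "conj_set G k D \<subseteq> carrier G"
    using subgroup.subset[OF subgroup_conj_set[OF k D]] .
  ultimately show ?thesis
    using kD by (auto simp: stabilizer_def coset_gset_def)
qed

text \<open>
  The stabilizer of \<open>k D\<close> is \<open>k D k\<^sup>-\<^sup>1\<close>, and each coset arises from \<open>|D|\<close> elements \<open>k\<close>. Summing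
  over group elements instead of cosets makes transitive sets easy to compute with.
\<close>

lemma stab_sum_coset_gset:
  assumes fin: "finite (carrier G)" and D: "subgroup D G"
  shows "stab_sum G w (coset_gset G D) = (\<Sum>k\<in>carrier G. w (conj_set G k D)) / of_nat (card D)"
proof -
  let ?X = "coset_gset G D"
  have finC: "\<forall>C\<in>lcosets D. finite C"
    using subgroup.lcosets_carrier[OF D is_group] fin finite_subset by blast
  have "(\<Sum>k\<in>carrier G. w (conj_set G k D))
      = (\<Sum>k\<in>\<Union>(lcosets D). w (stabilizer G (snd ?X) (k <# D)))"
    using stabilizer_coset_gset[OF D] lcosets_part_G[OF D] by simp
  also have "\<dots> = (\<Sum>C\<in>lcosets D. \<Sum>k\<in>C. w (stabilizer G (snd ?X) (k <# D)))"
    using sum.Union_disjoint[OF finC] lcos_disjoint[OF D] by fastforce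
  also have "\<dots> = (\<Sum>C\<in>lcosets D. of_nat (card D) * w (stabilizer G (snd ?X) C))"
  proof (rule sum.cong[OF refl])
    fix C assume C: "C \<in> lcosets D"
    have "k <# D = C" if k: "k \<in> C" for k
    proof -
      have kG: "k \<in> carrier G" using k C lcosets_part_G[OF D] by auto
      then have "k <# D \<in> lcosets D" by (auto simp: LCOSETS_def)
      moreover have "k \<in> k <# D" by (rule lcos_self[OF kG D])
      ultimately show ?thesis using lcos_disjoint[OF D C] k by blast
    qed
    then have "(\<Sum>k\<in>C. w (stabilizer G (snd ?X) (k <# D))) = of_nat (card C) * w (stabilizer G (snd ?X) C)"
      by simp
    also have "card C = card D"
      using l_card_cosets_equal[OF C subgroup.subset[OF D] fin] by simp
    finally show "(\<Sum>k\<in>C. w (stabilizer G (snd ?X) (k <# D))) = of_nat (card D) * w (stabilizer G (snd ?X) C)" .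
  qed
  also have "\<dots> = of_nat (card D) * stab_sum G w ?X"
    by (simp add: stab_sum_def sum_distrib_left coset_gset_def)
  finally have *: "(\<Sum>k\<in>carrier G. w (conj_set G k D)) = of_nat (card D) * stab_sum G w ?X" .
  have "card D > 0"
    using fin D subgroup.finite_imp_card_positive by blast
  then show ?thesis using * by simp
qed

end

section \<open>Orbits of commuting actions\<close>

text \<open>
  The orbits of \<open>H\<close> on \<open>Z\<close> carry an action of every group \<open>L\<close> that commutes with \<open>H\<close>. An orbit is
  fixed by \<open>l\<close> iff \<open>l\<close> moves one (equivalently each) of its points inside the orbit, and by the
  orbit-stabilizer theorem the weights \<open>|Stab z| / |H|\<close> of the points of an orbit add up to \<open>1\<close>. So
  fixed orbits can be counted by a sum over points, without any freeness assumption.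
\<close>

lemma orbit_gset:
  assumes L: "group_action L Z \<rho>" and H: "group_action H Z \<sigma>"
    and finZ: "finite Z" and finH: "finite (carrier H)"
    and comm: "\<And>l h z. \<lbrakk>l \<in> carrier L; h \<in> carrier H; z \<in> Z\<rbrakk> \<Longrightarrow> \<rho> l (\<sigma> h z) = \<sigma> h (\<rho> l z)"
  defines "X \<equiv> (orbits H Z \<sigma>, \<lambda>l. \<lambda>C\<in>orbits H Z \<sigma>. \<rho> l ` C)"
  shows "is_gset L X"
    and "D \<subseteq> carrier L \<Longrightarrow> of_nat (card (fixed_points D X))
      = (\<Sum>z\<in>Z. of_bool (\<forall>d\<in>D. \<exists>h\<in>carrier H. \<rho> d z = \<sigma> h z)
           * of_nat (card (stabilizer H \<sigma> z)) / (of_nat (order H) :: rat))"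
proof -
  interpret L: group_action L Z \<rho> by fact
  interpret H: group_action H Z \<sigma> by fact
  have grL: "group L" and grH: "group H"
    using L.group_hom H.group_hom by (auto simp: group_hom_def)
  have img: "\<rho> l ` orbit H \<sigma> z = orbit H \<sigma> (\<rho> l z)" if "l \<in> carrier L" "z \<in> Z" for l z
    using comm[OF that(1) _ that(2)] by (force simp: orbit_def image_iff)
  have mem: "z \<in> Z" if "C \<in> orbits H Z \<sigma>" "z \<in> C" for C z
    using that H.orbits_coverture by auto
  have orb: "C = orbit H \<sigma> z" if "C \<in> orbits H Z \<sigma>" "z \<in> C" for C z
  proof -
    have zZ: "z \<in> Z" by (rule mem[OF that])
    then have "orbit H \<sigma> z \<in> orbits H Z \<sigma>" by (auto simp: orbits_def)
    then show ?thesis using H.disjoint_union[OF that(1)] H.orbit_refl[OF zZ] that(2) by blast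
  qed
  have "group_action L (orbits H Z \<sigma>) (snd X)"
  proof (rule group_actionI[OF grL])
    fix k l C assume kl: "k \<in> carrier L" "l \<in> carrier L" and C: "C \<in> orbits H Z \<sigma>"
    have "\<rho> l ` C \<in> orbits H Z \<sigma>" if "l \<in> carrier L" for l
    proof -
      obtain z where "z \<in> Z" "C = orbit H \<sigma> z" using C by (auto simp: orbits_def)
      then show ?thesis using img[OF that] L.element_image[OF that] by (auto simp: orbits_def)
    qed
    then show "snd X (k \<otimes>\<^bsub>L\<^esub> l) C = snd X k (snd X l C)" "snd X k C \<in> orbits H Z \<sigma>"
      using kl C mem[OF C]
      by (auto simp: X_def group.is_monoid[OF grL] monoid.m_closed image_image L.composition_rule
          cong: image_cong)
  next
    fix C assume C: "C \<in> orbits H Z \<sigma>"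
    have "\<rho> \<one>\<^bsub>L\<^esub> z = z" if "z \<in> C" for z
      using L.id_eq_one mem[OF C that] by (metis restrict_apply')
    then show "snd X \<one>\<^bsub>L\<^esub> C = C" using C by (simp add: X_def)
  qed (simp add: X_def)
  moreover have "finite (orbits H Z \<sigma>)" using finZ by (simp add: orbits_def)
  ultimately show "is_gset L X" by (simp add: is_gset_def X_def)
  assume D: "D \<subseteq> carrier L"
  let ?P = "\<lambda>z. \<forall>d\<in>D. \<exists>h\<in>carrier H. \<rho> d z = \<sigma> h z"
  have fixed: "?P z \<longleftrightarrow> C \<in> fixed_points D X" if C: "C \<in> orbits H Z \<sigma>" and z: "z \<in> C" for C z
  proof -
    have zZ: "z \<in> Z" by (rule mem[OF C z])
    have "(\<exists>h\<in>carrier H. \<rho> d z = \<sigma> h z) \<longleftrightarrow> \<rho> d ` C = C" if d: "d \<in> D" for d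
    proof -
      have dL: "d \<in> carrier L" using d D by auto
      have C_eq: "C = orbit H \<sigma> z" by (rule orb[OF C z])
      have dz: "\<rho> d z \<in> Z" using L.element_image[OF dL zZ] by simp
      have "\<rho> d ` C = orbit H \<sigma> (\<rho> d z)" using C_eq img[OF dL zZ] by simp
      moreover have "orbit H \<sigma> (\<rho> d z) = C \<longleftrightarrow> \<rho> d z \<in> C"
        using orb[OF C] H.orbit_refl[OF dz] by blast
      moreover have "\<rho> d z \<in> C \<longleftrightarrow> (\<exists>h\<in>carrier H. \<rho> d z = \<sigma> h z)"
        by (auto simp: C_eq orbit_def)
      ultimately show ?thesis by simp
    qed
    then show ?thesis using C by (auto simp: fixed_points_def X_def)
  qed
  have ord: "order H > 0" 

    using finH monoid.one_closed[OF group.is_monoid[OF grH]]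
    unfolding order_def card_gt_0_iff by blast
  have "(\<Sum>z\<in>Z. of_bool (?P z) * of_nat (card (stabilizer H \<sigma> z)) / (of_nat (order H) :: rat))
    = (\<Sum>C\<in>orbits H Z \<sigma>. \<Sum>z\<in>C. of_bool (?P z) * of_nat (card (stabilizer H \<sigma> z)) / of_nat (order H))"
    by (rule H.disjoint_sum[OF finZ, symmetric])
  also have "\<dots> = (\<Sum>C\<in>orbits H Z \<sigma>. of_bool (C \<in> fixed_points D X))"
  proof (rule sum.cong[OF refl])
    fix C assume C: "C \<in> orbits H Z \<sigma>"
    have "(\<Sum>z\<in>C. of_bool (?P z) * of_nat (card (stabilizer H \<sigma> z)) / (of_nat (order H) :: rat))
      = of_bool (C \<in> fixed_points D X) * of_nat (\<Sum>z\<in>C. card (stabilizer H \<sigma> z)) / of_nat (order H)"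
      using fixed[OF C] by (simp add: sum_distrib_left sum_divide_distrib)
    also have "(\<Sum>z\<in>C. card (stabilizer H \<sigma> z)) = order H"
      by (rule H.card_stablizer_sum[OF finH C])
    finally show "(\<Sum>z\<in>C. of_bool (?P z) * of_nat (card (stabilizer H \<sigma> z)) / (of_nat (order H) :: rat))
      = of_bool (C \<in> fixed_points D X)" using ord by simp
  qed
  also have "\<dots> = of_nat (card (fixed_points D X))"
  proof -
    have "fixed_points D X = {C \<in> orbits H Z \<sigma>. C \<in> fixed_points D X}"
      by (auto simp: fixed_points_def X_def)
    then show ?thesis
      using \<open>finite (orbits H Z \<sigma>)\<close> by (simp add: of_bool_def sum.If_cases Int_def)
  qed
  finally show "of_nat (card (fixed_points D X))
      = (\<Sum>z\<in>Z. of_bool (?P z) * of_nat (card (stabilizer H \<sigma> z)) / (of_nat (order H) :: rat))" ..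
qed

section \<open>Stabilizer weights on the Burnside module\<close>

lemma Z_loc_add: "\<lbrakk>prime p; a \<in> Z_loc p; b \<in> Z_loc p\<rbrakk> \<Longrightarrow> a + b \<in> Z_loc p"
proof -
  assume p: "prime p" and "a \<in> Z_loc p" "b \<in> Z_loc p"
  then obtain x y u v where "a = of_int x / of_int y" "\<not> int p dvd y"
      "b = of_int u / of_int v" "\<not> int p dvd v"
    by (auto simp: Z_loc_def)
  moreover from this have "y \<noteq> 0" "v \<noteq> 0" by auto
  ultimately have "a + b = of_int (x * v + u * y) / of_int (y * v)" "\<not> int p dvd y * v"
    using p by (auto simp: field_simps prime_dvd_mult_iff)
  then show ?thesis unfolding Z_loc_def by blast
qed

lemma Z_loc_mult: "\<lbrakk>prime p; a \<in> Z_loc p; b \<in> Z_loc p\<rbrakk> \<Longrightarrow> a * b \<in> Z_loc p"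
proof -
  assume p: "prime p" and "a \<in> Z_loc p" "b \<in> Z_loc p"
  then obtain x y u v where "a = of_int x / of_int y" "\<not> int p dvd y"
      "b = of_int u / of_int v" "\<not> int p dvd v"
    by (auto simp: Z_loc_def)
  then have "a * b = of_int (x * u) / of_int (y * v)" "\<not> int p dvd y * v"
    using p by (auto simp: prime_dvd_mult_iff)
  then show ?thesis unfolding Z_loc_def by blast
qed

lemma Z_loc_of_int: "prime p \<Longrightarrow> of_int n \<in> Z_loc p"
proof -
  assume "prime p"
  then have "\<not> int p dvd 1" using prime_gt_1_nat by fastforce
  then show ?thesis
    unfolding Z_loc_def by (intro CollectI exI[of _ n] exI[of _ 1]) simp
qed

lemma Z_loc_sum:
  assumes "prime p" "\<And>i. i \<in> I \<Longrightarrow> f i \<in> Z_loc p"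
  shows "sum f I \<in> Z_loc p"
  using assms(2)
  by (induction I rule: infinite_finite_induct)
    (use Z_loc_of_int[OF assms(1), of 0] in \<open>auto intro: Z_loc_add[OF assms(1)]\<close>)

lemma not_inverse_p_Z_loc:
  assumes "prime p"
  shows "1 / of_nat p \<notin> Z_loc p"
proof
  assume "1 / of_nat p \<in> Z_loc p"
  then obtain x y where xy: "(1 :: rat) / of_nat p = of_int x / of_int y" "\<not> int p dvd y"
    by (auto simp: Z_loc_def)
  then have "of_int y = (of_int (int p * x) :: rat)"
    using assms by (auto simp: field_simps dest: prime_gt_0_nat)
  then have "y = int p * x" by (simp only: of_int_eq_iff)
  with xy(2) show False by simp
qed

definition formal_weight :: "('k, 'm) monoid_scheme \<Rightarrow> ('k set \<Rightarrow> rat) \<Rightarrow> 'k formal \<Rightarrow> rat" where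
  "formal_weight K w a =
     (\<Sum>X\<in>Poly_Mapping.keys a. Poly_Mapping.lookup a X * stab_sum K w X)"

lemma formal_weight_superset:
  assumes "finite A" "Poly_Mapping.keys a \<subseteq> A"
  shows "formal_weight K w a = (\<Sum>X\<in>A. Poly_Mapping.lookup a X * stab_sum K w X)"
  unfolding formal_weight_def
  by (rule sum.mono_neutral_left) (use assms in \<open>auto simp: in_keys_iff\<close>)

lemma formal_weight_add: "formal_weight K w (a + b) = formal_weight K w a + formal_weight K w b"
proof -
  let ?A = "Poly_Mapping.keys a \<union> Poly_Mapping.keys b"
  have "formal_weight K w c = (\<Sum>X\<in>?A. Poly_Mapping.lookup c X * stab_sum K w X)"
    if "c \<in> {a, b, a + b}" for c
    by (rule formal_weight_superset) (use that Poly_Mapping.keys_add[of a b] in auto)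
  then show ?thesis
    by (simp add: lookup_add distrib_right sum.distrib)
qed

lemma formal_weight_zero [simp]: "formal_weight K w 0 = 0"
  by (simp add: formal_weight_def)

lemma formal_weight_diff: "formal_weight K w (a - b) = formal_weight K w a - formal_weight K w b"
  using formal_weight_add[of K w "a - b" b] by simp

lemma formal_weight_single [simp]:
  "formal_weight K w (Poly_Mapping.single X c) = c * stab_sum K w X"
  by (simp add: formal_weight_def)

lemma formal_weight_sum: "formal_weight K w (sum f I) = (\<Sum>i\<in>I. formal_weight K w (f i))"
  by (induction I rule: infinite_finite_induct) (auto simp: formal_weight_add)

text \<open>
  The weight kills the relations of the Burnside module, hence is well defined on classes.
\<close>

lemma formal_weight_null: "a \<in> burnside_null p K \<Longrightarrow> formal_weight K w a = 0"
proof (induction rule: burnside_null.induct)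
  case (sum a c X Y Z)
  then have "stab_sum K w Z = stab_sum K w X + stab_sum K w Y"
    using stab_sum_iso[of K Z "gset_sum X Y" w] stab_sum_gset_sum[of X Y K w]
    by (auto dest: is_gset_finite)
  then show ?case
    using sum by (simp add: formal_weight_add formal_weight_diff algebra_simps)
qed (auto simp: formal_weight_add formal_weight_diff stab_sum_iso)

lemma burnside_null_add:
  assumes "b \<in> burnside_null p K" "a \<in> burnside_null p K"
  shows "a + b \<in> burnside_null p K"
  using assms(1)
proof induction
  case (iso b c X Y)
  then show ?case using burnside_null.iso[of "a + b" p K c X Y] by (simp add: add.assoc)
next
  case (sum b c X Y Z)
  then show ?case using burnside_null.sum[of "a + b" p K c X Y Z] by (simp add: add.assoc)
qed (use assms(2) in simp)

lemma burnside_null_sum: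
  "(\<And>i. i \<in> I \<Longrightarrow> f i \<in> burnside_null p K) \<Longrightarrow> sum f I \<in> burnside_null p K"
  by (induction I rule: infinite_finite_induct)
    (auto intro: burnside_null.zero burnside_null_add)

lemma burnside_null_single_diff:
  assumes "c \<in> Z_loc p" "is_gset K X" "is_gset K Y" "gset_iso K X Y"
  shows "Poly_Mapping.single X c - Poly_Mapping.single Y c \<in> burnside_null p K"
  using burnside_null.iso[OF burnside_null.zero assms] by simp

lemma burnside_free_add:
  "\<lbrakk>prime p; a \<in> burnside_free p K; b \<in> burnside_free p K\<rbrakk> \<Longrightarrow> a + b \<in> burnside_free p K"
  unfolding burnside_free_def mem_Collect_eq
proof (intro ballI conjI)
  fix X
  assume p: "prime p" and a: "\<forall>X\<in>Poly_Mapping.keys a. is_gset K X \<and> Poly_Mapping.lookup a X \<in> Z_loc p"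
    and b: "\<forall>X\<in>Poly_Mapping.keys b. is_gset K X \<and> Poly_Mapping.lookup b X \<in> Z_loc p"
    and X: "X \<in> Poly_Mapping.keys (a + b)"
  show "is_gset K X" using a b X Poly_Mapping.keys_add[of a b] by blast
  have "Poly_Mapping.lookup c X \<in> Z_loc p" if "c \<in> {a, b}" for c
    using a b that Z_loc_of_int[OF p, of 0] by (cases "X \<in> Poly_Mapping.keys c") (auto simp: in_keys_iff)
  then show "Poly_Mapping.lookup (a + b) X \<in> Z_loc p"
    by (simp add: lookup_add Z_loc_add[OF p])
qed

lemma burnside_free_single:
  "\<lbrakk>is_gset K X; c \<in> Z_loc p\<rbrakk> \<Longrightarrow> Poly_Mapping.single X c \<in> burnside_free p K"
  by (simp add: burnside_free_def)

lemma burnside_free_sum: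
  "\<lbrakk>prime p; \<And>i. i \<in> I \<Longrightarrow> f i \<in> burnside_free p K\<rbrakk> \<Longrightarrow> sum f I \<in> burnside_free p K"
  by (induction I rule: infinite_finite_induct)
    (auto intro: burnside_free_add, auto simp: burnside_free_def)

lemma burnside_cls_eqI:
  assumes "a - b \<in> burnside_null p K" "b - a \<in> burnside_null p K"
  shows "burnside_cls p K a = burnside_cls p K b"
proof -
  have "c - b \<in> burnside_null p K" if "c - a \<in> burnside_null p K" for c
    using burnside_null_add[OF assms(1) that] by simp
  moreover have "c - a \<in> burnside_null p K" if "c - b \<in> burnside_null p K" for c
    using burnside_null_add[OF assms(2) that] by simp
  ultimately show ?thesis by (auto simp: burnside_cls_def)
qed

definition weight :: "('k, 'm) monoid_scheme \<Rightarrow> ('k set \<Rightarrow> rat) \<Rightarrow> 'k formal set \<Rightarrow> rat" where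
  "weight K w \<alpha> = formal_weight K w (burnside_rep \<alpha>)"

lemma burnside_rep_in:
  assumes "\<alpha> \<in> burnside_loc p K"
  shows "burnside_rep \<alpha> \<in> \<alpha>" "burnside_rep \<alpha> \<in> burnside_free p K"
proof -
  obtain a where a: "a \<in> burnside_free p K" "\<alpha> = burnside_cls p K a"
    using assms by (auto simp: burnside_loc_def)
  then have "a \<in> \<alpha>" by (simp add: burnside_cls_def burnside_null.zero)
  then show "burnside_rep \<alpha> \<in> \<alpha>" unfolding burnside_rep_def by (rule someI)
  then show "burnside_rep \<alpha> \<in> burnside_free p K" using a by (simp add: burnside_cls_def)
qed

lemma burnside_rep_keys:
  assumes "\<alpha> \<in> burnside_loc p K" "X \<in> Poly_Mapping.keys (burnside_rep \<alpha>)"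
  shows "is_gset K X" "Poly_Mapping.lookup (burnside_rep \<alpha>) X \<in> Z_loc p"
  using burnside_rep_in(2)[OF assms(1)] assms(2) unfolding burnside_free_def by blast+

lemma weight_burnside_cls:
  assumes "a \<in> burnside_free p K"
  shows "weight K w (burnside_cls p K a) = formal_weight K w a"
proof -
  have "burnside_cls p K a \<in> burnside_loc p K" using assms by (simp add: burnside_loc_def)
  then have "burnside_rep (burnside_cls p K a) - a \<in> burnside_null p K"
    using burnside_rep_in(1) by (force simp: burnside_cls_def)
  then show ?thesis
    using formal_weight_null[of _ p K w] formal_weight_diff[of K w _ a] by (force simp: weight_def)
qed

context
  fixes p :: nat and K :: "('k, 'm) monoid_scheme" and I :: "'i set" and c :: "'i \<Rightarrow> rat"
    and X :: "'i \<Rightarrow> ('k, 'x) gset"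
  assumes p: "prime p" and K: "group K"
    and c: "\<And>i. i \<in> I \<Longrightarrow> c i \<in> Z_loc p" and X: "\<And>i. i \<in> I \<Longrightarrow> is_gset K (X i)"
begin

lemma burnside_comb_free:
  "(\<Sum>i\<in>I. Poly_Mapping.single (nat_model K (X i)) (c i)) \<in> burnside_free p K"
  by (intro burnside_free_sum burnside_free_single p) (auto intro: c nat_model X K)

lemma burnside_comb_in_loc: "burnside_comb p K I c X \<in> burnside_loc p K"
  using burnside_comb_free by (simp add: burnside_comb_def burnside_loc_def)

lemma weight_burnside_comb:
  "weight K w (burnside_comb p K I c X) = (\<Sum>i\<in>I. c i * stab_sum K w (X i))"
proof -
  have "stab_sum K w (nat_model K (X i)) = stab_sum K w (X i)" if "i \<in> I" for i
    using stab_sum_iso[OF X[OF that] nat_model(2)[OF X[OF that] K]] by simp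
  then show ?thesis
    by (simp add: burnside_comb_def weight_burnside_cls[OF burnside_comb_free] formal_weight_sum)
qed

end

lemma burnside_basic:
  assumes "prime p" "group K" "is_gset K X"
  shows "burnside_basic p K X \<in> burnside_loc p K"
    and "weight K w (burnside_basic p K X) = stab_sum K w X"
proof -
  have 1: "1 \<in> Z_loc p" using Z_loc_of_int[OF assms(1), of 1] by simp
  show "burnside_basic p K X \<in> burnside_loc p K"
    unfolding burnside_basic_def by (rule burnside_comb_in_loc) (use assms 1 in auto)
  show "weight K w (burnside_basic p K X) = stab_sum K w X"
    unfolding burnside_basic_def by (subst weight_burnside_comb) (use assms 1 in auto)
qed

lemma mark_eq_weight:
  assumes \<alpha>: "\<alpha> \<in> burnside_loc p K" and D: "D \<subseteq> carrier K"
  shows "mark D \<alpha> = weight K (\<lambda>E. of_bool (D \<subseteq> E)) \<alpha>"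
  unfolding mark_def weight_def formal_weight_def Let_def
proof (rule sum.cong[OF refl])
  fix X assume "X \<in> Poly_Mapping.keys (burnside_rep \<alpha>)"
  then have "is_gset K X" using burnside_rep_in(2)[OF \<alpha>] by (simp add: burnside_free_def)
  then show "Poly_Mapping.lookup (burnside_rep \<alpha>) X * of_nat (card (fixed_points D X)) =
      Poly_Mapping.lookup (burnside_rep \<alpha>) X * stab_sum K (\<lambda>E. of_bool (D \<subseteq> E)) X"
    by (simp add: card_fixed_points[OF _ D])
qed

lemma stab_sum_sum: "stab_sum K (\<lambda>E. \<Sum>i\<in>I. w i E) X = (\<Sum>i\<in>I. stab_sum K (w i) X)"
  unfolding stab_sum_def by (rule sum.swap)

lemma stab_sum_scale: "stab_sum K (\<lambda>E. c * w E) X = c * stab_sum K w X"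
  by (simp add: stab_sum_def sum_distrib_left)

lemma weight_scale: "weight K (\<lambda>E. c * w E) \<alpha> = c * weight K w \<alpha>"
  by (simp add: weight_def formal_weight_def stab_sum_scale sum_distrib_left mult.left_commute)

lemma weight_sum: "weight K (\<lambda>E. \<Sum>i\<in>I. w i E) \<alpha> = (\<Sum>i\<in>I. weight K (w i) \<alpha>)"
  unfolding weight_def formal_weight_def stab_sum_sum sum_distrib_left by (rule sum.swap)

lemma weight_conj:
  assumes "group K" "\<alpha> \<in> burnside_loc p K" "k \<in> carrier K"
  shows "weight K (\<lambda>E. w (conj_set K k E)) \<alpha> = weight K w \<alpha>"
  unfolding weight_def formal_weight_def
proof (rule sum.cong[OF refl])
  fix X assume "X \<in> Poly_Mapping.keys (burnside_rep \<alpha>)"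
  then have "is_gset K X" using burnside_rep_in(2)[OF assms(2)] by (simp add: burnside_free_def)
  then show "Poly_Mapping.lookup (burnside_rep \<alpha>) X * stab_sum K (\<lambda>E. w (conj_set K k E)) X =
      Poly_Mapping.lookup (burnside_rep \<alpha>) X * stab_sum K w X"
    by (simp add: group.stab_sum_conj[OF assms(1) _ assms(3)])
qed

text \<open>
  Conjugating \<open>D\<close> has the same effect as conjugating the stabilizers on which the indicator of the
  subgroups containing \<open>D\<close> is evaluated, and weights are insensitive to the latter.
\<close>

lemma mark_conj:
  assumes K: "group K" and \<alpha>: "\<alpha> \<in> burnside_loc p K" and k: "k \<in> carrier K" and D: "subgroup D K"
  shows "mark (conj_set K k D) \<alpha> = mark D \<alpha>"
proof -
  interpret group K by fact
  have D_sub: "D \<subseteq> carrier K" by (rule subgroup.subset[OF D])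
  have "weight K (\<lambda>E. of_bool (conj_set K k D \<subseteq> conj_set K k E)) \<alpha>
      = weight K (\<lambda>E. of_bool (conj_set K k D \<subseteq> E)) \<alpha>"
    by (rule weight_conj[OF K \<alpha> k, where w = "\<lambda>E. of_bool (conj_set K k D \<subseteq> E)"])
  moreover have "weight K (\<lambda>E. of_bool (conj_set K k D \<subseteq> conj_set K k E)) \<alpha>
      = weight K (\<lambda>E. of_bool (D \<subseteq> E)) \<alpha>"
    unfolding weight_def formal_weight_def stab_sum_def
  proof (intro sum.cong refl arg_cong2[where f = "(*)"])
    fix X x
    let ?E = "stabilizer K (snd X) x"
    have "?E \<subseteq> carrier K" by (auto simp: stabilizer_def)
    then have "conj_set K k D \<subseteq> conj_set K k ?E \<longleftrightarrow> D \<subseteq> ?E"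
      by (rule conj_set_subset_iff[OF k D_sub])
    then show "of_bool (conj_set K k D \<subseteq> conj_set K k ?E) = (of_bool (D \<subseteq> ?E) :: rat)" by simp
  qed
  ultimately show ?thesis
    using mark_eq_weight[OF \<alpha> D_sub] mark_eq_weight[OF \<alpha>, of "conj_set K k D"]
      subgroup.subset[OF subgroup_conj_set[OF k D]] by simp
qed

section \<open>Fixed points of a composition\<close>

text \<open>
  If \<open>A\<close> and \<open>B\<close> are the stabilizers of \<open>y\<close> and \<open>x\<close>, then the orbit of \<open>(y, x)\<close> under \<open>H\<close> is fixed by
  \<open>(k, g)\<close> iff some \<open>h\<close> satisfies \<open>(k, h) \<in> A\<close> and \<open>(h, g) \<in> B\<close>, and the stabilizer of \<open>(y, x)\<close> in
  \<open>H\<close> is the set whose cardinality occurs here. So this is the contribution of the pair \<open>(y, x)\<close> to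
  the number of \<open>D\<close>-fixed points of \<open>Y \<times>\<^bsub>H\<^esub> X\<close>.
\<close>

definition comp_kernel ::
  "('g, 'm) monoid_scheme \<Rightarrow> ('h, 'n) monoid_scheme \<Rightarrow> ('k, 'o) monoid_scheme \<Rightarrow>
   ('k \<times> 'g) set \<Rightarrow> ('k \<times> 'h) set \<Rightarrow> ('h \<times> 'g) set \<Rightarrow> rat" where
  "comp_kernel G H K D A B =
     of_bool (\<forall>(k, g)\<in>D. \<exists>h\<in>carrier H. (k, h) \<in> A \<and> (h, g) \<in> B)
       * of_nat (card {h \<in> carrier H. (\<one>\<^bsub>K\<^esub>, h) \<in> A \<and> (h, \<one>\<^bsub>G\<^esub>) \<in> B}) / of_nat (order H)"

lemma act_eq_iff:
  assumes K: "group K" and X: "is_gset K X" and k: "k \<in> carrier K" and l: "l \<in> carrier K" and x: "x \<in> fst X"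
  shows "snd X k x = snd X l x \<longleftrightarrow> snd X (inv\<^bsub>K\<^esub> l \<otimes>\<^bsub>K\<^esub> k) x = x"
proof -
  interpret group K by fact
  have "snd X (inv\<^bsub>K\<^esub> l \<otimes>\<^bsub>K\<^esub> k) x = snd X (inv\<^bsub>K\<^esub> l) (snd X k x)"
    using is_gset_mult[OF X _ k x] l by simp
  moreover have "snd X (inv\<^bsub>K\<^esub> l) (snd X l x) = x"
    using is_gset_mult[OF X _ l x, of "inv\<^bsub>K\<^esub> l"] is_gset_one[OF X x] l by simp
  moreover have "snd X l (snd X (inv\<^bsub>K\<^esub> l) z) = z" if "z \<in> fst X" for z
    using is_gset_mult[OF X l _ that, of "inv\<^bsub>K\<^esub> l"] is_gset_one[OF X that] l by simp
  ultimately show ?thesis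
    using is_gset_closed[OF X k x] by metis
qed

lemma biset_tensor:
  assumes G: "group G" and H: "group H" and K: "group K" and finH: "finite (carrier H)"
    and Y: "is_gset (K \<times>\<times> H) Y" and X: "is_gset (H \<times>\<times> G) X"
  shows "is_gset (K \<times>\<times> G) (biset_tensor G H K Y X)"
    and "D \<subseteq> carrier (K \<times>\<times> G) \<Longrightarrow> of_nat (card (fixed_points D (biset_tensor G H K Y X))) =
      (\<Sum>y\<in>fst Y. \<Sum>x\<in>fst X. comp_kernel G H K D
         (stabilizer (K \<times>\<times> H) (snd Y) y) (stabilizer (H \<times>\<times> G) (snd X) x))"
proof -
  interpret G: group G by fact
  interpret H: group H by fact
  interpret K: group K by fact
  let ?Z = "fst Y \<times> fst X"
  \<comment> \<open>\<open>\<rho>\<close> and \<open>\<sigma>\<close> are the commuting actions on pairs whose orbit set is \<open>Y \<times>\<^bsub>H\<^esub> X\<close>\<close>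
  define \<rho> where "\<rho> = (\<lambda>(k, g). \<lambda>(y, x)\<in>?Z. (snd Y (k, \<one>\<^bsub>H\<^esub>) y, snd X (\<one>\<^bsub>H\<^esub>, g) x))"
  define \<sigma> where "\<sigma> = (\<lambda>h. \<lambda>(y, x)\<in>?Z. (snd Y (\<one>\<^bsub>K\<^esub>, h) y, snd X (h, \<one>\<^bsub>G\<^esub>) x))"
  have Yc: "snd Y (k, h) y \<in> fst Y" if "k \<in> carrier K" "h \<in> carrier H" "y \<in> fst Y" for k h y
    using is_gset_closed[OF Y, of "(k, h)"] that by simp
  have Xc: "snd X (h, g) x \<in> fst X" if "h \<in> carrier H" "g \<in> carrier G" "x \<in> fst X" for h g x
    using is_gset_closed[OF X, of "(h, g)"] that by simp
  have Ym: "snd Y (k, h) (snd Y (k', h') y) = snd Y (k \<otimes>\<^bsub>K\<^esub> k', h \<otimes>\<^bsub>H\<^esub> h') y"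
    if "k \<in> carrier K" "h \<in> carrier H" "k' \<in> carrier K" "h' \<in> carrier H" "y \<in> fst Y" for k h k' h' y
    using is_gset_mult[OF Y, of "(k, h)" "(k', h')"] that by simp
  have Xm: "snd X (h, g) (snd X (h', g') x) = snd X (h \<otimes>\<^bsub>H\<^esub> h', g \<otimes>\<^bsub>G\<^esub> g') x"
    if "h \<in> carrier H" "g \<in> carrier G" "h' \<in> carrier H" "g' \<in> carrier G" "x \<in> fst X" for h g h' g' x
    using is_gset_mult[OF X, of "(h, g)" "(h', g')"] that by simp
  have Y1: "snd Y (\<one>\<^bsub>K\<^esub>, \<one>\<^bsub>H\<^esub>) y = y" if "y \<in> fst Y" for y
    using is_gset_one[OF Y that] by simp
  have X1: "snd X (\<one>\<^bsub>H\<^esub>, \<one>\<^bsub>G\<^esub>) x = x" if "x \<in> fst X" for x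
    using is_gset_one[OF X that] by simp
  have \<rho>: "group_action (K \<times>\<times> G) ?Z \<rho>"
    by (rule group_actionI)
      (auto simp: \<rho>_def Yc Xc Y1 X1 Ym Xm intro: DirProd_group G K)
  have \<sigma>: "group_action H ?Z \<sigma>"
    by (rule group_actionI) (auto simp: \<sigma>_def Yc Xc Y1 X1 Ym Xm intro: H)
  have comm: "\<rho> l (\<sigma> h z) = \<sigma> h (\<rho> l z)"
    if "l \<in> carrier (K \<times>\<times> G)" "h \<in> carrier H" "z \<in> ?Z" for l h z
    using that by (auto simp: \<rho>_def \<sigma>_def Yc Xc Ym Xm)
  have rel: "tensor_rel G H K Y X `` {z} = orbit H \<sigma> z" if "z \<in> ?Z" for z
    using that by (auto simp: tensor_rel_def orbit_def \<sigma>_def)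
  have E: "?Z // tensor_rel G H K Y X = orbits H ?Z \<sigma>"
    unfolding quotient_def orbits_def using rel by auto
  have sub: "C \<subseteq> ?Z" if "C \<in> orbits H ?Z \<sigma>" for C
    using group_action.orbits_coverture[OF \<sigma>] that by auto
  have "biset_tensor G H K Y X = (orbits H ?Z \<sigma>, \<lambda>l. \<lambda>C\<in>orbits H ?Z \<sigma>. \<rho> l ` C)"
    unfolding biset_tensor_def Let_def E
  proof (rule arg_cong[where f = "Pair _"], intro ext)
    fix l C
    show "(case l of (k, g) \<Rightarrow> \<lambda>C\<in>orbits H ?Z \<sigma>. (\<lambda>(y, x). (snd Y (k, \<one>\<^bsub>H\<^esub>) y, snd X (\<one>\<^bsub>H\<^esub>, g) x)) ` C) C
      = (\<lambda>C\<in>orbits H ?Z \<sigma>. \<rho> l ` C) C"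
    proof (cases "C \<in> orbits H ?Z \<sigma>")
      case True
      obtain k g where l: "l = (k, g)" by (cases l)
      have "(\<lambda>(y, x). (snd Y (k, \<one>\<^bsub>H\<^esub>) y, snd X (\<one>\<^bsub>H\<^esub>, g) x)) ` C = \<rho> (k, g) ` C"
      proof (rule image_cong[OF refl])
        fix z assume "z \<in> C"
        then have "z \<in> ?Z" using sub[OF True] by (rule set_mp[rotated])
        then show "(case z of (y, x) \<Rightarrow> (snd Y (k, \<one>\<^bsub>H\<^esub>) y, snd X (\<one>\<^bsub>H\<^esub>, g) x)) = \<rho> (k, g) z"
          by (simp add: \<rho>_def)
      qed
      then show ?thesis
        unfolding l prod.case restrict_apply'[OF True] .
    next
      case False
      then show ?thesis by (cases l) (simp only: prod.case restrict_def if_False)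
    qed
  qed
  note tensor = this
  have finZ: "finite ?Z" using is_gset_finite[OF Y] is_gset_finite[OF X] by simp
  show "is_gset (K \<times>\<times> G) (biset_tensor G H K Y X)"
    unfolding tensor by (rule orbit_gset(1)[OF \<rho> \<sigma> finZ finH]; rule comm)
  assume D: "D \<subseteq> carrier (K \<times>\<times> G)"
  let ?SY = "\<lambda>y. stabilizer (K \<times>\<times> H) (snd Y) y" and ?SX = "\<lambda>x. stabilizer (H \<times>\<times> G) (snd X) x"
  \<comment> \<open>\<open>(k, g)\<close> moves \<open>(y, x)\<close> like \<open>h\<close> does iff \<open>h\<^sup>-\<^sup>1\<close> is a witness in the kernel\<close>
  have eq: "\<rho> (k, g) (y, x) = \<sigma> h (y, x) \<longleftrightarrow> (k, inv\<^bsub>H\<^esub> h) \<in> ?SY y \<and> (inv\<^bsub>H\<^esub> h, g) \<in> ?SX x"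
    if "k \<in> carrier K" "g \<in> carrier G" "h \<in> carrier H" "y \<in> fst Y" "x \<in> fst X" for k g h y x
  proof -
    have "snd Y (k, \<one>\<^bsub>H\<^esub>) y = snd Y (\<one>\<^bsub>K\<^esub>, h) y \<longleftrightarrow> snd Y (k, inv\<^bsub>H\<^esub> h) y = y"
      using act_eq_iff[OF DirProd_group[OF K H] Y, of "(k, \<one>\<^bsub>H\<^esub>)" "(\<one>\<^bsub>K\<^esub>, h)" y] that
      by (simp add: inv_DirProd[OF K H])
    moreover have "snd X (\<one>\<^bsub>H\<^esub>, g) x = snd X (h, \<one>\<^bsub>G\<^esub>) x \<longleftrightarrow> snd X (inv\<^bsub>H\<^esub> h, g) x = x"
      using act_eq_iff[OF DirProd_group[OF H G] X, of "(\<one>\<^bsub>H\<^esub>, g)" "(h, \<one>\<^bsub>G\<^esub>)" x] that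
      by (simp add: inv_DirProd[OF H G])
    ultimately show ?thesis using that by (simp add: \<rho>_def \<sigma>_def stabilizer_def)
  qed
  have kernel: "of_bool (\<forall>d\<in>D. \<exists>h\<in>carrier H. \<rho> d (y, x) = \<sigma> h (y, x))
        * of_nat (card (stabilizer H \<sigma> (y, x))) / of_nat (order H)
      = comp_kernel G H K D (?SY y) (?SX x)"
    if yx: "y \<in> fst Y" "x \<in> fst X" for y x
  proof -
    have "(\<exists>h\<in>carrier H. \<rho> d (y, x) = \<sigma> h (y, x)) \<longleftrightarrow>
        (case d of (k, g) \<Rightarrow> \<exists>h\<in>carrier H. (k, h) \<in> ?SY y \<and> (h, g) \<in> ?SX x)" if "d \<in> D" for d
    proof -
      obtain k g where d: "d = (k, g)" "k \<in> carrier K" "g \<in> carrier G"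
        using \<open>d \<in> D\<close> D by (cases d) auto
      have "(\<exists>h\<in>carrier H. (k, inv\<^bsub>H\<^esub> h) \<in> ?SY y \<and> (inv\<^bsub>H\<^esub> h, g) \<in> ?SX x) \<longleftrightarrow>
          (\<exists>h\<in>carrier H. (k, h) \<in> ?SY y \<and> (h, g) \<in> ?SX x)"
        by (metis H.inv_closed H.inv_inv)
      then show ?thesis using eq[OF d(2,3) _ yx] d(1) by simp
    qed
    moreover have "stabilizer H \<sigma> (y, x)
        = {h \<in> carrier H. (\<one>\<^bsub>K\<^esub>, h) \<in> ?SY y \<and> (h, \<one>\<^bsub>G\<^esub>) \<in> ?SX x}"
      using yx by (auto simp: stabilizer_def \<sigma>_def)
    ultimately show ?thesis unfolding comp_kernel_def by (simp cong: ball_cong)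
  qed
  have "of_nat (card (fixed_points D (biset_tensor G H K Y X))) =
      (\<Sum>z\<in>?Z. of_bool (\<forall>d\<in>D. \<exists>h\<in>carrier H. \<rho> d z = \<sigma> h z)
        * of_nat (card (stabilizer H \<sigma> z)) / (of_nat (order H) :: rat))"
    unfolding tensor by (rule orbit_gset(2)[OF \<rho> \<sigma> finZ finH _ D]; rule comm)
  also have "\<dots> = (\<Sum>(y, x)\<in>?Z. comp_kernel G H K D (?SY y) (?SX x))"
  proof (rule sum.cong[OF refl])
    fix z assume "z \<in> ?Z"
    then show "of_bool (\<forall>d\<in>D. \<exists>h\<in>carrier H. \<rho> d z = \<sigma> h z) * of_nat (card (stabilizer H \<sigma> z))
        / of_nat (order H) = (case z of (y, x) \<Rightarrow> comp_kernel G H K D (?SY y) (?SX x))"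
      using kernel by (cases z) simp
  qed
  also have "\<dots> = (\<Sum>y\<in>fst Y. \<Sum>x\<in>fst X. comp_kernel G H K D (?SY y) (?SX x))"
    by (simp add: sum.cartesian_product)
  finally show "of_nat (card (fixed_points D (biset_tensor G H K Y X))) =
      (\<Sum>y\<in>fst Y. \<Sum>x\<in>fst X. comp_kernel G H K D (?SY y) (?SX x))" .
qed

text \<open>
  Since the kernel only involves stabilizers, the marks of a composition are an iterated weight. As
  weights do not depend on the representing formal sums, neither does the right-hand side.
\<close>

lemma mark_biset_comp:
  assumes p: "prime p" and G: "group G" and H: "group H" and K: "group K"
    and fin: "finite (carrier H)"
    and \<beta>: "\<beta> \<in> burnside_loc p (K \<times>\<times> H)" and \<alpha>: "\<alpha> \<in> burnside_loc p (H \<times>\<times> G)"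
    and D: "D \<subseteq> carrier (K \<times>\<times> G)"
  shows "mark D (biset_comp p G H K \<beta> \<alpha>) =
    weight (K \<times>\<times> H) (\<lambda>A. weight (H \<times>\<times> G) (comp_kernel G H K D A) \<alpha>) \<beta>"
proof -
  let ?b = "burnside_rep \<beta>" and ?a = "burnside_rep \<alpha>"
  let ?I = "Poly_Mapping.keys ?b \<times> Poly_Mapping.keys ?a"
  let ?c = "\<lambda>(Y, X). Poly_Mapping.lookup ?b Y * Poly_Mapping.lookup ?a X"
  let ?T = "\<lambda>(Y, X). biset_tensor G H K Y X"
  have Y: "is_gset (K \<times>\<times> H) Y" "Poly_Mapping.lookup ?b Y \<in> Z_loc p" if "Y \<in> Poly_Mapping.keys ?b" for Y
    by (rule burnside_rep_keys[OF \<beta> that])+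
  have X: "is_gset (H \<times>\<times> G) X" "Poly_Mapping.lookup ?a X \<in> Z_loc p" if "X \<in> Poly_Mapping.keys ?a" for X
    by (rule burnside_rep_keys[OF \<alpha> that])+
  have KG: "group (K \<times>\<times> G)" by (rule DirProd_group[OF K G])
  have c: "?c i \<in> Z_loc p" and T: "is_gset (K \<times>\<times> G) (?T i)" if "i \<in> ?I" for i
  proof -
    obtain Y' X' where i: "i = (Y', X')" "Y' \<in> Poly_Mapping.keys ?b" "X' \<in> Poly_Mapping.keys ?a"
      using \<open>i \<in> ?I\<close> by blast
    show "?c i \<in> Z_loc p" using Z_loc_mult[OF p Y(2)[OF i(2)] X(2)[OF i(3)]] by (simp add: i(1))
    show "is_gset (K \<times>\<times> G) (?T i)"
      using biset_tensor(1)[OF G H K fin Y(1)[OF i(2)] X(1)[OF i(3)]] by (simp add: i(1))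
  qed
  have comp: "biset_comp p G H K \<beta> \<alpha> = burnside_comb p (K \<times>\<times> G) ?I ?c ?T"
    unfolding biset_comp_def Let_def ..
  have loc: "burnside_comb p (K \<times>\<times> G) ?I ?c ?T \<in> burnside_loc p (K \<times>\<times> G)"
    by (rule burnside_comb_in_loc[OF p KG]; erule c T)
  have "mark D (biset_comp p G H K \<beta> \<alpha>) = weight (K \<times>\<times> G) (\<lambda>E. of_bool (D \<subseteq> E)) (burnside_comb p (K \<times>\<times> G) ?I ?c ?T)"
    unfolding comp by (rule mark_eq_weight[OF loc D])
  also have "\<dots> = (\<Sum>i\<in>?I. ?c i * stab_sum (K \<times>\<times> G) (\<lambda>E. of_bool (D \<subseteq> E)) (?T i))"
    by (rule weight_burnside_comb[OF p KG]; erule c T)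
  also have "\<dots> = (\<Sum>i\<in>?I. case i of (Y, X) \<Rightarrow> Poly_Mapping.lookup ?b Y * (\<Sum>y\<in>fst Y. Poly_Mapping.lookup ?a X *
      stab_sum (H \<times>\<times> G) (comp_kernel G H K D (stabilizer (K \<times>\<times> H) (snd Y) y)) X))"
  proof (rule sum.cong[OF refl])
    fix i assume i: "i \<in> ?I"
    obtain Y' X' where i_eq: "i = (Y', X')" by (cases i)
    have "stab_sum (K \<times>\<times> G) (\<lambda>E. of_bool (D \<subseteq> E)) (?T i) = (\<Sum>y\<in>fst Y'. \<Sum>x\<in>fst X'. comp_kernel G H K D
         (stabilizer (K \<times>\<times> H) (snd Y') y) (stabilizer (H \<times>\<times> G) (snd X') x))"
      using biset_tensor(2)[OF G H K fin Y(1) X(1) D, of Y' X'] card_fixed_points[OF T[OF i] D] i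
      by (simp add: i_eq)
    then show "?c i * stab_sum (K \<times>\<times> G) (\<lambda>E. of_bool (D \<subseteq> E)) (?T i) =
      (case i of (Y, X) \<Rightarrow> Poly_Mapping.lookup ?b Y * (\<Sum>y\<in>fst Y. Poly_Mapping.lookup ?a X *
      stab_sum (H \<times>\<times> G) (comp_kernel G H K D (stabilizer (K \<times>\<times> H) (snd Y) y)) X))"
      by (simp add: i_eq stab_sum_def sum_distrib_left mult.assoc)
  qed
  also have "\<dots> = (\<Sum>Y\<in>Poly_Mapping.keys ?b. \<Sum>X\<in>Poly_Mapping.keys ?a. Poly_Mapping.lookup ?b Y *
      (\<Sum>y\<in>fst Y. Poly_Mapping.lookup ?a X *
      stab_sum (H \<times>\<times> G) (comp_kernel G H K D (stabilizer (K \<times>\<times> H) (snd Y) y)) X))"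
    by (simp add: sum.cartesian_product)
  also have "\<dots> = (\<Sum>Y\<in>Poly_Mapping.keys ?b. Poly_Mapping.lookup ?b Y *
      (\<Sum>y\<in>fst Y. \<Sum>X\<in>Poly_Mapping.keys ?a. Poly_Mapping.lookup ?a X *
      stab_sum (H \<times>\<times> G) (comp_kernel G H K D (stabilizer (K \<times>\<times> H) (snd Y) y)) X))"
    by (subst sum.swap) (simp add: sum_distrib_left)
  also have "\<dots> = weight (K \<times>\<times> H) (\<lambda>A. weight (H \<times>\<times> G) (comp_kernel G H K D A) \<alpha>) \<beta>"
    by (simp add: weight_def formal_weight_def stab_sum_def)
  finally show ?thesis .
qed

section \<open>Fixed points of \<open>p\<close>-groups\<close>

text \<open>
  Every orbit is either a fixed point or has a nontrivial power of \<open>p\<close> as its size.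
\<close>

lemma p_group_action_fixed_points:
  assumes "group_action P E act" and p: "prime p" and ord: "order P = p ^ n" and fin: "finite E"
  shows "int p dvd int (card E) - int (card {x \<in> E. \<forall>g\<in>carrier P. act g x = x})"
proof -
  interpret group_action P E act by fact
  let ?F = "{x \<in> E. \<forall>g\<in>carrier P. act g x = x}"
  have "int (card E) - int (card ?F) = (\<Sum>x\<in>E. 1 - of_bool (x \<in> ?F))"
    using fin by (simp add: sum_subtractf of_bool_def sum.If_cases Int_def)
  also have "\<dots> = (\<Sum>C\<in>orbits P E act. \<Sum>x\<in>C. 1 - of_bool (x \<in> ?F))"
    by (rule disjoint_sum[OF fin, symmetric])
  also have "int p dvd \<dots>"
  proof (rule dvd_sum)
    fix C assume "C \<in> orbits P E act"
    then obtain x where x: "x \<in> E" "C = orbit P act x" by (auto simp: orbits_def)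
    have xC: "x \<in> C" using orbit_refl[OF x(1)] x(2) by simp
    have "C \<subseteq> E" using element_image x by (auto simp: orbit_def)
    have fixed: "C = {y}" if y: "y \<in> C" "y \<in> ?F" for y
    proof -
      have "x \<in> orbit P act y"
        using orbit_sym[OF x(1), of y] y x(2) by simp
      then have "x = y" using y(2) by (auto simp: orbit_def)
      then show ?thesis using x y by (auto simp: orbit_def)
    qed
    show "int p dvd (\<Sum>x\<in>C. 1 - of_bool (x \<in> ?F))"
    proof (cases "C \<inter> ?F = {}")
      case True
      then have "(\<Sum>x\<in>C. 1 - of_bool (x \<in> ?F)) = (\<Sum>x\<in>C. (1 :: int))"
        by (intro sum.cong) auto
      moreover have "card C dvd p ^ n"
        using orbit_stabilizer_theorem[OF x(1)] x(2) ord by (metis dvd_triv_left)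
      then obtain i where i: "card C = p ^ i" using divides_primepow_nat[OF p] by auto
      moreover have "card C \<noteq> 1"
      proof
        assume "card C = 1"
        then obtain y where "C = {y}" by (auto simp: card_1_singleton_iff)
        then have C: "C = {x}" using xC by simp
        have "act g x = x" if "g \<in> carrier P" for g
        proof -
          have "act g x \<in> C" using that x(2) by (auto simp: orbit_def)
          then show ?thesis using C by simp
        qed
        then show False using True C x(1) by auto
      qed
      then have "int p dvd int (card C)" using i by (cases i) auto
      ultimately show ?thesis by simp
    next
      case False
      then obtain y where "y \<in> C" "y \<in> ?F" by blast
      then have "C = {y}" "y \<in> ?F" using fixed by auto
      then show ?thesis by simp
    qed
  qed
  finally show ?thesis .
qed

lemma (in group) p_subgroup_fixed_points:
  assumes X: "is_gset G X" and P: "subgroup P G" and "prime p" "card P = p ^ n"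
  shows "int p dvd int (card (fst X)) - int (card (fixed_points P X))"
proof -
  interpret group_action G "fst X" "snd X" by (rule is_gset_group_action[OF X])
  have sub: "g \<in> carrier G" if "g \<in> P" for g using subgroup.subset[OF P] that by blast
  have "group_action (G\<lparr>carrier := P\<rparr>) (fst X) (snd X)"
  proof (rule group_actionI)
    show "group (G\<lparr>carrier := P\<rparr>)" by (rule subgroup.subgroup_is_group[OF P is_group])
    show "snd X k \<in> extensional (fst X)" if "k \<in> carrier (G\<lparr>carrier := P\<rparr>)" for k
      using bij_prop0[of k] sub that by (simp add: Bij_def)
  qed (use is_gset_closed[OF X] is_gset_one[OF X] is_gset_mult[OF X] sub in simp_all)
  then show ?thesis
    using p_group_action_fixed_points[of "G\<lparr>carrier := P\<rparr>" "fst X" "snd X" p n] assms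
      is_gset_finite[OF X] by (simp add: order_def fixed_points_def)
qed

section \<open>Graphs of morphisms of a fusion system\<close>

lemma graph_subset_graph_iff:
  assumes "\<phi> \<in> extensional P"
  shows "graph P \<phi> \<subseteq> graph Q \<psi> \<longleftrightarrow> P \<subseteq> Q \<and> restrict \<psi> P = \<phi>"
proof
  assume *: "graph P \<phi> \<subseteq> graph Q \<psi>"
  then have "u \<in> Q \<and> \<phi> u = \<psi> u" if "u \<in> P" for u using that by (auto simp: graph_def)
  then show "P \<subseteq> Q \<and> restrict \<psi> P = \<phi>"
    using assms by (auto intro!: extensionalityI[of _ P])
next
  assume *: "P \<subseteq> Q \<and> restrict \<psi> P = \<phi>"
  then have "\<phi> u = \<psi> u" if "u \<in> P" for u using that by auto
  then show "graph P \<phi> \<subseteq> graph Q \<psi>" using * by (auto simp: graph_def)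
qed

lemma mem_graph_iff: "(y, x) \<in> graph P \<phi> \<longleftrightarrow> x \<in> P \<and> y = \<phi> x"
  by (auto simp: graph_def)

lemma card_graph: "card (graph P \<phi>) = card P"
  unfolding graph_def by (rule card_image) (auto simp: inj_on_def)

lemma converse_graph_inj:
  "inj_on \<phi> P \<Longrightarrow> (graph P \<phi>)\<inverse> = graph (\<phi> ` P) (inv_into P \<phi>)"
  by (auto simp: graph_def image_iff)

lemma conj_set_DirProd:
  assumes "group G" "group H" "g \<in> carrier G" "h \<in> carrier H"
  shows "conj_set (G \<times>\<times> H) (g, h) D
    = (\<lambda>(x, y). (g \<otimes>\<^bsub>G\<^esub> x \<otimes>\<^bsub>G\<^esub> inv\<^bsub>G\<^esub> g, h \<otimes>\<^bsub>H\<^esub> y \<otimes>\<^bsub>H\<^esub> inv\<^bsub>H\<^esub> h)) ` D"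
  unfolding conj_set_def using assms by (intro image_cong refl) (auto split: prod.splits)

lemma converse_conj_set_DirProd:
  assumes "group G" "group H" "g \<in> carrier G" "h \<in> carrier H"
  shows "(conj_set (G \<times>\<times> H) (g, h) D)\<inverse> = conj_set (H \<times>\<times> G) (h, g) (D\<inverse>)"
  unfolding conj_set_DirProd[OF assms] conj_set_DirProd[OF assms(2,1,4,3)]
  by (force simp: image_iff)

context group
begin

lemma conj_set_subgroup_self:
  assumes P: "subgroup P G" and k: "k \<in> P"
  shows "conj_set G k P = P"
proof -
  have kG: "k \<in> carrier G" using subgroup.subset[OF P] k by blast
  have "conj_set G l P \<subseteq> P" if "l \<in> P" for l
    using subgroupE[OF P] that by (auto simp: conj_set_def)
  note sub = this
  have "conj_set G k (conj_set G (inv k) P) = P"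
    using conj_set_conj_set[of k "inv k" P] kG subgroup.subset[OF P] by (simp add: conj_set_one)
  then show ?thesis
    using sub[OF k] conj_set_mono[OF sub[of "inv k"], of k] subgroupE(3)[OF P k] by auto
qed

lemma inv_restrict_carrier: "\<lbrakk>subgroup P G; k \<in> P\<rbrakk> \<Longrightarrow> inv\<^bsub>G\<lparr>carrier := P\<rparr>\<^esub> k = inv k"
  by (simp add: m_inv_consistent)

lemma conj_set_DirProd_subgroup:
  assumes P: "subgroup P G" and H: "group H" and k: "k \<in> P" and h: "h \<in> carrier H"
  shows "conj_set (H \<times>\<times> G\<lparr>carrier := P\<rparr>) (h, k) D = conj_set (H \<times>\<times> G) (h, k) D"
    and "conj_set (G\<lparr>carrier := P\<rparr> \<times>\<times> H) (k, h) D = conj_set (G \<times>\<times> H) (k, h) D"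
proof -
  have kG: "k \<in> carrier G" using subgroup.subset[OF P] k by blast
  have GP: "group (G\<lparr>carrier := P\<rparr>)" by (rule subgroup.subgroup_is_group[OF P is_group])
  show "conj_set (H \<times>\<times> G\<lparr>carrier := P\<rparr>) (h, k) D = conj_set (H \<times>\<times> G) (h, k) D"
    using conj_set_DirProd[OF H GP h, of k] conj_set_DirProd[OF H is_group h kG] k
    by (simp add: inv_restrict_carrier[OF P])
  show "conj_set (G\<lparr>carrier := P\<rparr> \<times>\<times> H) (k, h) D = conj_set (G \<times>\<times> H) (k, h) D"
    using conj_set_DirProd[OF GP H _ h, of k] conj_set_DirProd[OF is_group H kG h] k
    by (simp add: inv_restrict_carrier[OF P])
qed

end

context fusion_system
begin

abbreviation "Mor P \<equiv> F P (carrier S)"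

definition F_graphs :: "('a \<times> 'a) set set" where
  "F_graphs = {graph P \<phi> |P \<phi>. subgroup P S \<and> \<phi> \<in> Mor P}"

lemma finite_carrier: "finite (carrier S)"
proof -
  have "order S > 0" using p_group prime_gt_0_nat[OF prime_p] by auto
  then show ?thesis by (simp add: order_def card_gt_0_iff)
qed

lemma order_pos: "order S > 0"
  using p_group prime_gt_0_nat[OF prime_p] by auto

lemma subgroup_carrier: "subgroup (carrier S) S"
  by (rule subgroup_self)

lemma finite_subgroup: "subgroup P S \<Longrightarrow> finite P"
  using finite_carrier finite_subset subgroup.subset by blast

lemma card_subgroup_pos: "subgroup P S \<Longrightarrow> card P > 0"
  using finite_subgroup subgroup.one_closed by (fastforce simp: card_gt_0_iff)

lemma card_subgroup_p_power: "subgroup P S \<Longrightarrow> \<exists>n. card P = p ^ n"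
proof -
  assume P: "subgroup P S"
  obtain n where "order S = p ^ n" using p_group by blast
  then have "card P dvd p ^ n" using lagrange[OF P] by (metis dvd_triv_right)
  then show ?thesis using divides_primepow_nat[OF prime_p] by blast
qed

lemma group_DirProd: "group (S \<times>\<times> S)"
  by (rule DirProd_group[OF is_group is_group])

lemma finite_DirProd: "finite (carrier (S \<times>\<times> S))"
  using finite_carrier by simp

context
  fixes P \<phi>
  assumes P: "subgroup P S" and \<phi>: "\<phi> \<in> Mor P"
begin

lemma Mor_extensional: "\<phi> \<in> extensional P"
  and Mor_inj: "inj_on \<phi> P"
  and Mor_mult: "\<And>u v. \<lbrakk>u \<in> P; v \<in> P\<rbrakk> \<Longrightarrow> \<phi> (u \<otimes> v) = \<phi> u \<otimes> \<phi> v"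
  and Mor_closed: "\<And>u. u \<in> P \<Longrightarrow> \<phi> u \<in> carrier S"
  using mor_mon[OF P subgroup_carrier \<phi>] by (auto simp: mon_def hom_def)

lemma Mor_group_hom: "group_hom (S\<lparr>carrier := P\<rparr>) S \<phi>"
  using subgroup.subgroup_is_group[OF P is_group] is_group Mor_mult Mor_closed
  by (intro group_hom.intro group_hom_axioms.intro) (auto simp: hom_def)

lemma Mor_one: "\<phi> \<one> = \<one>"
  using group_hom.hom_one[OF Mor_group_hom] by simp

lemma Mor_image_subgroup: "subgroup (\<phi> ` P) S"
  using group_hom.img_is_subgroup[OF Mor_group_hom] by simp

text \<open>
  Conjugating the graph of \<open>\<phi>\<close> by \<open>(a, b)\<close> gives the graph of \<open>c\<^sub>a \<circ> \<phi> \<circ> c\<^sub>b\<^sup>-\<^sup>1\<close>.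
\<close>

lemma Mor_compose_conj:
  assumes b: "b \<in> carrier S" and a: "a \<in> carrier S"
  shows "\<exists>\<chi>\<in>Mor (conj_set S b P). conj_set (S \<times>\<times> S) (a, b) (graph P \<phi>) = graph (conj_set S b P) \<chi>"
proof -
  let ?Q = "conj_set S b P"
  have Q: "subgroup ?Q S" by (rule subgroup_conj_set[OF b P])
  have PS: "u \<in> carrier S" if "u \<in> P" for u using that subgroup.subset[OF P] by blast
  have conj_inv: "inv b \<otimes> (b \<otimes> u \<otimes> inv b) \<otimes> inv (inv b) = u" if "u \<in> P" for u
    using PS[OF that] b by (simp add: m_assoc) (simp add: m_assoc[symmetric])
  have "conj_map S (inv b) ?Q \<in> F ?Q P"
    using conj_inv b by (intro conj_in[OF Q P]) (auto simp: conj_map_def conj_set_def)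
  moreover have "conj_map S a (carrier S) \<in> F (carrier S) (carrier S)"
    using a by (intro conj_in[OF subgroup_carrier subgroup_carrier]) (auto simp: conj_map_def)
  ultimately have "compose ?Q (conj_map S a (carrier S)) (compose ?Q \<phi> (conj_map S (inv b) ?Q)) \<in> Mor ?Q"
    by (meson P Q \<phi> comp_in subgroup_carrier)
  moreover have "conj_set (S \<times>\<times> S) (a, b) (graph P \<phi>)
    = graph ?Q (compose ?Q (conj_map S a (carrier S)) (compose ?Q \<phi> (conj_map S (inv b) ?Q)))"
    unfolding conj_set_DirProd[OF is_group is_group a b] graph_def conj_set_def[of S] image_image
    by (intro image_cong[OF refl])
      (auto simp: compose_def conj_map_def conj_inv Mor_closed)
  ultimately show ?thesis by blast
qed

lemma subgroup_graph: "subgroup (graph P \<phi>) (S \<times>\<times> S)"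
proof -
  interpret SS: group "S \<times>\<times> S" by (rule group_DirProd)
  interpret h: group_hom "S\<lparr>carrier := P\<rparr>" S \<phi> by (rule Mor_group_hom)
  show ?thesis
  proof (rule SS.subgroupI)
    show "graph P \<phi> \<subseteq> carrier (S \<times>\<times> S)"
      using Mor_closed subgroup.subset[OF P] by (auto simp: graph_def)
    show "graph P \<phi> \<noteq> {}" using subgroup.one_closed[OF P] by (auto simp: graph_def)
    fix x assume "x \<in> graph P \<phi>"
    then obtain u where u: "u \<in> P" "x = (\<phi> u, u)" by (auto simp: graph_def)
    have uS: "u \<in> carrier S" using subgroup.subset[OF P] u by blast
    have "inv\<^bsub>S \<times>\<times> S\<^esub> x = (\<phi> (inv u), inv u)"
      using u uS h.hom_inv[of u] Mor_closed by (simp add: inv_restrict_carrier[OF P])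
    then show "inv\<^bsub>S \<times>\<times> S\<^esub> x \<in> graph P \<phi>" using subgroupE(3)[OF P u(1)] by (simp add: mem_graph_iff)
    fix y assume "y \<in> graph P \<phi>"
    then show "x \<otimes>\<^bsub>S \<times>\<times> S\<^esub> y \<in> graph P \<phi>"
      using u Mor_mult subgroupE(4)[OF P] by (auto simp: graph_def image_iff)
  qed
qed

lemma inverse_Mor: "restrict (inv_into P \<phi>) (\<phi> ` P) \<in> F (\<phi> ` P) P"
  using iso_in[OF P subgroup_carrier \<phi>] by simp

text \<open>
  The graph of \<open>\<psi> \<circ> \<phi>\<^sup>-\<^sup>1\<close> in the parametrization by \<open>P\<close> in which it occurs when compositions of
  bisets are analysed.
\<close>

lemma compose_inverse_Mor:
  assumes \<psi>: "\<psi> \<in> Mor P"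
  shows "\<exists>\<chi>\<in>Mor (\<phi> ` P). graph (\<phi> ` P) \<chi> = (\<lambda>u. (\<psi> u, \<phi> u)) ` P"
proof
  let ?\<chi> = "compose (\<phi> ` P) \<psi> (restrict (inv_into P \<phi>) (\<phi> ` P))"
  show "?\<chi> \<in> Mor (\<phi> ` P)"
    by (rule comp_in[OF Mor_image_subgroup P subgroup_carrier inverse_Mor \<psi>])
  show "graph (\<phi> ` P) ?\<chi> = (\<lambda>u. (\<psi> u, \<phi> u)) ` P"
    unfolding graph_def image_image
    by (intro image_cong refl) (simp add: compose_def inv_into_f_f[OF Mor_inj])
qed

lemma Mor_restrict:
  assumes Q: "subgroup Q S" and "Q \<subseteq> P"
  shows "restrict \<phi> Q \<in> Mor Q"
proof -
  have QS: "u \<in> carrier S" if "u \<in> Q" for u using that subgroup.subset[OF Q] by blast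
  then have "conj_map S \<one> Q \<in> F Q P"
    using assms(2) by (intro conj_in[OF Q P]) (auto simp: conj_map_def)
  then have "compose Q \<phi> (conj_map S \<one> Q) \<in> Mor Q"
    by (rule comp_in[OF Q P subgroup_carrier _ \<phi>])
  moreover have "compose Q \<phi> (conj_map S \<one> Q) = restrict \<phi> Q"
    using QS by (auto simp: compose_def conj_map_def restrict_def)
  ultimately show ?thesis by simp
qed

end

lemma id_Mor: "subgroup P S \<Longrightarrow> restrict id P \<in> Mor P"
proof -
  assume P: "subgroup P S"
  then have PS: "u \<in> carrier S" if "u \<in> P" for u using that subgroup.subset by blast
  then have "conj_map S \<one> P \<in> Mor P"
    by (intro conj_in[OF P subgroup_carrier]) (auto simp: conj_map_def)
  moreover have "conj_map S \<one> P = restrict id P"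
    using PS by (auto simp: conj_map_def restrict_def)
  ultimately show ?thesis by simp
qed

lemma graph_restrict: "graph P (restrict \<phi> P) = graph P \<phi>"
  by (auto simp: graph_def)

lemma finite_Mor: "subgroup P S \<Longrightarrow> finite (Mor P)"
proof -
  assume P: "subgroup P S"
  have "Mor P \<subseteq> P \<rightarrow>\<^sub>E carrier S"
    using Mor_closed[OF P] Mor_extensional[OF P] by (auto simp: PiE_def)
  then show ?thesis
    by (rule finite_subset) (intro finite_PiE finite_subgroup P finite_carrier)
qed

lemma card_Mor_pos: "subgroup P S \<Longrightarrow> card (Mor P) > 0"
  using finite_Mor id_Mor by (auto simp: card_gt_0_iff)

lemma finite_fusion_pairs: "finite (fusion_pairs S F)"
proof -
  have "fusion_pairs S F = (SIGMA P:{P. subgroup P S}. Mor P)"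
    by (auto simp: fusion_pairs_def)
  moreover have "{P. subgroup P S} \<subseteq> Pow (carrier S)" using subgroup.subset by auto
  then have "finite {P. subgroup P S}" using finite_carrier finite_subset by blast
  ultimately show ?thesis using finite_Mor by auto
qed

lemma F_graphs_conj:
  assumes "D \<in> F_graphs" "k \<in> carrier (S \<times>\<times> S)"
  shows "conj_set (S \<times>\<times> S) k D \<in> F_graphs"
proof -
  obtain P \<phi> where D: "D = graph P \<phi>" and P: "subgroup P S" and \<phi>: "\<phi> \<in> Mor P"
    using assms(1) by (auto simp: F_graphs_def)
  obtain a b where k: "k = (a, b)" "a \<in> carrier S" "b \<in> carrier S" using assms(2) by (cases k) auto
  show ?thesis
    using Mor_compose_conj[OF P \<phi> k(3,2)] subgroup_conj_set[OF k(3) P]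
    unfolding D k(1) F_graphs_def by blast
qed

lemma F_graphs_subgroup: "D \<in> F_graphs \<Longrightarrow> subgroup D (S \<times>\<times> S)"
  using subgroup_graph by (auto simp: F_graphs_def)

lemma subgroup_of_F_graph:
  assumes D: "subgroup D (S \<times>\<times> S)" and E: "E \<in> F_graphs" and "D \<subseteq> E"
  shows "D \<in> F_graphs"
proof -
  obtain Q \<psi> where E_eq: "E = graph Q \<psi>" and Q: "subgroup Q S" and \<psi>: "\<psi> \<in> Mor Q"
    using E by (auto simp: F_graphs_def)
  have "group_hom (S \<times>\<times> S) S snd"
    using group_DirProd is_group
    by (intro group_hom.intro group_hom_axioms.intro) (auto simp: hom_def mult_DirProd')
  then have P: "subgroup (snd ` D) S"
    by (rule group_hom.subgroup_img_is_subgroup[OF _ D])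
  have "snd ` D \<subseteq> Q" using \<open>D \<subseteq> E\<close> by (auto simp: E_eq graph_def)
  moreover have "D = graph (snd ` D) (restrict \<psi> (snd ` D))"
    using \<open>D \<subseteq> E\<close> unfolding graph_restrict by (force simp: E_eq graph_def)
  ultimately show ?thesis
    using Mor_restrict[OF Q \<psi> P] P unfolding F_graphs_def by blast
qed

lemma converse_in_F_graphs:
  assumes P: "subgroup P S" and \<phi>: "\<phi> \<in> Mor P"
  shows "\<exists>\<chi>\<in>Mor (\<phi> ` P). (graph P \<phi>)\<inverse> = graph (\<phi> ` P) \<chi>"
proof -
  obtain \<chi> where "\<chi> \<in> Mor (\<phi> ` P)" "graph (\<phi> ` P) \<chi> = (\<lambda>u. (restrict id P u, \<phi> u)) ` P"
    using compose_inverse_Mor[OF P \<phi> id_Mor[OF P]] by blast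
  moreover have "(\<lambda>u. (restrict id P u, \<phi> u)) ` P = (graph P \<phi>)\<inverse>"
    by (auto simp: graph_def image_iff)
  ultimately show ?thesis by auto
qed

end

section \<open>Marks of the characteristic idempotent\<close>

context fusion_system
begin

lemma is_gset_graph_biset:
  "\<lbrakk>subgroup P S; \<phi> \<in> Mor P\<rbrakk> \<Longrightarrow> is_gset (S \<times>\<times> S) (graph_biset S S P \<phi>)"
  unfolding graph_biset_def
  by (rule group.is_gset_coset_gset[OF group_DirProd finite_DirProd subgroup_graph])

lemma stab_sum_graph_biset:
  assumes "subgroup P S" "\<phi> \<in> Mor P"
  shows "stab_sum (S \<times>\<times> S) w (graph_biset S S P \<phi>)
    = (\<Sum>k\<in>carrier (S \<times>\<times> S). w (conj_set (S \<times>\<times> S) k (graph P \<phi>))) / of_nat (card P)"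
  unfolding graph_biset_def
  using group.stab_sum_coset_gset[OF group_DirProd finite_DirProd subgroup_graph[OF assms]]
  by (simp add: card_graph)

context
  fixes I :: "('a set \<times> ('a \<Rightarrow> 'a)) set" and c :: "'a set \<times> ('a \<Rightarrow> 'a) \<Rightarrow> rat"
  assumes I: "I \<subseteq> fusion_pairs S F" and c: "\<And>i. i \<in> I \<Longrightarrow> c i \<in> Z_loc p"
begin

lemma F_comb_in_loc:
  "burnside_comb p (S \<times>\<times> S) I c (\<lambda>(P, \<phi>). graph_biset S S P \<phi>) \<in> burnside_loc p (S \<times>\<times> S)"
  by (rule burnside_comb_in_loc[OF prime_p group_DirProd])
    (use I c in \<open>auto simp: fusion_pairs_def intro: is_gset_graph_biset\<close>)

lemma weight_F_comb:
  "weight (S \<times>\<times> S) w (burnside_comb p (S \<times>\<times> S) I c (\<lambda>(P, \<phi>). graph_biset S S P \<phi>))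
   = (\<Sum>(P, \<phi>)\<in>I. c (P, \<phi>) *
       ((\<Sum>k\<in>carrier (S \<times>\<times> S). w (conj_set (S \<times>\<times> S) k (graph P \<phi>))) / of_nat (card P)))"
proof -
  have "weight (S \<times>\<times> S) w (burnside_comb p (S \<times>\<times> S) I c (\<lambda>(P, \<phi>). graph_biset S S P \<phi>))
      = (\<Sum>i\<in>I. c i * stab_sum (S \<times>\<times> S) w ((\<lambda>(P, \<phi>). graph_biset S S P \<phi>) i))"
    by (rule weight_burnside_comb[OF prime_p group_DirProd])
      (use I c in \<open>auto simp: fusion_pairs_def intro: is_gset_graph_biset\<close>)
  also have "\<dots> = (\<Sum>(P, \<phi>)\<in>I. c (P, \<phi>) *
       ((\<Sum>k\<in>carrier (S \<times>\<times> S). w (conj_set (S \<times>\<times> S) k (graph P \<phi>))) / of_nat (card P)))"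
    by (rule sum.cong[OF refl])
      (use I in \<open>auto simp: fusion_pairs_def stab_sum_graph_biset split: prod.splits\<close>)
  finally show ?thesis .
qed

end

lemma F_generated_in_loc: "F_generated p S F \<alpha> \<Longrightarrow> \<alpha> \<in> burnside_loc p (S \<times>\<times> S)"
  unfolding F_generated_def using F_comb_in_loc by blast

text \<open>
  All stabilizers that occur in an \<open>F\<close>-generated element are conjugates of graphs of morphisms, and
  these are again such graphs.
\<close>

lemma weight_cong_F_graphs:
  assumes "F_generated p S F \<alpha>" and w: "\<And>E. E \<in> F_graphs \<Longrightarrow> w E = w' E"
  shows "weight (S \<times>\<times> S) w \<alpha> = weight (S \<times>\<times> S) w' \<alpha>"
proof -
  obtain I c where I: "I \<subseteq> fusion_pairs S F" and c: "\<And>i. i \<in> I \<Longrightarrow> c i \<in> Z_loc p"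
    and \<alpha>: "\<alpha> = burnside_comb p (S \<times>\<times> S) I c (\<lambda>(P, \<phi>). graph_biset S S P \<phi>)"
    using assms(1) by (auto simp: F_generated_def)
  have "w (conj_set (S \<times>\<times> S) k (graph P \<phi>)) = w' (conj_set (S \<times>\<times> S) k (graph P \<phi>))"
    if "(P, \<phi>) \<in> I" "k \<in> carrier (S \<times>\<times> S)" for P \<phi> k
  proof (rule w, rule F_graphs_conj[OF _ that(2)])
    show "graph P \<phi> \<in> F_graphs" using that(1) I by (auto simp: F_graphs_def fusion_pairs_def)
  qed
  then have sums: "(\<Sum>k\<in>carrier (S \<times>\<times> S). w (conj_set (S \<times>\<times> S) k (graph P \<phi>)))
      = (\<Sum>k\<in>carrier (S \<times>\<times> S). w' (conj_set (S \<times>\<times> S) k (graph P \<phi>)))" if "(P, \<phi>) \<in> I" for P \<phi>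
    using that by (intro sum.cong) blast+
  have comb: "weight (S \<times>\<times> S) v \<alpha> = (\<Sum>(P, \<phi>)\<in>I. c (P, \<phi>) *
       ((\<Sum>k\<in>carrier (S \<times>\<times> S). v (conj_set (S \<times>\<times> S) k (graph P \<phi>))) / of_nat (card P)))" for v
    unfolding \<alpha> by (rule weight_F_comb[OF I]) (rule c)
  show ?thesis
    unfolding comb by (rule sum.cong[OF refl]) (use sums in \<open>auto split: prod.splits\<close>)
qed

lemma mark_graph:
  assumes "\<alpha> \<in> burnside_loc p (S \<times>\<times> S)" "subgroup P S" "\<phi> \<in> Mor P"
  shows "mark (graph P \<phi>) \<alpha> = weight (S \<times>\<times> S) (\<lambda>E. of_bool (graph P \<phi> \<subseteq> E)) \<alpha>"
  by (rule mark_eq_weight[OF assms(1) subgroup.subset[OF subgroup_graph[OF assms(2,3)]]])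

text \<open>
  The only graph over \<open>P\<close> inside the graph of \<open>\<psi>\<close> is that of the restriction of \<open>\<psi>\<close>.
\<close>

lemma sum_Mor_subset_graph:
  assumes P: "subgroup P S" and Q: "subgroup Q S" and \<psi>: "\<psi> \<in> Mor Q"
  shows "(\<Sum>\<eta>\<in>Mor P. of_bool (graph P \<eta> \<subseteq> graph Q \<psi>) * f \<eta>)
    = of_bool (P \<subseteq> Q) * (f (restrict \<psi> P) :: rat)"
proof -
  have "(\<Sum>\<eta>\<in>Mor P. of_bool (graph P \<eta> \<subseteq> graph Q \<psi>) * f \<eta>)
      = (\<Sum>\<eta>\<in>Mor P. if \<eta> = restrict \<psi> P then of_bool (P \<subseteq> Q) * f \<eta> else 0)"
    by (rule sum.cong[OF refl])
      (auto simp: graph_subset_graph_iff Mor_extensional[OF P])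
  also have "\<dots> = of_bool (P \<subseteq> Q) * f (restrict \<psi> P)"
    using finite_Mor[OF P] Mor_restrict[OF Q \<psi> P] by (auto simp: sum.delta')
  finally show ?thesis .
qed

lemma one_in_F_graph: "E \<in> F_graphs \<Longrightarrow> (\<one>, \<one>) \<in> E"
  using subgroup.one_closed[OF F_graphs_subgroup] by fastforce

lemma F_graph_one:
  "\<lbrakk>E \<in> F_graphs; (h, \<one>) \<in> E\<rbrakk> \<Longrightarrow> h = \<one>" "\<lbrakk>E \<in> F_graphs; (\<one>, h) \<in> E\<rbrakk> \<Longrightarrow> h = \<one>"
proof -
  assume "E \<in> F_graphs"
  then obtain P \<phi> where E: "E = graph P \<phi>" and P: "subgroup P S" and \<phi>: "\<phi> \<in> Mor P"
    by (auto simp: F_graphs_def)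
  show "h = \<one>" if "(h, \<one>) \<in> E"
    using that Mor_one[OF P \<phi>] by (simp add: E mem_graph_iff)
  show "h = \<one>" if "(\<one>, h) \<in> E"
    using that Mor_one[OF P \<phi>] Mor_inj[OF P \<phi>] subgroup.one_closed[OF P]
    by (auto simp: E mem_graph_iff inj_on_def)
qed

text \<open>
  If \<open>B\<close> is the graph of \<open>\<psi>\<close>, then the element \<open>h\<close> in the definition of the kernel can only be
  \<open>\<psi>(u)\<close>. So the kernel tests whether the restriction \<open>\<eta>\<close> of \<open>\<psi>\<close> to \<open>P\<close> has the graph of
  \<open>\<phi> \<circ> \<eta>\<^sup>-\<^sup>1\<close> inside \<open>A\<close>. Writing this as a sum over all \<open>\<eta>\<close> separates the variables \<open>A\<close> and \<open>B\<close>.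
\<close>

lemma comp_kernel_F_graphs:
  assumes P: "subgroup P S" and \<phi>: "\<phi> \<in> Mor P" and A: "A \<in> F_graphs" and B: "B \<in> F_graphs"
  shows "comp_kernel S S S (graph P \<phi>) A B =
    (\<Sum>\<eta>\<in>Mor P. of_bool ((\<lambda>u. (\<phi> u, \<eta> u)) ` P \<subseteq> A) / of_nat (order S) * of_bool (graph P \<eta> \<subseteq> B))"
proof -
  obtain Q \<psi> where Bg: "B = graph Q \<psi>" and Q: "subgroup Q S" and \<psi>: "\<psi> \<in> Mor Q"
    using B by (auto simp: F_graphs_def)
  have "{h \<in> carrier S. (\<one>, h) \<in> A \<and> (h, \<one>) \<in> B} = {\<one>}"
    using one_in_F_graph[OF A] one_in_F_graph[OF B] F_graph_one(1)[OF B] by auto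
  moreover have "(\<forall>(k, g)\<in>graph P \<phi>. \<exists>h\<in>carrier S. (k, h) \<in> A \<and> (h, g) \<in> B)
      \<longleftrightarrow> P \<subseteq> Q \<and> (\<lambda>u. (\<phi> u, restrict \<psi> P u)) ` P \<subseteq> A"
    using Mor_closed[OF Q \<psi>] by (auto simp: Bg graph_def image_subset_iff)
  ultimately have "comp_kernel S S S (graph P \<phi>) A B
      = of_bool (P \<subseteq> Q) * (of_bool ((\<lambda>u. (\<phi> u, restrict \<psi> P u)) ` P \<subseteq> A) / of_nat (order S))"
    unfolding comp_kernel_def by simp
  also have "\<dots> = (\<Sum>\<eta>\<in>Mor P. of_bool (graph P \<eta> \<subseteq> B) * (of_bool ((\<lambda>u. (\<phi> u, \<eta> u)) ` P \<subseteq> A) / of_nat (order S)))"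
    unfolding Bg by (rule sum_Mor_subset_graph[OF P Q \<psi>, symmetric])
  finally show ?thesis by (simp add: mult.commute)
qed

text \<open>
  The pairs lying over a fixed point of the composition are sorted by the morphism \<open>\<eta>\<close> that
  transports the action of \<open>P\<close> from one factor to the other. The division by \<open>|S|\<close> reflects that \<open>S\<close> acts
  freely on the pairs.
\<close>

lemma mark_comp_F_generated:
  assumes \<alpha>: "F_generated p S F \<alpha>" and \<beta>: "F_generated p S F \<beta>"
    and P: "subgroup P S" and \<phi>: "\<phi> \<in> Mor P"
  shows "mark (graph P \<phi>) (biset_comp p S S S \<beta> \<alpha>) =
    (\<Sum>\<eta>\<in>Mor P. mark (graph P \<eta>) \<alpha> * mark ((\<lambda>u. (\<phi> u, \<eta> u)) ` P) \<beta>) / of_nat (order S)"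
proof -
  let ?T = "S \<times>\<times> S" and ?E = "\<lambda>\<eta>. (\<lambda>u. (\<phi> u, \<eta> u)) ` P"
  have \<alpha>_loc: "\<alpha> \<in> burnside_loc p ?T" and \<beta>_loc: "\<beta> \<in> burnside_loc p ?T"
    using \<alpha> \<beta> F_generated_in_loc by auto
  have E: "mark (?E \<eta>) \<beta> = weight ?T (\<lambda>A. of_bool (?E \<eta> \<subseteq> A)) \<beta>" if "\<eta> \<in> Mor P" for \<eta>
    by (rule mark_eq_weight[OF \<beta>_loc]) (use Mor_closed[OF P \<phi>] Mor_closed[OF P that] in auto)
  have inner: "weight ?T (comp_kernel S S S (graph P \<phi>) A) \<alpha>
      = (\<Sum>\<eta>\<in>Mor P. mark (graph P \<eta>) \<alpha> / of_nat (order S) * of_bool (?E \<eta> \<subseteq> A))"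
    if A: "A \<in> F_graphs" for A
  proof -
    have "weight ?T (comp_kernel S S S (graph P \<phi>) A) \<alpha> = weight ?T (\<lambda>B. \<Sum>\<eta>\<in>Mor P.
        of_bool (?E \<eta> \<subseteq> A) / of_nat (order S) * of_bool (graph P \<eta> \<subseteq> B)) \<alpha>"
      by (rule weight_cong_F_graphs[OF \<alpha>]) (rule comp_kernel_F_graphs[OF P \<phi> A])
    also have "\<dots> = (\<Sum>\<eta>\<in>Mor P. mark (graph P \<eta>) \<alpha> / of_nat (order S) * of_bool (?E \<eta> \<subseteq> A))"
      unfolding weight_sum weight_scale
      by (rule sum.cong[OF refl]) (simp add: mark_graph[OF \<alpha>_loc P])
    finally show ?thesis .
  qed
  have "mark (graph P \<phi>) (biset_comp p S S S \<beta> \<alpha>)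
      = weight ?T (\<lambda>A. weight ?T (comp_kernel S S S (graph P \<phi>) A) \<alpha>) \<beta>"
    by (rule mark_biset_comp[OF prime_p is_group is_group is_group finite_carrier \<beta>_loc \<alpha>_loc
        subgroup.subset[OF subgroup_graph[OF P \<phi>]]])
  also have "\<dots> = weight ?T (\<lambda>A. \<Sum>\<eta>\<in>Mor P. mark (graph P \<eta>) \<alpha> / of_nat (order S) * of_bool (?E \<eta> \<subseteq> A)) \<beta>"
    by (rule weight_cong_F_graphs[OF \<beta> inner])
  also have "\<dots> = (\<Sum>\<eta>\<in>Mor P. mark (graph P \<eta>) \<alpha> * mark (?E \<eta>) \<beta>) / of_nat (order S)"
    unfolding weight_sum weight_scale sum_divide_distrib
    by (rule sum.cong[OF refl]) (simp add: E)
  finally show ?thesis .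
qed

lemma group_restrict_carrier: "subgroup P S \<Longrightarrow> group (S\<lparr>carrier := P\<rparr>)"
  by (rule subgroup.subgroup_is_group[OF _ is_group])

context
  fixes P \<phi>
  assumes P: "subgroup P S" and \<phi>: "\<phi> \<in> Mor P"
begin

lemma subgroup_graph_restrict_carrier: "subgroup (graph P \<phi>) (S \<times>\<times> (S\<lparr>carrier := P\<rparr>))"
proof -
  have "subgroup (carrier S \<times> P) (S \<times>\<times> S)"
    by (rule DirProd_subgroups[OF is_group subgroup_carrier is_group P])
  moreover have "graph P \<phi> \<subseteq> carrier S \<times> P"
    using Mor_closed[OF P \<phi>] by (auto simp: graph_def)
  ultimately have "subgroup (graph P \<phi>) ((S \<times>\<times> S)\<lparr>carrier := carrier S \<times> P\<rparr>)"
    using group.subgroup_incl[OF group_DirProd subgroup_graph[OF P \<phi>]] by blast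
  then show ?thesis by (simp add: DirProd_def)
qed

lemma subgroup_converse_graph: "subgroup ((graph P \<phi>)\<inverse>) (S \<times>\<times> S)"
  using converse_in_F_graphs[OF P \<phi>] subgroup_graph[OF Mor_image_subgroup[OF P \<phi>]] by auto

lemma subgroup_converse_graph_restrict_carrier: "subgroup ((graph P \<phi>)\<inverse>) ((S\<lparr>carrier := P\<rparr>) \<times>\<times> S)"
proof -
  have "subgroup (P \<times> carrier S) (S \<times>\<times> S)"
    by (rule DirProd_subgroups[OF is_group P is_group subgroup_carrier])
  moreover have "(graph P \<phi>)\<inverse> \<subseteq> P \<times> carrier S"
    using Mor_closed[OF P \<phi>] by (auto simp: graph_def)
  ultimately have "subgroup ((graph P \<phi>)\<inverse>) ((S \<times>\<times> S)\<lparr>carrier := P \<times> carrier S\<rparr>)"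
    using group.subgroup_incl[OF group_DirProd subgroup_converse_graph] by blast
  then show ?thesis by (simp add: DirProd_def)
qed

text \<open>
  For \<open>k \<in> P\<close> the conjugate graph still has the domain \<open>P\<close>. So the stabilizers in \<open>[P, \<phi>]\<^sub>P\<^sup>S\<close> are graphs
  over \<open>P\<close>, and those in \<open>[\<phi>P, \<phi>\<^sup>-\<^sup>1]\<^sub>S\<^sup>P\<close> are converses of such graphs.
\<close>

lemma conj_graph_over_P:
  assumes s: "s \<in> carrier S" and k: "k \<in> P"
  obtains \<chi> where "\<chi> \<in> Mor P" "conj_set (S \<times>\<times> S) (s, k) (graph P \<phi>) = graph P \<chi>"
proof -
  have kS: "k \<in> carrier S" using subgroup.subset[OF P] k by blast
  show ?thesis
    using Mor_compose_conj[OF P \<phi> kS s] that unfolding conj_set_subgroup_self[OF P k] by blast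
qed

text \<open>
  In both kernels below, the element \<open>h\<close> that connects \<open>u\<close> with itself through the graph of \<open>\<phi>\<close> is
  forced to be \<open>\<phi>(u)\<close>.
\<close>

lemma comp_kernel_left:
  assumes "B \<in> F_graphs"
  shows "comp_kernel S S (S\<lparr>carrier := P\<rparr>) (graph P id) ((graph P \<phi>)\<inverse>) B = of_bool (graph P \<phi> \<subseteq> B) / of_nat (order S)"
proof -
  have "{h \<in> carrier S. (\<one>\<^bsub>(S\<lparr>carrier := P\<rparr>)\<^esub>, h) \<in> (graph P \<phi>)\<inverse> \<and> (h, \<one>) \<in> B} = {\<one>}"
    using one_in_F_graph[OF assms] Mor_one[OF P \<phi>] subgroup.one_closed[OF P]
    by (auto simp: mem_graph_iff)
  moreover have "(\<forall>(k, g)\<in>graph P id. \<exists>h\<in>carrier S. (k, h) \<in> (graph P \<phi>)\<inverse> \<and> (h, g) \<in> B) \<longleftrightarrow> graph P \<phi> \<subseteq> B"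
    using Mor_closed[OF P \<phi>] by (auto simp: graph_def)
  ultimately show ?thesis unfolding comp_kernel_def by simp
qed

lemma comp_kernel_right:
  assumes "A \<in> F_graphs"
  shows "comp_kernel (S\<lparr>carrier := P\<rparr>) S S (graph P id) A (graph P \<phi>) = of_bool ((graph P \<phi>)\<inverse> \<subseteq> A) / of_nat (order S)"
proof -
  have "{h \<in> carrier S. (\<one>, h) \<in> A \<and> (h, \<one>\<^bsub>(S\<lparr>carrier := P\<rparr>)\<^esub>) \<in> graph P \<phi>} = {\<one>}"
    using one_in_F_graph[OF assms] Mor_one[OF P \<phi>] subgroup.one_closed[OF P]
    by (auto simp: mem_graph_iff)
  moreover have "(\<forall>(k, g)\<in>graph P id. \<exists>h\<in>carrier S. (k, h) \<in> A \<and> (h, g) \<in> graph P \<phi>) \<longleftrightarrow> (graph P \<phi>)\<inverse> \<subseteq> A"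
  proof -
    have "(graph P \<phi>)\<inverse> \<subseteq> A \<longleftrightarrow> (\<forall>u\<in>P. (u, \<phi> u) \<in> A)" by (auto simp: graph_def)
    then show ?thesis using Mor_closed[OF P \<phi>] by (auto simp: graph_def)
  qed
  ultimately show ?thesis unfolding comp_kernel_def by simp
qed

end

text \<open>
  Composing with \<open>[\<phi>P, \<phi>\<^sup>-\<^sup>1]\<close> on the left restricts the left action along \<open>\<phi>\<close>, which turns the mark at
  \<open>\<Delta>(P, id)\<close> into the mark at \<open>\<Delta>(P, \<phi>)\<close>. The proof shows that each point of the biset
  \<open>[\<phi>P, \<phi>\<^sup>-\<^sup>1]\<close> contributes the same amount, since its stabilizer differs from the converse of
  \<open>\<Delta>(P, \<phi>)\<close> by a conjugation, under which marks are invariant.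
\<close>

lemma mark_comp_left:
  assumes P: "subgroup P S" and \<phi>: "\<phi> \<in> Mor P" and \<alpha>: "F_generated p S F \<alpha>"
  shows "mark (graph P id) (biset_comp p S S (S\<lparr>carrier := P\<rparr>)
      (burnside_basic p (S\<lparr>carrier := P\<rparr> \<times>\<times> S) (coset_gset (S\<lparr>carrier := P\<rparr> \<times>\<times> S) ((graph P \<phi>)\<inverse>))) \<alpha>)
    = mark (graph P \<phi>) \<alpha>"
proof -
  let ?SP = "S\<lparr>carrier := P\<rparr>"
  let ?K = "?SP \<times>\<times> S" and ?T = "S \<times>\<times> S"
  let ?X = "coset_gset ?K ((graph P \<phi>)\<inverse>)"
  let ?w = "\<lambda>A. weight ?T (comp_kernel S S ?SP (graph P id) A) \<alpha>"
  have \<alpha>_loc: "\<alpha> \<in> burnside_loc p ?T" by (rule F_generated_in_loc[OF \<alpha>])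
  have K: "group ?K" by (rule DirProd_group[OF group_restrict_carrier[OF P] is_group])
  have finK: "finite (carrier ?K)" using finite_subgroup[OF P] finite_carrier by simp
  have E: "subgroup ((graph P \<phi>)\<inverse>) ?K" by (rule subgroup_converse_graph_restrict_carrier[OF P \<phi>])
  have X: "is_gset ?K ?X" by (rule group.is_gset_coset_gset[OF K finK E])
  have orbit: "?w (conj_set ?K k ((graph P \<phi>)\<inverse>)) = mark (graph P \<phi>) \<alpha> / of_nat (order S)"
    if k_in: "k \<in> carrier ?K" for k
  proof -
    obtain u s where k: "k = (u, s)" "u \<in> P" "s \<in> carrier S" using k_in by auto
    have uS: "u \<in> carrier S" using subgroup.subset[OF P] k(2) by blast
    obtain \<chi> where \<chi>: "\<chi> \<in> Mor P" and eq: "conj_set ?T (s, u) (graph P \<phi>) = graph P \<chi>"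
      by (rule conj_graph_over_P[OF P \<phi> k(3,2)])
    have "conj_set ?K k ((graph P \<phi>)\<inverse>) = conj_set ?T (u, s) ((graph P \<phi>)\<inverse>)"
      unfolding k(1) by (rule conj_set_DirProd_subgroup(2)[OF P is_group k(2,3)])
    also have "\<dots> = (graph P \<chi>)\<inverse>"
      using converse_conj_set_DirProd[OF is_group is_group k(3) uS, of "graph P \<phi>"] eq by simp
    finally have "?w (conj_set ?K k ((graph P \<phi>)\<inverse>))
        = weight ?T (\<lambda>B. 1 / of_nat (order S) * of_bool (graph P \<chi> \<subseteq> B)) \<alpha>"
      using comp_kernel_left[OF P \<chi>] by (auto intro!: weight_cong_F_graphs[OF \<alpha>])
    also have "\<dots> = mark (graph P \<chi>) \<alpha> / of_nat (order S)"
      unfolding weight_scale using mark_graph[OF \<alpha>_loc P \<chi>] by simp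
    also have "mark (graph P \<chi>) \<alpha> = mark (graph P \<phi>) \<alpha>"
      using mark_conj[OF group_DirProd \<alpha>_loc _ subgroup_graph[OF P \<phi>], of "(s, u)"] k uS eq by simp
    finally show ?thesis .
  qed
  have "mark (graph P id) (biset_comp p S S ?SP (burnside_basic p ?K ?X) \<alpha>)
      = weight ?K ?w (burnside_basic p ?K ?X)"
    by (rule mark_biset_comp[OF prime_p is_group is_group group_restrict_carrier[OF P] finite_carrier
          burnside_basic(1)[OF prime_p K X] \<alpha>_loc])
      (use subgroup.subset[OF P] in \<open>auto simp: graph_def\<close>)
  also have "\<dots> = stab_sum ?K ?w ?X"
    by (rule burnside_basic(2)[OF prime_p K X])
  also have "\<dots> = (\<Sum>k\<in>carrier ?K. ?w (conj_set ?K k ((graph P \<phi>)\<inverse>))) / of_nat (card ((graph P \<phi>)\<inverse>))"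
    by (rule group.stab_sum_coset_gset[OF K finK E])
  also have "\<dots> = (\<Sum>k\<in>carrier ?K. mark (graph P \<phi>) \<alpha> / of_nat (order S)) / of_nat (card P)"
    using orbit by (simp add: card_inverse card_graph)
  also have "\<dots> = mark (graph P \<phi>) \<alpha>"
    using card_subgroup_pos[OF P] order_pos by (simp add: card_cartesian_product order_def)
  finally show ?thesis .
qed

text \<open>
  On the right, restricting along \<open>\<phi>\<close> replaces the mark at \<open>\<Delta>(P, id)\<close> by the one at the converse of
  \<open>\<Delta>(P, \<phi>)\<close>, which is the graph \<open>\<Delta>(\<phi>P, \<phi>\<^sup>-\<^sup>1)\<close>.
\<close>

lemma mark_comp_right:
  assumes P: "subgroup P S" and \<phi>: "\<phi> \<in> Mor P" and \<alpha>: "F_generated p S F \<alpha>"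
  shows "mark (graph P id) (biset_comp p (S\<lparr>carrier := P\<rparr>) S S \<alpha>
      (burnside_basic p (S \<times>\<times> S\<lparr>carrier := P\<rparr>) (coset_gset (S \<times>\<times> S\<lparr>carrier := P\<rparr>) (graph P \<phi>))))
    = mark ((graph P \<phi>)\<inverse>) \<alpha>"
proof -
  let ?SP = "S\<lparr>carrier := P\<rparr>"
  let ?K = "S \<times>\<times> ?SP" and ?T = "S \<times>\<times> S"
  let ?X = "coset_gset ?K (graph P \<phi>)"
  let ?w = "comp_kernel ?SP S S (graph P id)"
  have \<alpha>_loc: "\<alpha> \<in> burnside_loc p ?T" by (rule F_generated_in_loc[OF \<alpha>])
  have K: "group ?K" by (rule DirProd_group[OF is_group group_restrict_carrier[OF P]])
  have finK: "finite (carrier ?K)" using finite_subgroup[OF P] finite_carrier by simp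
  have E: "subgroup (graph P \<phi>) ?K" by (rule subgroup_graph_restrict_carrier[OF P \<phi>])
  have X: "is_gset ?K ?X" by (rule group.is_gset_coset_gset[OF K finK E])
  have orbit: "weight ?T (\<lambda>A. ?w A (conj_set ?K k (graph P \<phi>))) \<alpha> = mark ((graph P \<phi>)\<inverse>) \<alpha> / of_nat (order S)"
    if k_in: "k \<in> carrier ?K" for k
  proof -
    obtain s u where k: "k = (s, u)" "u \<in> P" "s \<in> carrier S" using k_in by auto
    have uS: "u \<in> carrier S" using subgroup.subset[OF P] k(2) by blast
    obtain \<chi> where \<chi>: "\<chi> \<in> Mor P" and eq: "conj_set ?T (s, u) (graph P \<phi>) = graph P \<chi>"
      by (rule conj_graph_over_P[OF P \<phi> k(3,2)])
    have "conj_set ?K k (graph P \<phi>) = graph P \<chi>"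
      unfolding k(1) eq[symmetric] by (rule conj_set_DirProd_subgroup(1)[OF P is_group k(2,3)])
    then have "weight ?T (\<lambda>A. ?w A (conj_set ?K k (graph P \<phi>))) \<alpha>
        = weight ?T (\<lambda>A. 1 / of_nat (order S) * of_bool ((graph P \<chi>)\<inverse> \<subseteq> A)) \<alpha>"
      using comp_kernel_right[OF P \<chi>] by (auto intro!: weight_cong_F_graphs[OF \<alpha>])
    also have "\<dots> = mark ((graph P \<chi>)\<inverse>) \<alpha> / of_nat (order S)"
      unfolding weight_scale
      using mark_eq_weight[OF \<alpha>_loc subgroup.subset[OF subgroup_converse_graph[OF P \<chi>]]] by simp
    also have "(graph P \<chi>)\<inverse> = conj_set ?T (u, s) ((graph P \<phi>)\<inverse>)"
      using converse_conj_set_DirProd[OF is_group is_group k(3) uS, of "graph P \<phi>"] eq by simp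
    also have "mark (conj_set ?T (u, s) ((graph P \<phi>)\<inverse>)) \<alpha> = mark ((graph P \<phi>)\<inverse>) \<alpha>"
      by (rule mark_conj[OF group_DirProd \<alpha>_loc _ subgroup_converse_graph[OF P \<phi>]])
        (use k uS in simp)
    finally show ?thesis .
  qed
  have "mark (graph P id) (biset_comp p ?SP S S \<alpha> (burnside_basic p ?K ?X))
      = weight ?T (\<lambda>A. weight ?K (?w A) (burnside_basic p ?K ?X)) \<alpha>"
    by (rule mark_biset_comp[OF prime_p group_restrict_carrier[OF P] is_group is_group finite_carrier
          \<alpha>_loc burnside_basic(1)[OF prime_p K X]])
      (use subgroup.subset[OF P] in \<open>auto simp: graph_def\<close>)
  also have "(\<lambda>A. weight ?K (?w A) (burnside_basic p ?K ?X))
      = (\<lambda>A. 1 / of_nat (card P) * (\<Sum>k\<in>carrier ?K. ?w A (conj_set ?K k (graph P \<phi>))))"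
    using burnside_basic(2)[OF prime_p K X] group.stab_sum_coset_gset[OF K finK E]
    by (simp add: card_graph)
  also have "weight ?T \<dots> \<alpha> = 1 / of_nat (card P) * (\<Sum>k\<in>carrier ?K. mark ((graph P \<phi>)\<inverse>) \<alpha> / of_nat (order S))"
    unfolding weight_scale weight_sum using orbit by simp
  also have "\<dots> = mark ((graph P \<phi>)\<inverse>) \<alpha>"
    using card_subgroup_pos[OF P] order_pos by (simp add: card_cartesian_product order_def)
  finally show ?thesis .
qed

text \<open>
  Left stability makes the mark at \<open>\<Delta>(P, \<phi>)\<close> independent of \<open>\<phi>\<close>. Right stability identifies the
  marks at \<open>\<Delta>(P, id)\<close> and \<open>\<Delta>(\<phi>P, \<phi>\<^sup>-\<^sup>1)\<close>, and left stability over \<open>\<phi>P\<close> moves on to \<open>\<Delta>(\<phi>P, id)\<close>.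
\<close>

lemma mark_F_stable:
  assumes gen: "F_generated p S F \<alpha>" and left: "left_F_stable p S F \<alpha>" and right: "right_F_stable p S F \<alpha>"
    and P: "subgroup P S" and \<phi>: "\<phi> \<in> Mor P"
  shows "mark (graph P \<phi>) \<alpha> = mark (graph P id) \<alpha>"
    and "mark (graph (\<phi> ` P) id) \<alpha> = mark (graph P id) \<alpha>"
proof -
  have conv_id: "(graph P id)\<inverse> = graph P id" for P :: "'a set"
    by (auto simp: graph_def)
  have left_inv: "mark (graph P \<phi>) \<alpha> = mark (graph P id) \<alpha>"
    if P: "subgroup P S" and \<phi>: "\<phi> \<in> Mor P" for P \<phi>
  proof -
    let ?SP = "S\<lparr>carrier := P\<rparr>"
    have "biset_comp p S S ?SP (graph_elem p S ?SP (\<phi> ` P) (inv_into P \<phi>)) \<alpha>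
        = biset_comp p S S ?SP (graph_elem p S ?SP P id) \<alpha>"
      using left P \<phi> unfolding left_F_stable_def by blast
    then show ?thesis
      using mark_comp_left[OF P \<phi> gen] mark_comp_left[OF P id_Mor[OF P] gen]
      by (simp add: graph_elem_def graph_biset_def converse_graph_inj[OF Mor_inj[OF P \<phi>]]
          conv_id graph_restrict)
  qed
  then show "mark (graph P \<phi>) \<alpha> = mark (graph P id) \<alpha>" using P \<phi> .
  let ?SP = "S\<lparr>carrier := P\<rparr>"
  have "biset_comp p ?SP S S \<alpha> (graph_elem p ?SP S P \<phi>) = biset_comp p ?SP S S \<alpha> (graph_elem p ?SP S P id)"
    using right P \<phi> unfolding right_F_stable_def by blast
  then have "mark ((graph P \<phi>)\<inverse>) \<alpha> = mark (graph P id) \<alpha>"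
    using mark_comp_right[OF P \<phi> gen] mark_comp_right[OF P id_Mor[OF P] gen]
    by (simp add: graph_elem_def graph_biset_def conv_id graph_restrict)
  moreover obtain \<chi> where "\<chi> \<in> Mor (\<phi> ` P)" "(graph P \<phi>)\<inverse> = graph (\<phi> ` P) \<chi>"
    using converse_in_F_graphs[OF P \<phi>] by blast
  ultimately show "mark (graph (\<phi> ` P) id) \<alpha> = mark (graph P id) \<alpha>"
    using left_inv[OF Mor_image_subgroup[OF P \<phi>]] by simp
qed

lemma augmentation_eq_weight: "augmentation S \<alpha> = weight (S \<times>\<times> S) (\<lambda>_. 1 / of_nat (order S)) \<alpha>"
  by (simp add: augmentation_def Let_def weight_def formal_weight_def stab_sum_def)

text \<open>
  The left orbits of \<open>(S \<times> S) / \<Delta>(Q, \<chi>)\<close> form the \<open>P\<close>-set \<open>S/Q\<close>, whose size is the augmentation of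
  \<open>[Q, \<chi>]\<close>. A point \<open>x\<close> lies over a \<open>P\<close>-fixed orbit iff its stabilizer contains \<open>\<Delta>(P, \<eta>)\<close> for some
  \<open>\<eta>\<close>, which is then unique. So the sum of the marks, divided by \<open>|S|\<close>, is the number of \<open>P\<close>-fixed
  points of \<open>S/Q\<close>, and \<open>P\<close> is a \<open>p\<close>-group.
\<close>

lemma augmentation_congruence:
  assumes gen: "F_generated p S F \<alpha>" and P: "subgroup P S"
  shows "\<exists>z\<in>Z_loc p. augmentation S \<alpha> - (\<Sum>\<eta>\<in>Mor P. mark (graph P \<eta>) \<alpha>) / of_nat (order S) = of_nat p * z"
proof -
  let ?T = "S \<times>\<times> S"
  obtain I c where I: "I \<subseteq> fusion_pairs S F" and c: "\<And>i. i \<in> I \<Longrightarrow> c i \<in> Z_loc p"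
    and \<alpha>: "\<alpha> = burnside_comb p ?T I c (\<lambda>(P, \<phi>). graph_biset S S P \<phi>)"
    using gen by (auto simp: F_generated_def)
  have \<alpha>_loc: "\<alpha> \<in> burnside_loc p ?T" by (rule F_generated_in_loc[OF gen])
  have comb: "weight ?T v \<alpha> = (\<Sum>(Q, \<chi>)\<in>I. c (Q, \<chi>) *
       ((\<Sum>k\<in>carrier ?T. v (conj_set ?T k (graph Q \<chi>))) / of_nat (card Q)))" for v
    unfolding \<alpha> by (rule weight_F_comb[OF I]) (rule c)
  have pairs: "subgroup Q S" "\<chi> \<in> Mor Q" if "(Q, \<chi>) \<in> I" for Q \<chi>
    using I that by (auto simp: fusion_pairs_def)
  have points: "(\<Sum>k\<in>carrier ?T. 1 / of_nat (order S)) / of_nat (card Q)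
      = (of_nat (card (fst (coset_gset S Q))) :: rat)" if Q: "subgroup Q S" for Q
  proof -
    have "stab_sum S (\<lambda>_. 1) (coset_gset S Q) = of_nat (order S) / of_nat (card Q)"
      using stab_sum_coset_gset[OF finite_carrier Q, of "\<lambda>_. 1"] by (simp add: order_def)
    then show ?thesis
      using order_pos by (simp add: stab_sum_def card_cartesian_product order_def)
  qed
  \<comment> \<open>the second projection of a stabilizer is the stabilizer of the left orbit\<close>
  have fixed: "(\<Sum>k\<in>carrier ?T. of_bool (P \<subseteq> snd ` conj_set ?T k (graph Q \<chi>)) / of_nat (order S)) / of_nat (card Q)
      = (of_nat (card (fixed_points P (coset_gset S Q))) :: rat)" if Q: "subgroup Q S" for Q \<chi>
  proof -
    have "snd ` conj_set ?T (a, b) (graph Q \<chi>) = conj_set S b Q"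
      if "a \<in> carrier S" "b \<in> carrier S" for a b
      unfolding conj_set_DirProd[OF is_group is_group that] by (auto simp: graph_def conj_set_def image_image)
    then have "(\<Sum>k\<in>carrier ?T. of_bool (P \<subseteq> snd ` conj_set ?T k (graph Q \<chi>)) / (of_nat (order S) :: rat))
        = (\<Sum>(a, b)\<in>carrier S \<times> carrier S. of_bool (P \<subseteq> conj_set S b Q) / of_nat (order S))"
      by (intro sum.cong) auto
    also have "\<dots> = (\<Sum>b\<in>carrier S. of_bool (P \<subseteq> conj_set S b Q))"
      using order_pos by (simp add: sum.cartesian_product[symmetric] order_def sum_divide_distrib[symmetric])
    also have "\<dots> = stab_sum S (\<lambda>E. of_bool (P \<subseteq> E)) (coset_gset S Q) * of_nat (card Q)"
      using stab_sum_coset_gset[OF finite_carrier Q] card_subgroup_pos[OF Q] by simp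
    also have "stab_sum S (\<lambda>E. of_bool (P \<subseteq> E)) (coset_gset S Q) = of_nat (card (fixed_points P (coset_gset S Q)))"
      using card_fixed_points[OF is_gset_coset_gset[OF finite_carrier Q] subgroup.subset[OF P]] by simp
    finally show ?thesis using card_subgroup_pos[OF Q] by simp
  qed
  have cong: "int p dvd int (card (fst (coset_gset S Q))) - int (card (fixed_points P (coset_gset S Q)))"
    if Q: "subgroup Q S" for Q
    using p_subgroup_fixed_points[OF is_gset_coset_gset[OF finite_carrier Q] P prime_p] card_subgroup_p_power[OF P] by blast
  define n where "n Q = (int (card (fst (coset_gset S Q))) - int (card (fixed_points P (coset_gset S Q)))) div int p" for Q
  have n: "rat_of_nat (card (fst (coset_gset S Q))) - of_nat (card (fixed_points P (coset_gset S Q))) = of_nat p * of_int (n Q)"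
    if Q: "subgroup Q S" for Q
  proof -
    have "int (card (fst (coset_gset S Q))) - int (card (fixed_points P (coset_gset S Q))) = int p * n Q"
      using cong[OF Q] by (simp add: n_def)
    then show ?thesis by (metis of_int_diff of_int_mult of_int_of_nat_eq)
  qed
  have "(\<Sum>\<eta>\<in>Mor P. mark (graph P \<eta>) \<alpha>) / of_nat (order S)
      = weight ?T (\<lambda>E. \<Sum>\<eta>\<in>Mor P. 1 / of_nat (order S) * of_bool (graph P \<eta> \<subseteq> E)) \<alpha>"
    unfolding weight_sum weight_scale sum_divide_distrib
    by (rule sum.cong[OF refl]) (simp add: mark_graph[OF \<alpha>_loc P])
  also have "\<dots> = weight ?T (\<lambda>E. of_bool (P \<subseteq> snd ` E) / of_nat (order S)) \<alpha>"
  proof (rule weight_cong_F_graphs[OF gen])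
    fix E assume "E \<in> F_graphs"
    then obtain Q \<psi> where E: "E = graph Q \<psi>" and Q: "subgroup Q S" "\<psi> \<in> Mor Q" by (auto simp: F_graphs_def)
    have "snd ` E = Q" by (auto simp: E graph_def image_image)
    then show "(\<Sum>\<eta>\<in>Mor P. 1 / rat_of_nat (order S) * of_bool (graph P \<eta> \<subseteq> E)) = of_bool (P \<subseteq> snd ` E) / of_nat (order S)"
      using sum_Mor_subset_graph[OF P Q, of "\<lambda>_. 1 / of_nat (order S)"] unfolding E by (simp add: mult.commute)
  qed
  also have "\<dots> = (\<Sum>(Q, \<chi>)\<in>I. c (Q, \<chi>) * of_nat (card (fixed_points P (coset_gset S Q))))"
    unfolding comb by (rule sum.cong[OF refl]) (use pairs fixed in \<open>auto simp del: times_divide_eq_right\<close>)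
  finally have marks: "(\<Sum>\<eta>\<in>Mor P. mark (graph P \<eta>) \<alpha>) / of_nat (order S)
      = (\<Sum>(Q, \<chi>)\<in>I. c (Q, \<chi>) * of_nat (card (fixed_points P (coset_gset S Q))))" .
  have "augmentation S \<alpha> = (\<Sum>(Q, \<chi>)\<in>I. c (Q, \<chi>) * of_nat (card (fst (coset_gset S Q))))"
    unfolding augmentation_eq_weight comb
    by (rule sum.cong[OF refl]) (use pairs points in \<open>auto simp del: times_divide_eq_right sum_constant\<close>)
  then have "augmentation S \<alpha> - (\<Sum>\<eta>\<in>Mor P. mark (graph P \<eta>) \<alpha>) / of_nat (order S)
      = (\<Sum>(Q, \<chi>)\<in>I. c (Q, \<chi>) * (of_nat (card (fst (coset_gset S Q))) - of_nat (card (fixed_points P (coset_gset S Q)))))"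
    unfolding marks by (simp add: sum_subtractf[symmetric] right_diff_distrib case_prod_unfold)
  also have "\<dots> = (\<Sum>(Q, \<chi>)\<in>I. of_nat p * (c (Q, \<chi>) * of_int (n Q)))"
    by (rule sum.cong[OF refl]) (use pairs n in auto)
  also have "\<dots> = of_nat p * (\<Sum>(Q, \<chi>)\<in>I. c (Q, \<chi>) * of_int (n Q))"
    by (simp add: sum_distrib_left case_prod_unfold)
  finally show ?thesis
  proof (rule bexI)
    show "(\<Sum>(Q, \<chi>)\<in>I. c (Q, \<chi>) * of_int (n Q)) \<in> Z_loc p"
      by (rule Z_loc_sum[OF prime_p]) (auto intro!: Z_loc_mult[OF prime_p] Z_loc_of_int[OF prime_p] c)
  qed
qed

context
  fixes \<omega>
  assumes \<omega>: "characteristic_idempotent p S F \<omega>"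
begin

lemma characteristic_idempotent_props:
  "F_generated p S F \<omega>" "left_F_stable p S F \<omega>" "right_F_stable p S F \<omega>"
  "biset_comp p S S S \<omega> \<omega> = \<omega>" "\<omega> \<in> burnside_loc p (S \<times>\<times> S)"
  using \<omega> by (auto simp: characteristic_idempotent_def F_characteristic_def)

text \<open>
  If the mark at \<open>P\<close> vanished, then by stability so would the whole sum in \<open>augmentation_congruence\<close>,
  and the unit \<open>\<epsilon>(\<omega>)\<close> would be divisible by \<open>p\<close>.
\<close>

lemma mark_graph_id_nonzero:
  assumes P: "subgroup P S"
  shows "mark (graph P id) \<omega> \<noteq> 0"
proof
  assume zero: "mark (graph P id) \<omega> = 0"
  have "mark (graph P \<eta>) \<omega> = 0" if "\<eta> \<in> Mor P" for \<eta>
    using mark_F_stable(1)[OF characteristic_idempotent_props(1-3) P that] zero by simp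
  then have "(\<Sum>\<eta>\<in>Mor P. mark (graph P \<eta>) \<omega>) = 0" by simp
  then obtain z where z: "z \<in> Z_loc p" "augmentation S \<omega> = of_nat p * z"
    using augmentation_congruence[OF characteristic_idempotent_props(1) P] by auto
  obtain u where u: "u \<in> Z_loc p" "augmentation S \<omega> * u = 1"
    using \<omega> by (auto simp: characteristic_idempotent_def F_characteristic_def)
  have "1 / of_nat p = z * u"
    using u(2) prime_gt_0_nat[OF prime_p] unfolding z(2) by (simp add: field_simps)
  then show False
    using not_inverse_p_Z_loc[OF prime_p] Z_loc_mult[OF prime_p z(1) u(1)] by simp
qed

text \<open>
  For \<open>\<phi> = id\<close> both factors in each of the \<open>|F(P, S)|\<close> summands of \<open>mark_comp_F_generated\<close> are equal
  to the mark at \<open>\<Delta>(P, id)\<close>, so idempotency is a quadratic equation for that mark.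
\<close>

lemma mark_graph_characteristic_idempotent:
  assumes P: "subgroup P S" and \<phi>: "\<phi> \<in> Mor P"
  shows "mark (graph P \<phi>) \<omega> = of_nat (order S) / of_nat (card (Mor P))"
proof -
  let ?f = "mark (graph P id) \<omega>"
  have stable: "mark (graph P \<eta>) \<omega> = ?f" if "\<eta> \<in> Mor P" for \<eta>
    by (rule mark_F_stable(1)[OF characteristic_idempotent_props(1-3) P that])
  \<comment> \<open>\<open>{(u, \<eta>(u))}\<close> is the graph of \<open>\<eta>\<^sup>-\<^sup>1\<close> on \<open>\<eta>P\<close>, an \<open>F\<close>-conjugate of \<open>P\<close>\<close>
  have factor: "mark ((\<lambda>u. (restrict id P u, \<eta> u)) ` P) \<omega> = ?f" if \<eta>: "\<eta> \<in> Mor P" for \<eta>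
  proof -
    obtain \<chi> where "\<chi> \<in> Mor (\<eta> ` P)" "graph (\<eta> ` P) \<chi> = (\<lambda>u. (restrict id P u, \<eta> u)) ` P"
      using compose_inverse_Mor[OF P \<eta> id_Mor[OF P]] by blast
    then show ?thesis
      using mark_F_stable[OF characteristic_idempotent_props(1-3) Mor_image_subgroup[OF P \<eta>]]
        mark_F_stable(2)[OF characteristic_idempotent_props(1-3) P \<eta>] by metis
  qed
  have "?f = mark (graph P (restrict id P)) (biset_comp p S S S \<omega> \<omega>)"
    using characteristic_idempotent_props(4) by (simp add: graph_restrict)
  also have "\<dots> = (\<Sum>\<eta>\<in>Mor P. ?f * ?f) / of_nat (order S)"
    unfolding mark_comp_F_generated[OF characteristic_idempotent_props(1,1) P id_Mor[OF P]]
    by (intro arg_cong2[where f = "(/)"] sum.cong refl) (simp only: stable factor)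
  finally have "?f = of_nat (card (Mor P)) * ?f * ?f / of_nat (order S)" by simp
  then have "?f * of_nat (order S) = of_nat (card (Mor P)) * ?f * ?f"
    using order_pos by (simp add: field_simps)
  then have "of_nat (order S) = of_nat (card (Mor P)) * ?f"
    using mark_graph_id_nonzero[OF P] by simp
  then show ?thesis
    using stable[OF \<phi>] card_Mor_pos[OF P] by (simp add: field_simps)
qed

lemma mark_not_F_graph:
  assumes D: "subgroup D (S \<times>\<times> S)" "D \<notin> F_graphs"
  shows "mark D \<omega> = 0"
proof -
  have "mark D \<omega> = weight (S \<times>\<times> S) (\<lambda>E. of_bool (D \<subseteq> E)) \<omega>"
    by (rule mark_eq_weight[OF characteristic_idempotent_props(5) subgroup.subset[OF D(1)]])
  also have "\<dots> = weight (S \<times>\<times> S) (\<lambda>_. 0) \<omega>"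
    using subgroup_of_F_graph[OF D(1)] D(2) by (intro weight_cong_F_graphs[OF characteristic_idempotent_props(1)]) auto
  also have "\<dots> = 0"
    by (simp add: weight_def formal_weight_def stab_sum_def)
  finally show ?thesis .
qed

end

end

section \<open>The idempotent in terms of transitive bisets\<close>

lemma gset_iso_trans:
  assumes X: "is_gset K X" and XY: "gset_iso K X Y" and YZ: "gset_iso K Y Z"
  shows "gset_iso K X Z"
proof -
  obtain f where f: "bij_betw f (fst X) (fst Y)" "\<And>k x. \<lbrakk>k \<in> carrier K; x \<in> fst X\<rbrakk> \<Longrightarrow> f (snd X k x) = snd Y k (f x)"
    using XY by (auto simp: gset_iso_def)
  obtain g where g: "bij_betw g (fst Y) (fst Z)" "\<And>k y. \<lbrakk>k \<in> carrier K; y \<in> fst Y\<rbrakk> \<Longrightarrow> g (snd Y k y) = snd Z k (g y)"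
    using YZ by (auto simp: gset_iso_def)
  show ?thesis
    unfolding gset_iso_def
  proof (intro exI conjI ballI)
    show "bij_betw (g \<circ> f) (fst X) (fst Z)" by (rule bij_betw_trans[OF f(1) g(1)])
    fix k x assume "k \<in> carrier K" "x \<in> fst X"
    then show "(g \<circ> f) (snd X k x) = snd Z k ((g \<circ> f) x)"
      using f g bij_betwE[OF f(1)] by simp
  qed
qed

lemma gset_iso_sym:
  assumes X: "is_gset K X" and XY: "gset_iso K X Y"
  shows "gset_iso K Y X"
proof -
  obtain f where f: "bij_betw f (fst X) (fst Y)" "\<And>k x. \<lbrakk>k \<in> carrier K; x \<in> fst X\<rbrakk> \<Longrightarrow> f (snd X k x) = snd Y k (f x)"
    using XY by (auto simp: gset_iso_def)
  let ?g = "inv_into (fst X) f"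
  show ?thesis
    unfolding gset_iso_def
  proof (intro exI conjI ballI)
    show "bij_betw ?g (fst Y) (fst X)" by (rule bij_betw_inv_into[OF f(1)])
    fix k y assume k: "k \<in> carrier K" and y: "y \<in> fst Y"
    have gy: "?g y \<in> fst X" "f (?g y) = y"
      using f(1) y by (auto simp: bij_betw_def inv_into_into f_inv_into_f)
    have "?g (snd Y k y) = ?g (f (snd X k (?g y)))" using f(2)[OF k gy(1)] gy(2) by simp
    also have "\<dots> = snd X k (?g y)"
      using bij_betw_inv_into_left[OF f(1)] is_gset_closed[OF X k gy(1)] by simp
    finally show "?g (snd Y k y) = snd X k (?g y)" .
  qed
qed

text \<open>
  The isomorphism sends \<open>a D\<close> to \<open>a D k\<^sup>-\<^sup>1 = (a k\<^sup>-\<^sup>1) (k D k\<^sup>-\<^sup>1)\<close>.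
\<close>

lemma (in group) coset_gset_conj_iso:
  assumes D: "subgroup D G" and k: "k \<in> carrier G"
  shows "gset_iso G (coset_gset G D) (coset_gset G (conj_set G k D))"
proof -
  have DG: "D \<subseteq> carrier G" by (rule subgroup.subset[OF D])
  have shift: "(a <# D) #> inv k = (a \<otimes> inv k) <# conj_set G k D" if a: "a \<in> carrier G" for a
  proof -
    have "(a \<otimes> inv k) <# conj_set G k D = ((a \<otimes> inv k) <# (k <# D)) #> inv k"
      using a k DG by (simp add: conj_set_eq_cosets coset_assoc l_coset_subset_G)
    also have "(a \<otimes> inv k) <# (k <# D) = a <# D"
      using a k DG by (simp add: lcos_m_assoc m_assoc)
    finally show ?thesis by simp
  qed
  have sub: "C \<subseteq> carrier G" if "C \<in> lcosets D" for C
    using subgroup.lcosets_carrier[OF D is_group] that by blast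
  have img: "(\<lambda>C. C #> inv k) ` (lcosets D) = lcosets (conj_set G k D)"
  proof (intro equalityI subsetI)
    fix C assume "C \<in> (\<lambda>C. C #> inv k) ` (lcosets D)"
    then obtain a where a: "a \<in> carrier G" "C = (a <# D) #> inv k" by (auto simp: LCOSETS_def)
    then have "C = (a \<otimes> inv k) <# conj_set G k D" "a \<otimes> inv k \<in> carrier G" using shift k by auto
    then show "C \<in> lcosets (conj_set G k D)" unfolding LCOSETS_def by blast
  next
    fix C assume "C \<in> lcosets (conj_set G k D)"
    then obtain a where a: "a \<in> carrier G" "C = a <# conj_set G k D" by (auto simp: LCOSETS_def)
    have "C = ((a \<otimes> k) <# D) #> inv k"
      using shift[of "a \<otimes> k"] a k by (simp add: m_assoc)
    moreover have "(a \<otimes> k) <# D \<in> lcosets D" using a k unfolding LCOSETS_def by blast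
    ultimately show "C \<in> (\<lambda>C. C #> inv k) ` (lcosets D)" by blast
  qed
  have "inj_on (\<lambda>C. C #> inv k) (lcosets D)"
  proof (rule inj_on_inverseI[where g = "\<lambda>C. C #> k"])
    fix C assume "C \<in> lcosets D"
    then show "(C #> inv k) #> k = C" using sub[of C] k by (simp add: coset_mult_assoc)
  qed
  show ?thesis
    unfolding gset_iso_def coset_gset_def fst_conv snd_conv
  proof (intro exI conjI ballI)
    show "bij_betw (\<lambda>C. C #> inv k) (lcosets D) (lcosets (conj_set G k D))"
      using \<open>inj_on _ _\<close> img by (simp add: bij_betw_def)
    fix g C assume g: "g \<in> carrier G" and C: "C \<in> lcosets D"
    have "C #> inv k \<in> lcosets (conj_set G k D)" using img C by blast
    then show "((\<lambda>C\<in>lcosets D. g <# C) C) #> inv k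
        = (\<lambda>C\<in>lcosets (conj_set G k D). g <# C) (C #> inv k)"
      using C sub[OF C] g k by (simp add: coset_assoc)
  qed
qed

lemma sum_mobius:
  assumes finR: "finite R" and PR: "P \<subseteq> R" and R: "R \<in> A"
  shows "(\<Sum>Q | Q \<in> A \<and> P \<subseteq> Q \<and> Q \<subseteq> R. mobius A P Q) = of_bool (P = R)"
proof (cases "P = R")
  case True
  then have "{Q. Q \<in> A \<and> P \<subseteq> Q \<and> Q \<subseteq> R} = {R}" using R by auto
  then show ?thesis using True finR by (simp add: mobius.simps)
next
  case False
  have set_eq: "{Q. Q \<in> A \<and> P \<subseteq> Q \<and> Q \<subseteq> R} = insert R {Q \<in> A. P \<subseteq> Q \<and> Q \<subset> R}"
    using PR R by auto
  have "finite {Q \<in> A. P \<subseteq> Q \<and> Q \<subset> R}"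
    by (rule finite_subset[of _ "Pow R"]) (use finR in auto)
  then show ?thesis
    unfolding set_eq using False finR PR mobius.simps[of A P R] by simp
qed

context fusion_system
begin

text \<open>
  The number of points with stabilizer exactly \<open>\<Delta>(P, \<phi>)\<close>, obtained from the marks. The inversion
  holds already for the test functions: for a graph \<open>E = \<Delta>(R, \<chi>)\<close> the inner sum counts the
  restrictions of \<open>\<chi>\<close> to \<open>Q\<close> that extend \<open>\<phi>\<close>, so it is \<open>1\<close> if \<open>Q \<le> R\<close> and \<open>\<chi>\<close> extends \<open>\<phi>\<close>, and \<open>0\<close>
  otherwise; summing the Moebius function over \<open>P \<le> Q \<le> R\<close> leaves only \<open>R = P\<close>.
\<close>

lemma weight_eq_graph:
  assumes gen: "F_generated p S F \<alpha>" and P: "subgroup P S" and \<phi>: "\<phi> \<in> Mor P"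
  shows "weight (S \<times>\<times> S) (\<lambda>E. of_bool (E = graph P \<phi>)) \<alpha> =
    (\<Sum>Q | subgroup Q S \<and> P \<subseteq> Q. of_int (mobius {H. subgroup H S} P Q)
      * (\<Sum>\<psi> | \<psi> \<in> Mor Q \<and> restrict \<psi> P = \<phi>. mark (graph Q \<psi>) \<alpha>))"
proof -
  let ?T = "S \<times>\<times> S" and ?\<mu> = "mobius {H. subgroup H S} P"
  have \<alpha>_loc: "\<alpha> \<in> burnside_loc p ?T" by (rule F_generated_in_loc[OF gen])
  have fin: "finite {Q. subgroup Q S}"
    by (rule finite_subset[of _ "Pow (carrier S)"]) (use subgroup.subset finite_carrier in auto)
  have pointwise: "of_bool (E = graph P \<phi>) = (\<Sum>Q | subgroup Q S \<and> P \<subseteq> Q. rat_of_int (?\<mu> Q)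
      * (\<Sum>\<psi> | \<psi> \<in> Mor Q \<and> restrict \<psi> P = \<phi>. of_bool (graph Q \<psi> \<subseteq> E)))"
    if EF: "E \<in> F_graphs" for E
  proof -
    obtain R \<chi> where E: "E = graph R \<chi>" and R: "subgroup R S" and \<chi>: "\<chi> \<in> Mor R"
      using EF by (auto simp: F_graphs_def)
    have inner: "(\<Sum>\<psi> | \<psi> \<in> Mor Q \<and> restrict \<psi> P = \<phi>. of_bool (graph Q \<psi> \<subseteq> E))
        = (of_bool (Q \<subseteq> R) * of_bool (restrict \<chi> P = \<phi>) :: rat)" if Q: "subgroup Q S" "P \<subseteq> Q" for Q
    proof -
      have "(\<Sum>\<psi> | \<psi> \<in> Mor Q \<and> restrict \<psi> P = \<phi>. of_bool (graph Q \<psi> \<subseteq> E))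
          = (\<Sum>\<psi>\<in>Mor Q. of_bool (graph Q \<psi> \<subseteq> graph R \<chi>) * (of_bool (restrict \<psi> P = \<phi>) :: rat))"
        unfolding E using finite_Mor[OF Q(1)] by (intro sum.mono_neutral_cong_left) auto
      also have "\<dots> = of_bool (Q \<subseteq> R) * of_bool (restrict (restrict \<chi> Q) P = \<phi>)"
        by (rule sum_Mor_subset_graph[OF Q(1) R \<chi>])
      also have "restrict (restrict \<chi> Q) P = restrict \<chi> P"
        using Q(2) by (auto simp: restrict_def fun_eq_iff)
      finally show ?thesis .
    qed
    have "(\<Sum>Q | subgroup Q S \<and> P \<subseteq> Q. rat_of_int (?\<mu> Q)
        * (\<Sum>\<psi> | \<psi> \<in> Mor Q \<and> restrict \<psi> P = \<phi>. of_bool (graph Q \<psi> \<subseteq> E)))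
        = (\<Sum>Q | subgroup Q S \<and> P \<subseteq> Q. of_bool (Q \<subseteq> R) * rat_of_int (?\<mu> Q)) * of_bool (restrict \<chi> P = \<phi>)"
      unfolding sum_distrib_right by (rule sum.cong[OF refl]) (simp add: inner mult_ac)
    also have "(\<Sum>Q | subgroup Q S \<and> P \<subseteq> Q. of_bool (Q \<subseteq> R) * rat_of_int (?\<mu> Q))
        = (\<Sum>Q | Q \<in> {H. subgroup H S} \<and> P \<subseteq> Q \<and> Q \<subseteq> R. rat_of_int (?\<mu> Q))"
      by (rule sum.mono_neutral_cong_right) (use fin in auto)
    also have "\<dots> = of_int (\<Sum>Q | Q \<in> {H. subgroup H S} \<and> P \<subseteq> Q \<and> Q \<subseteq> R. ?\<mu> Q)"
      by simp
    also have "\<dots> = of_bool (P = R)"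
    proof (cases "P \<subseteq> R")
      case True
      then show ?thesis
        using sum_mobius[OF finite_subgroup[OF R] True, of "{H. subgroup H S}"] R by simp
    next
      case False
      then have no_Q: "{Q. Q \<in> {H. subgroup H S} \<and> P \<subseteq> Q \<and> Q \<subseteq> R} = {}" by blast
      show ?thesis unfolding no_Q using False by auto
    qed
    finally have "(\<Sum>Q | subgroup Q S \<and> P \<subseteq> Q. rat_of_int (?\<mu> Q)
        * (\<Sum>\<psi> | \<psi> \<in> Mor Q \<and> restrict \<psi> P = \<phi>. of_bool (graph Q \<psi> \<subseteq> E)))
        = of_bool (P = R) * of_bool (restrict \<chi> P = \<phi>)" .
    moreover have "E = graph P \<phi> \<longleftrightarrow> P = R \<and> restrict \<chi> P = \<phi>"
    proof
      assume eq: "E = graph P \<phi>"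
      then have "graph P \<phi> \<subseteq> graph R \<chi>" "graph R \<chi> \<subseteq> graph P \<phi>" by (simp_all add: E)
      then show "P = R \<and> restrict \<chi> P = \<phi>"
        using graph_subset_graph_iff[OF Mor_extensional[OF P \<phi>]]
          graph_subset_graph_iff[OF Mor_extensional[OF R \<chi>]] by blast
    next
      assume "P = R \<and> restrict \<chi> P = \<phi>"
      then show "E = graph P \<phi>" using graph_restrict[of R \<chi>] by (auto simp: E)
    qed
    ultimately show ?thesis by (simp only: of_bool_conj)
  qed
  have "weight ?T (\<lambda>E. of_bool (E = graph P \<phi>)) \<alpha> = weight ?T (\<lambda>E. \<Sum>Q | subgroup Q S \<and> P \<subseteq> Q. rat_of_int (?\<mu> Q)
      * (\<Sum>\<psi> | \<psi> \<in> Mor Q \<and> restrict \<psi> P = \<phi>. of_bool (graph Q \<psi> \<subseteq> E))) \<alpha>"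
    by (rule weight_cong_F_graphs[OF gen pointwise])
  also have "\<dots> = (\<Sum>Q | subgroup Q S \<and> P \<subseteq> Q. rat_of_int (?\<mu> Q)
      * (\<Sum>\<psi> | \<psi> \<in> Mor Q \<and> restrict \<psi> P = \<phi>. mark (graph Q \<psi>) \<alpha>))"
    unfolding weight_sum weight_scale
    by (intro sum.cong refl arg_cong2[where f = "(*)"]) (simp add: mark_graph[OF \<alpha>_loc])
  finally show ?thesis .
qed

lemma graph_biset_iso:
  assumes D: "(P, \<phi>) \<in> fusion_pairs S F"
    and conj: "subgroups_conjugate (S \<times>\<times> S) (graph P \<phi>) (graph Q \<psi>)"
  shows "gset_iso (S \<times>\<times> S) (graph_biset S S P \<phi>) (graph_biset S S Q \<psi>)"
proof -
  interpret SS: group "S \<times>\<times> S" by (rule group_DirProd)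
  obtain k where k: "k \<in> carrier (S \<times>\<times> S)" "graph Q \<psi> = conj_set (S \<times>\<times> S) k (graph P \<phi>)"
    using conj by (auto simp: subgroups_conjugate_def SS.conj_set_eq_cosets)
  show ?thesis
    using SS.coset_gset_conj_iso[OF subgroup_graph k(1)] D
    unfolding graph_biset_def k(2) by (simp add: fusion_pairs_def)
qed

lemma graph_representatives_ex1:
  assumes "graph_representatives S F R" "(P, \<phi>) \<in> fusion_pairs S F"
  shows "\<exists>!r. r \<in> R \<and> subgroups_conjugate (S \<times>\<times> S) (graph P \<phi>) (graph (fst r) (snd r))"
proof -
  have "\<forall>i\<in>fusion_pairs S F. \<exists>!r. r \<in> R
      \<and> subgroups_conjugate (S \<times>\<times> S) (graph (fst i) (snd i)) (graph (fst r) (snd r))"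
    using assms(1) unfolding graph_representatives_def case_prod_unfold by (rule conjunct2)
  from bspec[OF this assms(2)] show ?thesis by simp
qed

text \<open>
  Conjugate graphs have isomorphic bisets, so the coefficients of a conjugacy class can be collected
  at its representative. This keeps the coefficients in the localization.
\<close>

lemma F_generated_along_representatives:
  assumes gen: "F_generated p S F \<alpha>" and R: "graph_representatives S F R"
  shows "\<exists>c. (\<forall>r\<in>R. c r \<in> Z_loc p)
    \<and> \<alpha> = burnside_comb p (S \<times>\<times> S) R c (\<lambda>(P, \<phi>). graph_biset S S P \<phi>)"
proof -
  let ?T = "S \<times>\<times> S"
  obtain I c where finI: "finite I" and I: "I \<subseteq> fusion_pairs S F" and c: "\<And>i. i \<in> I \<Longrightarrow> c i \<in> Z_loc p"
    and \<alpha>: "\<alpha> = burnside_comb p ?T I c (\<lambda>(P, \<phi>). graph_biset S S P \<phi>)"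
    using gen by (auto simp: F_generated_def)
  have "\<exists>r. r \<in> R \<and> subgroups_conjugate ?T (graph (fst i) (snd i)) (graph (fst r) (snd r))" if "i \<in> I" for i
  proof -
    have "(fst i, snd i) \<in> fusion_pairs S F" using subsetD[OF I that] by simp
    from graph_representatives_ex1[OF R this] show ?thesis by (rule ex1_implies_ex)
  qed
  then have "\<forall>i\<in>I. \<exists>r. r \<in> R \<and> subgroups_conjugate ?T (graph (fst i) (snd i)) (graph (fst r) (snd r))"
    by (rule ballI)
  from bchoice[OF this] obtain rep where rep: "\<And>i. i \<in> I \<Longrightarrow> rep i \<in> R"
      "\<And>i. i \<in> I \<Longrightarrow> subgroups_conjugate ?T (graph (fst i) (snd i)) (graph (fst (rep i)) (snd (rep i)))"
    by blast
  have R_sub: "R \<subseteq> fusion_pairs S F" using R by (simp add: graph_representatives_def)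
  then have finR: "finite R" using finite_fusion_pairs finite_subset by blast
  define d where "d r = (\<Sum>i | i \<in> I \<and> rep i = r. c i)" for r
  let ?X = "\<lambda>(P, \<phi>). graph_biset S S P \<phi>"
  let ?N = "\<lambda>i. nat_model ?T (?X i)"
  have X: "is_gset ?T (?X i)" if "i \<in> fusion_pairs S F" for i
    using that is_gset_graph_biset by (auto simp: fusion_pairs_def)
  have N: "is_gset ?T (?N i)" "gset_iso ?T (?X i) (?N i)" if "i \<in> fusion_pairs S F" for i
    using nat_model[OF X[OF that] group_DirProd] by auto
  have N_iso: "gset_iso ?T (?N i) (?N (rep i))" if i: "i \<in> I" for i
  proof -
    have iF: "i \<in> fusion_pairs S F" and rF: "rep i \<in> fusion_pairs S F" using i I rep(1)[OF i] R_sub by auto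
    have "gset_iso ?T (?X i) (?X (rep i))"
      using graph_biset_iso[of "fst i" "snd i" "fst (rep i)" "snd (rep i)"] iF rep(2)[OF i]
      by (simp add: case_prod_unfold)
    then have "gset_iso ?T (?X i) (?N (rep i))"
      using gset_iso_trans[OF X[OF iF] _ N(2)[OF rF]] by blast
    then show ?thesis
      using gset_iso_trans[OF N(1)[OF iF] gset_iso_sym[OF X[OF iF] N(2)[OF iF]]] by blast
  qed
  have regroup: "(\<Sum>r\<in>R. Poly_Mapping.single (?N r) (d r)) = (\<Sum>i\<in>I. Poly_Mapping.single (?N (rep i)) (c i))"
  proof -
    have "(\<Sum>i\<in>I. Poly_Mapping.single (?N (rep i)) (c i))
        = (\<Sum>r\<in>R. \<Sum>i | i \<in> I \<and> rep i = r. Poly_Mapping.single (?N (rep i)) (c i))"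
      by (rule sum.group[OF finI finR, symmetric]) (use rep(1) in blast)
    also have "\<dots> = (\<Sum>r\<in>R. Poly_Mapping.single (?N r) (d r))"
    proof (rule sum.cong[OF refl])
      fix r
      have single: "Poly_Mapping.single x (sum f J) = (\<Sum>i\<in>J. Poly_Mapping.single x (f i))"
        for x :: "('a \<times> 'a, nat) gset" and f :: "'a set \<times> ('a \<Rightarrow> 'a) \<Rightarrow> rat" and J
        by (induction J rule: infinite_finite_induct) (auto simp: single_add)
      have "(\<Sum>i | i \<in> I \<and> rep i = r. Poly_Mapping.single (?N (rep i)) (c i))
          = (\<Sum>i | i \<in> I \<and> rep i = r. Poly_Mapping.single (?N r) (c i))"
        by (rule sum.cong) auto
      then show "(\<Sum>i | i \<in> I \<and> rep i = r. Poly_Mapping.single (?N (rep i)) (c i)) = Poly_Mapping.single (?N r) (d r)"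
        by (simp only: single d_def)
    qed
    finally show ?thesis by simp
  qed
  have "\<alpha> = burnside_comb p ?T R d ?X"
    unfolding \<alpha> burnside_comb_def regroup
  proof (rule burnside_cls_eqI)
    have null: "Poly_Mapping.single (?N i) (c i) - Poly_Mapping.single (?N (rep i)) (c i) \<in> burnside_null p ?T"
      "Poly_Mapping.single (?N (rep i)) (c i) - Poly_Mapping.single (?N i) (c i) \<in> burnside_null p ?T"
      if i: "i \<in> I" for i
    proof -
      have iF: "i \<in> fusion_pairs S F" and rF: "rep i \<in> fusion_pairs S F" using i I rep(1)[OF i] R_sub by auto
      show "Poly_Mapping.single (?N i) (c i) - Poly_Mapping.single (?N (rep i)) (c i) \<in> burnside_null p ?T"
        by (rule burnside_null_single_diff[OF c[OF i] N(1)[OF iF] N(1)[OF rF] N_iso[OF i]])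
      show "Poly_Mapping.single (?N (rep i)) (c i) - Poly_Mapping.single (?N i) (c i) \<in> burnside_null p ?T"
        by (rule burnside_null_single_diff[OF c[OF i] N(1)[OF rF] N(1)[OF iF] gset_iso_sym[OF N(1)[OF iF] N_iso[OF i]]])
    qed
    show "(\<Sum>i\<in>I. Poly_Mapping.single (?N i) (c i)) - (\<Sum>i\<in>I. Poly_Mapping.single (?N (rep i)) (c i)) \<in> burnside_null p ?T"
      unfolding sum_subtractf[symmetric] by (rule burnside_null_sum) (rule null)
    show "(\<Sum>i\<in>I. Poly_Mapping.single (?N (rep i)) (c i)) - (\<Sum>i\<in>I. Poly_Mapping.single (?N i) (c i)) \<in> burnside_null p ?T"
      unfolding sum_subtractf[symmetric] by (rule burnside_null_sum) (rule null)
  qed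
  moreover have "\<forall>r\<in>R. d r \<in> Z_loc p"
    unfolding d_def by (auto intro!: Z_loc_sum[OF prime_p] c)
  ultimately show ?thesis by blast
qed

text \<open>
  A conjugate of the finite set \<open>\<Delta>(P, \<phi>)\<close> contains it only if it is equal to it. So on the transitive
  biset \<open>[P, \<phi>]\<close> the points fixed by \<open>\<Delta>(P, \<phi>)\<close> are those with exactly this stabilizer.
\<close>

lemma mark_graph_elem:
  assumes P: "subgroup P S" and \<phi>: "\<phi> \<in> Mor P"
  shows "mark (graph P \<phi>) (graph_elem p S S P \<phi>)
      = (\<Sum>k\<in>carrier (S \<times>\<times> S). of_bool (conj_set (S \<times>\<times> S) k (graph P \<phi>) = graph P \<phi>)) / of_nat (card P)"
    and "mark (graph P \<phi>) (graph_elem p S S P \<phi>) \<noteq> 0"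
proof -
  let ?T = "S \<times>\<times> S"
  interpret SS: group ?T by (rule group_DirProd)
  have DT: "graph P \<phi> \<subseteq> carrier ?T" by (rule subgroup.subset[OF subgroup_graph[OF P \<phi>]])
  have fin: "finite (graph P \<phi>)" using finite_subset[OF DT finite_DirProd] .
  have eq: "graph P \<phi> \<subseteq> conj_set ?T k (graph P \<phi>) \<longleftrightarrow> conj_set ?T k (graph P \<phi>) = graph P \<phi>"
    if k: "k \<in> carrier ?T" for k
    using card_subset_eq[of "conj_set ?T k (graph P \<phi>)" "graph P \<phi>"] SS.card_conj_set[OF k DT] fin
    by (auto simp: conj_set_def)
  have X: "is_gset ?T (graph_biset S S P \<phi>)" by (rule is_gset_graph_biset[OF P \<phi>])
  have "mark (graph P \<phi>) (graph_elem p S S P \<phi>) = stab_sum ?T (\<lambda>E. of_bool (graph P \<phi> \<subseteq> E)) (graph_biset S S P \<phi>)"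
    unfolding graph_elem_def
    using mark_eq_weight[OF burnside_basic(1)[OF prime_p group_DirProd X] DT] burnside_basic(2)[OF prime_p group_DirProd X]
    by simp
  also have "\<dots> = (\<Sum>k\<in>carrier ?T. of_bool (graph P \<phi> \<subseteq> conj_set ?T k (graph P \<phi>))) / of_nat (card P)"
    by (rule stab_sum_graph_biset[OF P \<phi>])
  also have "\<dots> = (\<Sum>k\<in>carrier ?T. of_bool (conj_set ?T k (graph P \<phi>) = graph P \<phi>)) / of_nat (card P)"
    by (intro arg_cong2[where f = "(/)"] sum.cong refl) (simp add: eq)
  finally show mark: "mark (graph P \<phi>) (graph_elem p S S P \<phi>)
      = (\<Sum>k\<in>carrier ?T. of_bool (conj_set ?T k (graph P \<phi>) = graph P \<phi>)) / of_nat (card P)" .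
  have "(\<Sum>k\<in>carrier ?T. of_bool (conj_set ?T k (graph P \<phi>) = graph P \<phi>)) > (0 :: rat)"
  proof (rule sum_pos2[OF finite_DirProd SS.one_closed])
    show "0 < (of_bool (conj_set ?T \<one>\<^bsub>?T\<^esub> (graph P \<phi>) = graph P \<phi>) :: rat)"
      using SS.conj_set_one[OF DT] by simp
  qed simp
  then show "mark (graph P \<phi>) (graph_elem p S S P \<phi>) \<noteq> 0"
    using card_subgroup_pos[OF P] unfolding mark by simp
qed

text \<open>
  Only the representative \<open>(P, \<phi>)\<close> itself has points with stabilizer \<open>\<Delta>(P, \<phi>)\<close>, because the
  stabilizers of the other bisets are not conjugate to it.
\<close>

lemma coefficient_of_representative:
  assumes R: "graph_representatives S F R" and c: "\<And>r. r \<in> R \<Longrightarrow> c r \<in> Z_loc p"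
    and r: "(P, \<phi>) \<in> R"
  shows "weight (S \<times>\<times> S) (\<lambda>E. of_bool (E = graph P \<phi>))
      (burnside_comb p (S \<times>\<times> S) R c (\<lambda>(P, \<phi>). graph_biset S S P \<phi>))
    = c (P, \<phi>) * mark (graph P \<phi>) (graph_elem p S S P \<phi>)"
proof -
  let ?T = "S \<times>\<times> S"
  interpret SS: group ?T by (rule group_DirProd)
  have R_sub: "R \<subseteq> fusion_pairs S F" using R by (simp add: graph_representatives_def)
  then have finR: "finite R" using finite_fusion_pairs finite_subset by blast
  have P: "subgroup P S" and \<phi>: "\<phi> \<in> Mor P" using r R_sub by (auto simp: fusion_pairs_def)
  let ?s = "\<lambda>Q \<psi>. (\<Sum>k\<in>carrier ?T. of_bool (conj_set ?T k (graph Q \<psi>) = graph P \<phi>)) / (of_nat (card Q) :: rat)"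
  have other: "?s Q \<psi> = 0" if Q: "(Q, \<psi>) \<in> R" and ne: "(Q, \<psi>) \<noteq> (P, \<phi>)" for Q \<psi>
  proof -
    have "conj_set ?T k (graph Q \<psi>) \<noteq> graph P \<phi>" if k: "k \<in> carrier ?T" for k
    proof
      assume eq: "conj_set ?T k (graph Q \<psi>) = graph P \<phi>"
      let ?conj = "\<lambda>r. r \<in> R \<and> subgroups_conjugate ?T (graph Q \<psi>) (graph (fst r) (snd r))"
      have QF: "(Q, \<psi>) \<in> fusion_pairs S F" by (rule subsetD[OF R_sub Q])
      have "graph Q \<psi> \<subseteq> carrier ?T"
        by (rule subgroup.subset[OF subgroup_graph]) (use QF in \<open>simp_all add: fusion_pairs_def\<close>)
      then have self: "graph Q \<psi> = conj_set ?T \<one>\<^bsub>?T\<^esub> (graph Q \<psi>)"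
        by (rule SS.conj_set_one[symmetric])
      have Pc: "?conj (P, \<phi>)"
        unfolding subgroups_conjugate_def SS.conj_set_eq_cosets[symmetric] fst_conv snd_conv
        by (rule conjI[OF r], rule bexI[OF _ k], rule eq[symmetric])
      have Qc: "?conj (Q, \<psi>)"
        unfolding subgroups_conjugate_def SS.conj_set_eq_cosets[symmetric] fst_conv snd_conv
        by (rule conjI[OF Q], rule bexI[OF _ SS.one_closed], rule self)
      note ex1 = graph_representatives_ex1[OF R QF]
      have "(Q, \<psi>) = (P, \<phi>)"
        by (rule trans[OF sym[OF the1_equality[OF ex1 Qc]] the1_equality[OF ex1 Pc]])
      with ne show False by contradiction
    qed
    then show ?thesis by simp
  qed
  have "weight ?T (\<lambda>E. of_bool (E = graph P \<phi>)) (burnside_comb p ?T R c (\<lambda>(P, \<phi>). graph_biset S S P \<phi>))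
      = (\<Sum>(Q, \<psi>)\<in>R. c (Q, \<psi>) * ?s Q \<psi>)"
    by (rule weight_F_comb[OF R_sub]) (rule c)
  also have "\<dots> = (\<Sum>i\<in>R. if i = (P, \<phi>) then c (P, \<phi>) * ?s P \<phi> else 0)"
  proof (rule sum.cong[OF refl])
    fix i assume iR: "i \<in> R"
    obtain Q \<psi> where i: "i = (Q, \<psi>)" by (cases i)
    show "(case i of (Q, \<psi>) \<Rightarrow> c (Q, \<psi>) * ?s Q \<psi>) = (if i = (P, \<phi>) then c (P, \<phi>) * ?s P \<phi> else 0)"
    proof (cases "i = (P, \<phi>)")
      case False
      then have "?s Q \<psi> = 0" using other[of Q \<psi>] iR unfolding i by blast
      then show ?thesis using False unfolding i prod.case by (simp only: mult_zero_right if_False)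
    qed (simp only: prod.case refl if_True)
  qed
  also have "\<dots> = c (P, \<phi>) * ?s P \<phi>" using finR r by simp
  finally show ?thesis by (simp add: mark_graph_elem(1)[OF P \<phi>])
qed

end

theorem theorem2:
  fixes S :: "('a, 'b) monoid_scheme" and p :: nat
    and F :: "'a set \<Rightarrow> 'a set \<Rightarrow> ('a \<Rightarrow> 'a) set" and \<omega> :: "('a \<times> 'a) formal set"
  assumes "saturated_fusion_system S p F"
    and "characteristic_idempotent p S F \<omega>"
  shows "(\<forall>P \<phi>. subgroup P S \<and> \<phi> \<in> F P (carrier S) \<longrightarrow>
            mark (graph P \<phi>) \<omega> = of_nat (order S) / of_nat (card (F P (carrier S))))
       \<and> (\<forall>D. subgroup D (S \<times>\<times> S) \<and> \<not> (\<exists>P \<phi>. subgroup P S \<and> \<phi> \<in> F P (carrier S) \<and> D = graph P \<phi>)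
            \<longrightarrow> mark D \<omega> = 0)
       \<and> (\<forall>R. graph_representatives S F R \<longrightarrow>
            \<omega> = burnside_comb p (S \<times>\<times> S) R
              (\<lambda>(P, \<phi>).
                 of_nat (order S)
                   / mark (graph P \<phi>) (graph_elem p S S P \<phi>)
                 * (\<Sum>Q | subgroup Q S \<and> P \<subseteq> Q.
                      of_nat (card {\<psi> \<in> F Q (carrier S). restrict \<psi> P = \<phi>})
                        / of_nat (card (F Q (carrier S)))
                      * of_int (mobius {H. subgroup H S} P Q)))
              (\<lambda>(P, \<phi>). graph_biset S S P \<phi>))"
proof -
  interpret saturated_fusion_system S p F by fact
  note \<omega> = assms(2)
  let ?T = "S \<times>\<times> S"
  note marks = mark_graph_characteristic_idempotent[OF \<omega>]
  let ?a = "\<lambda>(P, \<phi>). of_nat (order S) / mark (graph P \<phi>) (graph_elem p S S P \<phi>)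
      * (\<Sum>Q | subgroup Q S \<and> P \<subseteq> Q. of_nat (card {\<psi> \<in> Mor Q. restrict \<psi> P = \<phi>}) / of_nat (card (Mor Q))
          * of_int (mobius {H. subgroup H S} P Q))"
  have comb: "\<omega> = burnside_comb p ?T R ?a (\<lambda>(P, \<phi>). graph_biset S S P \<phi>)"
    if R: "graph_representatives S F R" for R
  proof -
    have gen: "F_generated p S F \<omega>" using \<omega> by (simp add: characteristic_idempotent_def F_characteristic_def)
    obtain c where c: "\<And>r. r \<in> R \<Longrightarrow> c r \<in> Z_loc p"
      and \<omega>_eq: "\<omega> = burnside_comb p ?T R c (\<lambda>(P, \<phi>). graph_biset S S P \<phi>)"
      using F_generated_along_representatives[OF gen R] by blast
    \<comment> \<open>both sides, multiplied by the mark of \<open>[P, \<phi>]\<close>, count points with stabilizer \<open>\<Delta>(P, \<phi>)\<close>\<close>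
    have "c r = ?a r" if rR: "r \<in> R" for r
    proof -
      obtain P \<phi> where r: "r = (P, \<phi>)" "(P, \<phi>) \<in> R" using rR by (cases r) auto
      then have P: "subgroup P S" and \<phi>: "\<phi> \<in> Mor P"
        using R by (auto simp: graph_representatives_def fusion_pairs_def)
      have "c (P, \<phi>) * mark (graph P \<phi>) (graph_elem p S S P \<phi>)
          = weight ?T (\<lambda>E. of_bool (E = graph P \<phi>)) \<omega>"
        unfolding \<omega>_eq by (rule coefficient_of_representative[OF R _ r(2), symmetric]) (rule c)
      also have "\<dots> = (\<Sum>Q | subgroup Q S \<and> P \<subseteq> Q. of_int (mobius {H. subgroup H S} P Q)
          * (\<Sum>\<psi> | \<psi> \<in> Mor Q \<and> restrict \<psi> P = \<phi>. mark (graph Q \<psi>) \<omega>))"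
        by (rule weight_eq_graph[OF gen P \<phi>])
      also have "\<dots> = of_nat (order S) * (\<Sum>Q | subgroup Q S \<and> P \<subseteq> Q.
          of_nat (card {\<psi> \<in> Mor Q. restrict \<psi> P = \<phi>}) / of_nat (card (Mor Q)) * of_int (mobius {H. subgroup H S} P Q))"
        unfolding sum_distrib_left by (rule sum.cong[OF refl]) (simp add: marks)
      finally show "c r = ?a r"
        using mark_graph_elem(2)[OF P \<phi>] by (simp add: r(1) field_simps)
    qed
    then have "(\<Sum>r\<in>R. Poly_Mapping.single (nat_model ?T ((\<lambda>(P, \<phi>). graph_biset S S P \<phi>) r)) (c r))
        = (\<Sum>r\<in>R. Poly_Mapping.single (nat_model ?T ((\<lambda>(P, \<phi>). graph_biset S S P \<phi>) r)) (?a r))"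
      by (intro sum.cong) auto
    then show ?thesis unfolding \<omega>_eq burnside_comb_def by simp
  qed
  show ?thesis
  proof (intro conjI allI impI)
    fix P \<phi> assume "subgroup P S \<and> \<phi> \<in> Mor P"
    then show "mark (graph P \<phi>) \<omega> = of_nat (order S) / of_nat (card (Mor P))" using marks by blast
  next
    fix D assume "subgroup D ?T \<and> \<not> (\<exists>P \<phi>. subgroup P S \<and> \<phi> \<in> Mor P \<and> D = graph P \<phi>)"
    then show "mark D \<omega> = 0" using mark_not_F_graph[OF \<omega>, of D] by (auto simp: F_graphs_def)
  next
    fix R assume "graph_representatives S F R"
    then show "\<omega> = burnside_comb p ?T R ?a (\<lambda>(P, \<phi>). graph_biset S S P \<phi>)" by (rule comb)
  qed
qed

end
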